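(* Let $\mathcal{K}=(K,+,\cdot,<,\dots)$ be a sufficiently saturated weakly o-minimal expansion of an ordered field. For a definable valuation $v$ on $K$, let $\Gamma_v$ denote its value group and $\mathbf{k}_v$ its residue field. The following are equivalent: (1) $\mathcal{K}^{\mathrm{eq}}$ has uniform finiteness. (2) For any definable valuation $v$ on $K$ (possibly trivial), the collection of all definable convex subgroups of $\Gamma_v$ and the collection of all definable convex subgroups of $(\mathbf{k}_v,+)$ have uniform finiteness. (3) There exists a definable valuation $v$ on $K$ (possibly trivial) such that the collection of all definable convex subgroups of $\Gamma_v$ and the collection of all definable convex subgroups of $(\mathbf{k}_v,+)$ have uniform finiteness. (4) For any definable valuation $v$ on $K$ (possibly trivial), the collection of all definable convex subgroups of $\Gamma_v$ has uniform finiteness. (5) For any definable valuation $v$ on $K$ (possibly trivial), the collection of all definable convex subgroups of $(\mathbf{k}_v,+)$ has uniform finiteness.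
   Context: A linearly ordered structure is weakly o-minimal if every definable subset of its universe is a finite union of convex sets. "Sufficiently saturated" includes at least $\aleph_0$-saturated (the level of saturation the paper works with throughout), so the theory of $\mathcal{K}$ is weakly o-minimal. Convention: "definable" means definable in $\mathcal{K}^{\mathrm{eq}}$, with parameters; in particular definable subgroups of $\Gamma_v$ and $\mathbf{k}_v$ are those definable in $\mathcal{K}$. In a weakly o-minimal expansion of an ordered group every definable subgroup is convex, so definable valuation rings are convex, and $\Gamma_v$, $\mathbf{k}_v$ carry the induced orders. For the trivial valuation $\mathbf{k}_v=K$ and $\Gamma_v$ is trivial. A definable set $X$ (in $\mathcal{K}^{\mathrm{eq}}$) has uniform finiteness if for every definable family $\{Y_t\subseteq X: t\in T\}$ there is $n\in\mathbb{N}$ such that for all $t\in T$: $|Y_t|=\infty \iff |Y_t|>n$. $\mathcal{K}^{\mathrm{eq}}$ has uniform finiteness if every definable set in $\mathcal{K}^{\mathrm{eq}}$ does. Let $D$ be a definable set and $\mathcal{D}$ a (not necessarily definable) collection of definable subsets of $D$. A definable set $X$ is a set of imaginaries from $\mathcal{D}$ if there is a definable relation $R\subseteq X\times D$ such that $x\mapsto R_x:=\{d\in D:(x,d)\in R\}$ is injective and $R_x\in\mathcal{D}$ for every $x\in X$. The collection $\mathcal{D}$ has uniform finiteness if every definable set of imaginaries from $\mathcal{D}$ has uniform finiteness. *)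

theory Defs
  imports Complex_Main "HOL-Algebra.Group"
begin

section \<open>First-order structures expanding an ordered field\<close>

text \<open>
  The universe is the whole type, which carries the ordered field structure; the ring operations
  and the order are built into the syntax, and the additional symbols come from the type
  variables for function and relation symbols. A symbol may be applied to argument lists of any
  length and then acts as a separate symbol for each length, so no arities are declared.
\<close>

record ('a, 'f, 'r) expansion =
  fun_int :: "'f \<Rightarrow> 'a list \<Rightarrow> 'a"
  rel_int :: "'r \<Rightarrow> 'a list \<Rightarrow> bool"

datatype 'f trm =
    Var nat
  | Add "'f trm" "'f trm"
  | Mul "'f trm" "'f trm"
  | Fn 'f "'f trm list"

datatype ('f, 'r) fml =
    Eq "'f trm" "'f trm"
  | Less "'f trm" "'f trm"
  | Rel 'r "'f trm list"
  | Neg "('f, 'r) fml"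
  | Conj "('f, 'r) fml" "('f, 'r) fml"
  | Ex nat "('f, 'r) fml"

primrec tval :: "('a::linordered_field, 'f, 'r) expansion \<Rightarrow> (nat \<Rightarrow> 'a) \<Rightarrow> 'f trm \<Rightarrow> 'a" where
  "tval K e (Var i) = e i"
| "tval K e (Add s t) = tval K e s + tval K e t"
| "tval K e (Mul s t) = tval K e s * tval K e t"
| "tval K e (Fn f ts) = fun_int K f (map (tval K e) ts)"

primrec sat :: "('a::linordered_field, 'f, 'r) expansion \<Rightarrow> (nat \<Rightarrow> 'a) \<Rightarrow> ('f, 'r) fml \<Rightarrow> bool" where
  "sat K e (Eq s t) \<longleftrightarrow> tval K e s = tval K e t"
| "sat K e (Less s t) \<longleftrightarrow> tval K e s < tval K e t"
| "sat K e (Rel r ts) \<longleftrightarrow> rel_int K r (map (tval K e) ts)"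
| "sat K e (Neg p) \<longleftrightarrow> \<not> sat K e p"
| "sat K e (Conj p q) \<longleftrightarrow> sat K e p \<and> sat K e q"
| "sat K e (Ex i p) \<longleftrightarrow> (\<exists>a. sat K (e(i := a)) p)"

primrec tvars :: "'f trm \<Rightarrow> nat set" where
  "tvars (Var i) = {i}"
| "tvars (Add s t) = tvars s \<union> tvars t"
| "tvars (Mul s t) = tvars s \<union> tvars t"
| "tvars (Fn f ts) = \<Union> (set (map tvars ts))"

primrec fvars :: "('f, 'r) fml \<Rightarrow> nat set" where
  "fvars (Eq s t) = tvars s \<union> tvars t"
| "fvars (Less s t) = tvars s \<union> tvars t"
| "fvars (Rel r ts) = \<Union> (tvars ` set ts)"
| "fvars (Neg p) = fvars p"
| "fvars (Conj p q) = fvars p \<union> fvars q"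
| "fvars (Ex i p) = fvars p - {i}"

text \<open>
  Definability with parameters: elements of the \<open>n\<close>-th power are lists of length \<open>n\<close>, which are
  assigned to the variables below \<open>n\<close>; the environment supplies the (finitely many relevant)
  parameters for the remaining variables.
\<close>

abbreviation tuples :: "nat \<Rightarrow> 'a list set" where
  "tuples n \<equiv> {xs. length xs = n}"

definition definable :: "('a::linordered_field, 'f, 'r) expansion \<Rightarrow> nat \<Rightarrow> 'a list set \<Rightarrow> bool" where
  "definable K n S \<longleftrightarrow>
     (\<exists>p e. S = {xs \<in> tuples n. sat K (\<lambda>i. if i < n then xs ! i else e i) p})"

definition ord_convex :: "'a::linorder set \<Rightarrow> bool" where
  "ord_convex C \<longleftrightarrow> (\<forall>x\<in>C. \<forall>y\<in>C. \<forall>z. x \<le> z \<and> z \<le> y \<longrightarrow> z \<in> C)"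

definition weakly_o_minimal :: "('a::linordered_field, 'f, 'r) expansion \<Rightarrow> bool" where
  "weakly_o_minimal K \<longleftrightarrow>
     (\<forall>S. definable K 1 ((\<lambda>x. [x]) ` S) \<longrightarrow>
        (\<exists>\<C>. finite \<C> \<and> (\<forall>C\<in>\<C>. ord_convex C) \<and> S = \<Union> \<C>))"

text \<open>
  Every finitely satisfiable set of formulas in the variable \<open>0\<close>, with the finitely many
  parameters assigned to the variables \<open>1, \<dots>, m\<close>, is realized.
\<close>

definition aleph0_saturated :: "('a::linordered_field, 'f, 'r) expansion \<Rightarrow> bool" where
  "aleph0_saturated K \<longleftrightarrow>
     (\<forall>m e \<Phi>. (\<forall>p\<in>\<Phi>. fvars p \<subseteq> {..m}) \<longrightarrow>
        (\<forall>\<Psi>. finite \<Psi> \<and> \<Psi> \<subseteq> \<Phi> \<longrightarrow> (\<exists>a. \<forall>p\<in>\<Psi>. sat K (e(0 := a)) p)) \<longrightarrow>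
        (\<exists>a. \<forall>p\<in>\<Phi>. sat K (e(0 := a)) p))"


section \<open>Imaginaries\<close>

text \<open>
  A sort of \<open>K\<^sup>e\<^sup>q\<close> is a quotient of a power \<open>K\<^sup>n\<close> by a definable equivalence relation, and its
  elements are the equivalence classes. Since definability is always with parameters, the
  equivalence relations may use parameters too (the parameters are regarded as named).
  A subset of a sort, or a relation between finitely many sorts, is definable in \<open>K\<^sup>e\<^sup>q\<close> iff its
  pullback under the quotient maps is definable in \<open>K\<close>. A finite product of sorts is again a sort,
  up to the obvious identification, so definable sets are taken inside a single sort.
\<close>

definition definable_equiv ::
    "('a::linordered_field, 'f, 'r) expansion \<Rightarrow> nat \<Rightarrow> ('a list \<times> 'a list) set \<Rightarrow> bool" where
  "definable_equiv K n E \<longleftrightarrow>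
     equiv (tuples n) E \<and> definable K (n + n) {xs @ ys | xs ys. (xs, ys) \<in> E}"

definition eq_definable_set ::
    "('a::linordered_field, 'f, 'r) expansion \<Rightarrow> 'a list set set \<Rightarrow> bool" where
  "eq_definable_set K X \<longleftrightarrow>
     (\<exists>n E. definable_equiv K n E \<and> X \<subseteq> tuples n // E \<and> definable K n (\<Union> X))"

text \<open>
  Relations between elements of definable sets are sets of lists of imaginaries. The predicate
  below is only meaningful for subsets of a product of definable sets.
\<close>

definition pullback :: "'a list set list set \<Rightarrow> 'a list set" where
  "pullback R = {concat xss | xss cs. cs \<in> R \<and> list_all2 (\<in>) xss cs}"

definition eq_definable_rel ::
    "('a::linordered_field, 'f, 'r) expansion \<Rightarrow> 'a list set list set \<Rightarrow> bool" where
  "eq_definable_rel K R \<longleftrightarrow> (\<exists>n. definable K n (pullback R))"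

definition eq_definable_rel2 ::
    "('a::linordered_field, 'f, 'r) expansion \<Rightarrow> ('a list set \<times> 'a list set) set \<Rightarrow> bool" where
  "eq_definable_rel2 K R \<longleftrightarrow> eq_definable_rel K {[x, y] | x y. (x, y) \<in> R}"


section \<open>Uniform finiteness\<close>

text \<open>The members of the family are the fibres \<open>{x. (x, t) \<in> Y}\<close> for \<open>t \<in> T\<close>.\<close>

definition uniform_finiteness ::
    "('a::linordered_field, 'f, 'r) expansion \<Rightarrow> 'a list set set \<Rightarrow> bool" where
  "uniform_finiteness K X \<longleftrightarrow>
     (\<forall>T Y. eq_definable_set K T \<and> Y \<subseteq> X \<times> T \<and> eq_definable_rel2 K Y \<longrightarrow>
        (\<exists>n. \<forall>t\<in>T. infinite {x. (x, t) \<in> Y} \<longleftrightarrow>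
                     infinite {x. (x, t) \<in> Y} \<or> card {x. (x, t) \<in> Y} > n))"

definition eq_uniform_finiteness :: "('a::linordered_field, 'f, 'r) expansion \<Rightarrow> bool" where
  "eq_uniform_finiteness K \<longleftrightarrow> (\<forall>X. eq_definable_set K X \<longrightarrow> uniform_finiteness K X)"

definition imaginaries_from ::
    "('a::linordered_field, 'f, 'r) expansion \<Rightarrow> 'a list set set \<Rightarrow> 'a list set set set \<Rightarrow>
     'a list set set \<Rightarrow> bool" where
  "imaginaries_from K D \<D> X \<longleftrightarrow>
     eq_definable_set K X \<and>
     (\<exists>R. R \<subseteq> X \<times> D \<and> eq_definable_rel2 K R \<and>
        inj_on (\<lambda>x. {d \<in> D. (x, d) \<in> R}) X \<and>
        (\<forall>x\<in>X. {d \<in> D. (x, d) \<in> R} \<in> \<D>))"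

definition collection_uniform_finiteness ::
    "('a::linordered_field, 'f, 'r) expansion \<Rightarrow> 'a list set set \<Rightarrow> 'a list set set set \<Rightarrow> bool" where
  "collection_uniform_finiteness K D \<D> \<longleftrightarrow>
     (\<forall>X. imaginaries_from K D \<D> X \<longrightarrow> uniform_finiteness K X)"


section \<open>Definable valuations\<close>

text \<open>Groups are in the multiplicative notation of HOL-Algebra.\<close>

record 'b ogroup = "'b monoid" +
  gle :: "'b \<Rightarrow> 'b \<Rightarrow> bool"

definition ordered_abelian_group :: "'b ogroup \<Rightarrow> bool" where
  "ordered_abelian_group G \<longleftrightarrow>
     comm_group G \<and>
     (\<forall>a\<in>carrier G. gle G a a) \<and>
     (\<forall>a\<in>carrier G. \<forall>b\<in>carrier G. gle G a b \<and> gle G b a \<longrightarrow> a = b) \<and>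
     (\<forall>a\<in>carrier G. \<forall>b\<in>carrier G. \<forall>c\<in>carrier G. gle G a b \<and> gle G b c \<longrightarrow> gle G a c) \<and>
     (\<forall>a\<in>carrier G. \<forall>b\<in>carrier G. gle G a b \<or> gle G b a) \<and>
     (\<forall>a\<in>carrier G. \<forall>b\<in>carrier G. \<forall>c\<in>carrier G. gle G a b \<longrightarrow>
        gle G (a \<otimes>\<^bsub>G\<^esub> c) (b \<otimes>\<^bsub>G\<^esub> c))"

definition convex_subgroup :: "'b set \<Rightarrow> 'b ogroup \<Rightarrow> bool" where
  "convex_subgroup H G \<longleftrightarrow>
     subgroup H G \<and>
     (\<forall>a\<in>H. \<forall>b\<in>H. \<forall>c\<in>carrier G. gle G a c \<and> gle G c b \<longrightarrow> c \<in> H)"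

definition definable_convex_subgroups ::
    "('a::linordered_field, 'f, 'r) expansion \<Rightarrow> 'a list set ogroup \<Rightarrow> 'a list set set set" where
  "definable_convex_subgroups K G = {H. eq_definable_set K H \<and> convex_subgroup H G}"

record 'a valuation =
  value_group :: "'a list set ogroup"
  val :: "'a \<Rightarrow> 'a list set"

text \<open>
  Surjective Krull valuations. The value at \<open>0\<close> is meant to be infinity and is never used;
  the field \<open>val\<close> is arbitrary there.
\<close>

definition is_valuation :: "'a::linordered_field valuation \<Rightarrow> bool" where
  "is_valuation v \<longleftrightarrow>
     ordered_abelian_group (value_group v) \<and>
     val v ` (- {0}) = carrier (value_group v) \<and>
     (\<forall>x y. x \<noteq> 0 \<and> y \<noteq> 0 \<longrightarrow> val v (x * y) = val v x \<otimes>\<^bsub>value_group v\<^esub> val v y) \<and>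
     (\<forall>x y. x \<noteq> 0 \<and> y \<noteq> 0 \<and> x + y \<noteq> 0 \<longrightarrow>
        gle (value_group v) (val v x) (val v (x + y)) \<or>
        gle (value_group v) (val v y) (val v (x + y)))"

text \<open>
  The value group, its operation, its order and the valuation map are definable in \<open>K\<^sup>e\<^sup>q\<close>;
  the element \<open>x\<close> of \<open>K\<close> is the imaginary \<open>{[x]}\<close>.
\<close>

definition definable_valuation ::
    "('a::linordered_field, 'f, 'r) expansion \<Rightarrow> 'a valuation \<Rightarrow> bool" where
  "definable_valuation K v \<longleftrightarrow>
     is_valuation v \<and>
     (let G = value_group v in
        eq_definable_set K (carrier G) \<and>
        eq_definable_rel K {[a, b, a \<otimes>\<^bsub>G\<^esub> b] | a b. a \<in> carrier G \<and> b \<in> carrier G} \<and>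
        eq_definable_rel K {[a, b] | a b. a \<in> carrier G \<and> b \<in> carrier G \<and> gle G a b} \<and>
        eq_definable_rel K {[{[x]}, val v x] | x. x \<noteq> 0})"

definition val_ring :: "'a::linordered_field valuation \<Rightarrow> 'a set" where
  "val_ring v = {x. x = 0 \<or> gle (value_group v) \<one>\<^bsub>value_group v\<^esub> (val v x)}"

definition val_ideal :: "'a::linordered_field valuation \<Rightarrow> 'a set" where
  "val_ideal v = {x \<in> val_ring v. x = 0 \<or> val v x \<noteq> \<one>\<^bsub>value_group v\<^esub>}"

definition residue_class :: "'a::linordered_field valuation \<Rightarrow> 'a \<Rightarrow> 'a list set" where
  "residue_class v x = {[y] | y. y - x \<in> val_ideal v}"

text \<open>
  The ordered additive group of the residue field, i.e. of the valuation ring modulo its maximal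
  ideal, as a set of imaginaries. The order is induced from the field.
\<close>

definition residue_add_group :: "'a::linordered_field valuation \<Rightarrow> 'a list set ogroup" where
  "residue_add_group v =
     \<lparr>carrier = residue_class v ` val_ring v,
      mult = (\<lambda>P Q. {[x + y] | x y. [x] \<in> P \<and> [y] \<in> Q}),
      one = residue_class v 0,
      gle = (\<lambda>P Q. \<exists>x y. [x] \<in> P \<and> [y] \<in> Q \<and> x \<le> y)\<rparr>"

definition value_group_uniform_finiteness ::
    "('a::linordered_field, 'f, 'r) expansion \<Rightarrow> 'a valuation \<Rightarrow> bool" where
  "value_group_uniform_finiteness K v \<longleftrightarrow>
     collection_uniform_finiteness K (carrier (value_group v))
       (definable_convex_subgroups K (value_group v))"

definition residue_field_uniform_finiteness ::
    "('a::linordered_field, 'f, 'r) expansion \<Rightarrow> 'a valuation \<Rightarrow> bool" where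
  "residue_field_uniform_finiteness K v \<longleftrightarrow>
     collection_uniform_finiteness K (carrier (residue_add_group v))
       (definable_convex_subgroups K (residue_add_group v))"

end

theory Submission
  imports Defs
begin

text \<open>
  A finite chain of cuts of \<open>K\<close> is the same as a convex equivalence relation on \<open>K\<close> with finitely
  many classes, so uniform finiteness for cuts only concerns definable families of binary relations.
  By induction on \<open>n\<close> a bound for cuts bounds the finite quotients of subsets of \<open>K\<^sup>n\<close>: the endpoints
  of the projections of the classes to the first coordinate form a finite set of cuts, and between two
  consecutive ones the fibres meet the same classes. In a divisible definable ordered group, cuts
  reduce to their stabilizers, because the number of cuts with a given stabilizer is bounded by the
  number of convex components of the set of points that lie in the upper half of the piece between
  two neighbouring cuts. Applied to \<open>(K, +)\<close> this leaves the convex subgroups of \<open>K\<close>. Given a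
  convex valuation ring, such a subgroup either is a module over it, hence a cut of the value group,
  or it lies between two neighbouring modules, where it is a convex subgroup of the residue field up
  to scaling. Applied to the value group, the reduction to stabilizers then leaves its convex subgroups.
  When only value groups are controlled, saturation turns unbounded finite chains of subgroups into
  a discrete infinite one; for the ring of all scalars preserving each of its members, every member is
  a module, and the finite initial segments of the chain are cuts of a single value group.
\<close>

section \<open>Definable predicates on environments\<close>

text \<open>A cut of \<open>K\<close> need not have an endpoint in \<open>K\<close>, so a finite set
  of cuts cannot be listed by elements; this is why every count is a count of classes of a definable
  relation. Weak o-minimality speaks about one set at a time, and what saturation makes uniform is
  the number of alternations of a definable family. A set that alternates inside each piece between
  neighbouring cuts of one type is therefore needed, and halving in the group provides the points
  where it alternates. Many bounds are exponential because a class is recovered from a set of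
  labels; only their independence of the parameters matters. A bound obtained from a value group
  depends on the ring, and different finite chains of subgroups have different rings of scalars.
  Passing to one infinite chain fixes a single ring, and discreteness, being first-order, survives
  the passage and provides finite initial segments of every length. Condition (1) gives the others
  at once, since each of them only restricts the definable sets to be considered; the content is the
  way back.\<close>

definition pre :: "'a list \<Rightarrow> (nat \<Rightarrow> 'a) \<Rightarrow> nat \<Rightarrow> 'a" where
  "pre xs \<rho> i = (if i < length xs then xs ! i else \<rho> (i - length xs))"

lemma finite_tvars: "finite (tvars t)"
  by (induction t) auto

lemma finite_fvars: "finite (fvars p)"
  by (induction p) (auto simp: finite_tvars)

lemma tval_cong: "(\<And>i. i \<in> tvars t \<Longrightarrow> e i = e' i) \<Longrightarrow> tval K e t = tval K e' t"
proof (induction t)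
  case (Fn f ts)
  have "map (tval K e) ts = map (tval K e') ts"
    using Fn by (intro map_cong) auto
  then show ?case by (simp only: tval.simps)
next
  case (Add s t) then show ?case by (metis UnCI tval.simps(2) tvars.simps(2))
next
  case (Mul s t) then show ?case by (metis UnCI tval.simps(3) tvars.simps(3))
qed auto

lemma sat_cong: "(\<And>i. i \<in> fvars p \<Longrightarrow> e i = e' i) \<Longrightarrow> sat K e p = sat K e' p"
proof (induction p arbitrary: e e')
  case (Eq s t)
  have "tval K e s = tval K e' s" "tval K e t = tval K e' t"
    using Eq by (auto intro!: tval_cong)
  then show ?case by simp
next
  case (Less s t)
  have "tval K e s = tval K e' s" "tval K e t = tval K e' t"
    using Less by (auto intro!: tval_cong)
  then show ?case by simp
next
  case (Rel r ts)
  have "map (tval K e) ts = map (tval K e') ts"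
    using Rel by (intro map_cong tval_cong) auto
  then show ?case by (simp only: sat.simps)
next
  case (Neg p) then show ?case by (metis fvars.simps(4) sat.simps(4))
next
  case (Conj p q) then show ?case by (metis UnCI fvars.simps(5) sat.simps(5))
next
  case (Ex i p)
  have "sat K (e(i := a)) p = sat K (e'(i := a)) p" for a
    using Ex.prems by (intro Ex.IH) auto
  then show ?case by simp
qed

primrec rename_trm :: "(nat \<Rightarrow> nat) \<Rightarrow> 'f trm \<Rightarrow> 'f trm" where
  "rename_trm \<sigma> (Var i) = Var (\<sigma> i)"
| "rename_trm \<sigma> (Add s t) = Add (rename_trm \<sigma> s) (rename_trm \<sigma> t)"
| "rename_trm \<sigma> (Mul s t) = Mul (rename_trm \<sigma> s) (rename_trm \<sigma> t)"
| "rename_trm \<sigma> (Fn f ts) = Fn f (map (rename_trm \<sigma>) ts)"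

lemma tvars_rename: "tvars (rename_trm \<sigma> t) = \<sigma> ` tvars t"
  by (induction t) (auto simp: image_Un)

lemma tval_rename: "tval K e (rename_trm \<sigma> t) = tval K (\<lambda>i. e (\<sigma> i)) t"
proof (induction t)
  case (Fn f ts)
  have "map (tval K e \<circ> rename_trm \<sigma>) ts = map (tval K (\<lambda>i. e (\<sigma> i))) ts"
    using Fn by (intro map_cong) auto
  then show ?case by (simp del: map_eq_conv)
qed auto

text \<open>The renaming need not be injective, so a bound variable is sent to an index outside the
  image of the variables of its body, which avoids capture. The inclusion for \<open>fvars\<close>
  is kept because \<open>aleph0_saturated\<close> restricts the variables of a type.\<close>

lemma sat_rename:
  "\<exists>p'. fvars p' \<subseteq> \<sigma> ` fvars p \<and> (\<forall>e. sat K e p' = sat K (\<lambda>i. e (\<sigma> i)) p)"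
proof (induction p arbitrary: \<sigma>)
  case (Eq s t)
  show ?case by (rule exI[of _ "Eq (rename_trm \<sigma> s) (rename_trm \<sigma> t)"])
      (auto simp: tvars_rename tval_rename)
next
  case (Less s t)
  show ?case by (rule exI[of _ "Less (rename_trm \<sigma> s) (rename_trm \<sigma> t)"])
      (auto simp: tvars_rename tval_rename)
next
  case (Rel r ts)
  have "map (tval K e \<circ> rename_trm \<sigma>) ts = map (tval K (\<lambda>i. e (\<sigma> i))) ts" for e
    by (intro map_cong) (auto simp: tval_rename)
  then show ?case by (intro exI[of _ "Rel r (map (rename_trm \<sigma>) ts)"])
      (auto simp: tvars_rename simp del: map_eq_conv)
next
  case (Neg p)
  then obtain p' where "fvars p' \<subseteq> \<sigma> ` fvars p" "\<forall>e. sat K e p' = sat K (\<lambda>i. e (\<sigma> i)) p" by blast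
  then show ?case by (intro exI[of _ "Neg p'"]) auto
next
  case (Conj p q)
  from Conj.IH(1) obtain p' where "fvars p' \<subseteq> \<sigma> ` fvars p" "\<forall>e. sat K e p' = sat K (\<lambda>i. e (\<sigma> i)) p"
    by blast
  moreover from Conj.IH(2) obtain q' where "fvars q' \<subseteq> \<sigma> ` fvars q"
    "\<forall>e. sat K e q' = sat K (\<lambda>i. e (\<sigma> i)) q" by blast
  ultimately show ?case by (intro exI[of _ "Conj p' q'"]) auto
next
  case (Ex i p)
  have "finite (\<sigma> ` fvars p)" by (simp add: finite_fvars)
  then obtain j where j: "j \<notin> \<sigma> ` fvars p" using ex_new_if_finite infinite_UNIV_nat by blast
  from Ex.IH obtain p' where p': "fvars p' \<subseteq> (\<sigma>(i := j)) ` fvars p"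
    "\<And>e. sat K e p' = sat K (\<lambda>k. e ((\<sigma>(i := j)) k)) p" by metis
  have "sat K (e(j := a)) p' = sat K ((\<lambda>k. e (\<sigma> k))(i := a)) p" for e a
    unfolding p'(2) using j by (intro sat_cong) auto
  moreover have "fvars p' - {j} \<subseteq> \<sigma> ` (fvars p - {i})"
    using p'(1) by (auto split: if_splits)
  ultimately show ?case by (intro exI[of _ "Ex j p'"]) auto
qed

text \<open>
  A definable family is a predicate on environments, the tail of the environment being the parameter
  of the family; the fixed parameters of the definition are the constants \<open>es\<close>.
\<close>

definition dfn :: "('a::linordered_field, 'f, 'r) expansion \<Rightarrow> 'a list \<Rightarrow> ((nat \<Rightarrow> 'a) \<Rightarrow> bool) \<Rightarrow> bool"
  where "dfn K es \<phi> \<longleftrightarrow> (\<exists>p. \<forall>\<rho>. \<phi> \<rho> = sat K (pre es \<rho>) p)"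

lemma dfn_support:
  assumes "dfn K es \<phi>"
  obtains N where "\<And>\<rho> \<rho>'. (\<And>i. i < N \<Longrightarrow> \<rho> i = \<rho>' i) \<Longrightarrow> \<phi> \<rho> = \<phi> \<rho>'"
proof -
  obtain p where p: "\<And>\<rho>. \<phi> \<rho> = sat K (pre es \<rho>) p" using assms unfolding dfn_def by blast
  define N where "N = Suc (Max (insert 0 (fvars p)))"
  have lt: "i < N" if "i \<in> fvars p" for i
    using that finite_fvars[of p] unfolding N_def by (simp add: less_Suc_eq_le)
  show thesis
  proof (rule that[of N])
    fix \<rho> \<rho>' :: "nat \<Rightarrow> 'a" assume *: "\<And>i. i < N \<Longrightarrow> \<rho> i = \<rho>' i"
    show "\<phi> \<rho> = \<phi> \<rho>'" unfolding p
      by (rule sat_cong) (auto simp: pre_def intro!: * dest: lt)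
  qed
qed

text \<open>Parameters sit in front of the environment, so enlarging or permuting \<open>es\<close>
  and changing the variables by \<open>s\<close> are both covered by one renaming of
  indices.\<close>

lemma dfn_reindex:
  assumes "dfn K es \<phi>" and "set es \<subseteq> set es'"
  shows "dfn K es' (\<lambda>\<rho>. \<phi> (\<lambda>i. \<rho> (s i)))"
proof -
  obtain p where p: "\<And>\<rho>. \<phi> \<rho> = sat K (pre es \<rho>) p" using assms unfolding dfn_def by blast
  have "\<forall>i. \<exists>j. i < length es \<longrightarrow> j < length es' \<and> es' ! j = es ! i"
    using assms(2) by (metis in_set_conv_nth nth_mem subset_code(1))
  then obtain c where c: "\<And>i. i < length es \<Longrightarrow> c i < length es' \<and> es' ! (c i) = es ! i" by metis
  define \<sigma> where "\<sigma> i = (if i < length es then c i else length es' + s (i - length es))" for i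
  obtain p' where p': "\<And>e. sat K e p' = sat K (\<lambda>i. e (\<sigma> i)) p" using sat_rename by metis
  have "(\<lambda>i. pre es' \<rho> (\<sigma> i)) = pre es (\<lambda>i. \<rho> (s i))" for \<rho> :: "nat \<Rightarrow> 'a"
    by (auto simp: fun_eq_iff pre_def \<sigma>_def c)
  then show ?thesis unfolding dfn_def by (intro exI[of _ p']) (simp add: p p')
qed

lemma dfn_mono: "dfn K es \<phi> \<Longrightarrow> set es \<subseteq> set es' \<Longrightarrow> dfn K es' \<phi>"
  using dfn_reindex[of K es \<phi> es' "\<lambda>i. i"] by simp

section \<open>Closure of definable families under first-order operations\<close>

named_theorems dfn_intros

lemma dfn_not [dfn_intros]: "dfn K es \<phi> \<Longrightarrow> dfn K es (\<lambda>\<rho>. \<not> \<phi> \<rho>)"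
proof -
  assume "dfn K es \<phi>"
  then obtain p where "\<And>\<rho>. \<phi> \<rho> = sat K (pre es \<rho>) p" unfolding dfn_def by blast
  then show ?thesis unfolding dfn_def by (intro exI[of _ "Neg p"]) simp
qed

lemma dfn_conj [dfn_intros]: "dfn K es \<phi> \<Longrightarrow> dfn K es \<psi> \<Longrightarrow> dfn K es (\<lambda>\<rho>. \<phi> \<rho> \<and> \<psi> \<rho>)"
proof -
  assume "dfn K es \<phi>" "dfn K es \<psi>"
  then obtain p q where "\<And>\<rho>. \<phi> \<rho> = sat K (pre es \<rho>) p" "\<And>\<rho>. \<psi> \<rho> = sat K (pre es \<rho>) q"
    unfolding dfn_def by blast
  then show ?thesis unfolding dfn_def by (intro exI[of _ "Conj p q"]) simp
qed

lemma dfn_disj [dfn_intros]: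
  assumes "dfn K es \<phi>" "dfn K es \<psi>" shows "dfn K es (\<lambda>\<rho>. \<phi> \<rho> \<or> \<psi> \<rho>)"
proof -
  have "dfn K es (\<lambda>\<rho>. \<not> (\<not> \<phi> \<rho> \<and> \<not> \<psi> \<rho>))" by (intro dfn_not dfn_conj assms)
  then show ?thesis by simp
qed

lemma dfn_imp [dfn_intros]:
  assumes "dfn K es \<phi>" "dfn K es \<psi>" shows "dfn K es (\<lambda>\<rho>. \<phi> \<rho> \<longrightarrow> \<psi> \<rho>)"
proof -
  have "dfn K es (\<lambda>\<rho>. \<not> \<phi> \<rho> \<or> \<psi> \<rho>)" by (intro dfn_not dfn_disj assms)
  then show ?thesis by simp
qed

lemma dfn_iff [dfn_intros]:
  assumes "dfn K es \<phi>" "dfn K es \<psi>" shows "dfn K es (\<lambda>\<rho>. \<phi> \<rho> \<longleftrightarrow> \<psi> \<rho>)"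
proof -
  have "dfn K es (\<lambda>\<rho>. (\<phi> \<rho> \<longrightarrow> \<psi> \<rho>) \<and> (\<psi> \<rho> \<longrightarrow> \<phi> \<rho>))" by (intro dfn_conj dfn_imp assms)
  then show ?thesis by (simp only: iff_conv_conj_imp)
qed

text \<open>The quantified value is the head of the environment and everything else is shifted, as
  with de Bruijn indices; nested quantifiers are then handled by the same rule.\<close>

lemma dfn_ex [dfn_intros]:
  assumes "dfn K es (\<lambda>\<rho>. \<phi> (\<rho> 0) (\<lambda>i. \<rho> (Suc i)))"
  shows "dfn K es (\<lambda>\<rho>. \<exists>a. \<phi> a \<rho>)"
proof -
  obtain p where p: "\<And>\<rho>. \<phi> (\<rho> 0) (\<lambda>i. \<rho> (Suc i)) = sat K (pre es \<rho>) p"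
    using assms unfolding dfn_def by blast
  obtain j where j: "\<And>i. i \<in> fvars p \<Longrightarrow> i < j" and jm: "j > length es"
    using finite_nat_set_iff_bounded finite_fvars[of p]
    by (metis finite_insert insert_iff)
  define m where "m = length es"
  \<comment> \<open>Index \<open>m\<close> carries the value to be quantified and moves to
    \<open>j\<close>; the later indices close the gap. As \<open>j\<close> exceeds all free
    variables of \<open>p\<close>, no shifted index collides with it.\<close>
  define \<sigma> where "\<sigma> i = (if i < m then i else if i = m then j else i - 1)" for i
  obtain p' where p': "\<And>e. sat K e p' = sat K (\<lambda>i. e (\<sigma> i)) p" using sat_rename by metis
  have "\<phi> a \<rho> = sat K ((pre es \<rho>)(j := a)) p'" for a \<rho>
  proof -
    have "\<phi> a \<rho> = sat K (pre es (case_nat a \<rho>)) p" using p[of "case_nat a \<rho>"] by simp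
    also have "\<dots> = sat K (\<lambda>i. ((pre es \<rho>)(j := a)) (\<sigma> i)) p"
    proof (rule sat_cong)
      fix i assume "i \<in> fvars p"
      with j have "i < j" by blast
      then show "pre es (case_nat a \<rho>) i = (\<lambda>i. ((pre es \<rho>)(j := a)) (\<sigma> i)) i"
        using jm by (auto simp: pre_def \<sigma>_def m_def split: nat.splits)
          (metis Suc_diff_Suc diff_Suc_1 diff_Suc_eq_diff_pred nat_neq_iff)
    qed
    finally show ?thesis by (simp add: p')
  qed
  then show ?thesis unfolding dfn_def by (intro exI[of _ "Ex j p'"]) simp
qed

lemma dfn_all [dfn_intros]:
  assumes "dfn K es (\<lambda>\<rho>. \<phi> (\<rho> 0) (\<lambda>i. \<rho> (Suc i)))"
  shows "dfn K es (\<lambda>\<rho>. \<forall>a. \<phi> a \<rho>)"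
proof -
  have "dfn K es (\<lambda>\<rho>. \<not> (\<exists>a. \<not> \<phi> a \<rho>))" by (intro dfn_not dfn_ex assms)
  then show ?thesis by simp
qed

text \<open>A function counts as definable when its graph is. Inverse, division and absolute value
  are not terms of the language, but can be substituted like terms in this way.\<close>

definition dterm :: "('a::linordered_field, 'f, 'r) expansion \<Rightarrow> 'a list \<Rightarrow> ((nat \<Rightarrow> 'a) \<Rightarrow> 'a) \<Rightarrow> bool"
  where "dterm K es f \<longleftrightarrow> dfn K es (\<lambda>\<rho>. \<rho> 0 = f (\<lambda>i. \<rho> (Suc i)))"

text \<open>By finite support only the arguments below \<open>N\<close> matter, and they are
  replaced one at a time by quantifying over the new value. In the induction the old arguments
  occupy the positions below \<open>N\<close> and the environment of the functions
  \<open>F i\<close> starts at \<open>N\<close>, so the two do not interfere.\<close>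

lemma dfn_subst:
  assumes \<phi>: "dfn K es \<phi>" and F: "\<And>i. dterm K es (F i)"
  shows "dfn K es (\<lambda>\<rho>. \<phi> (\<lambda>i. F i \<rho>))"
proof -
  obtain N where N: "\<And>\<rho> \<rho>'. (\<And>i. i < N \<Longrightarrow> \<rho> i = \<rho>' i) \<Longrightarrow> \<phi> \<rho> = \<phi> \<rho>'"
    using dfn_support[OF \<phi>] by blast
  have *: "dfn K es (\<lambda>\<rho>. \<phi> (\<lambda>i. if i < k then F i (\<lambda>j. \<rho> (N + j)) else \<rho> i))" if "k \<le> N" for k
    using that
  proof (induction k)
    case 0
    then show ?case using \<phi> by simp
  next
    case (Suc k)
    have "dfn K es (\<lambda>\<rho>. \<exists>a. a = F k (\<lambda>j. \<rho> (N + j)) \<and>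
        \<phi> (\<lambda>i. if i < k then F i (\<lambda>j. \<rho> (N + j)) else if i = k then a else \<rho> i))"
    proof (intro dfn_ex dfn_conj)
      show "dfn K es (\<lambda>\<rho>. \<rho> 0 = F k (\<lambda>j. \<rho> (Suc (N + j))))"
        using dfn_reindex[OF F[of k, unfolded dterm_def] order_refl,
            of "case_nat 0 (\<lambda>j. Suc (N + j))"] by simp
      have eq: "(\<lambda>i. if i < k then F i (\<lambda>j. \<rho> (Suc (N + j))) else if i = k then \<rho> 0 else \<rho> (Suc i)) =
         (\<lambda>i. if i < k then F i (\<lambda>j. \<rho> (if N + j = k then 0 else Suc (N + j)))
           else \<rho> (if i = k then 0 else Suc i))" for \<rho> :: "nat \<Rightarrow> 'a"
        using Suc.prems by (auto simp: fun_eq_iff)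
      show "dfn K es (\<lambda>\<rho>. \<phi> (\<lambda>i. if i < k then F i (\<lambda>j. \<rho> (Suc (N + j)))
          else if i = k then \<rho> 0 else \<rho> (Suc i)))"
        unfolding eq
        using dfn_reindex[OF Suc.IH[OF Suc_leD[OF Suc.prems]] order_refl,
            of "\<lambda>i. if i = k then 0 else Suc i"] by simp
    qed
    moreover have "(\<exists>a. a = F k (\<lambda>j. \<rho> (N + j)) \<and>
        \<phi> (\<lambda>i. if i < k then F i (\<lambda>j. \<rho> (N + j)) else if i = k then a else \<rho> i)) =
        \<phi> (\<lambda>i. if i < Suc k then F i (\<lambda>j. \<rho> (N + j)) else \<rho> i)" for \<rho>
    proof -
      have "(\<lambda>i. if i < k then F i (\<lambda>j. \<rho> (N + j)) else if i = k then F k (\<lambda>j. \<rho> (N + j)) else \<rho> i)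
        = (\<lambda>i. if i < Suc k then F i (\<lambda>j. \<rho> (N + j)) else \<rho> i)"
        by (auto simp: fun_eq_iff less_Suc_eq)
      then show ?thesis by simp
    qed
    ultimately show ?case by simp
  qed
  have "dfn K es (\<lambda>\<rho>. \<phi> (\<lambda>i. if i < N then F i (\<lambda>j. \<rho> (N + j - N)) else \<rho> (i - N)))"
    using dfn_reindex[OF *[OF order_refl] order_refl, of "\<lambda>i. i - N"] by simp
  moreover have "\<phi> (\<lambda>i. if i < N then F i (\<lambda>j. \<rho> (N + j - N)) else \<rho> (i - N)) = \<phi> (\<lambda>i. F i \<rho>)" for \<rho>
    by (rule N) simp
  ultimately show ?thesis by simp
qed

lemma dfn_atoms:
  "dfn K es (\<lambda>\<rho>. \<rho> i = \<rho> j)" "dfn K es (\<lambda>\<rho>. \<rho> i < \<rho> j)"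
  "dfn K es (\<lambda>\<rho>. \<rho> k = \<rho> i + \<rho> j)" "dfn K es (\<lambda>\<rho>. \<rho> k = \<rho> i * \<rho> j)"
proof -
  let ?v = "\<lambda>i. Var (length es + i)"
  show "dfn K es (\<lambda>\<rho>. \<rho> i = \<rho> j)"
    unfolding dfn_def by (intro exI[of _ "Eq (?v i) (?v j)"]) (auto simp: pre_def)
  show "dfn K es (\<lambda>\<rho>. \<rho> i < \<rho> j)"
    unfolding dfn_def by (intro exI[of _ "Less (?v i) (?v j)"]) (auto simp: pre_def)
  show "dfn K es (\<lambda>\<rho>. \<rho> k = \<rho> i + \<rho> j)"
    unfolding dfn_def by (intro exI[of _ "Eq (?v k) (Add (?v i) (?v j))"]) (auto simp: pre_def)
  show "dfn K es (\<lambda>\<rho>. \<rho> k = \<rho> i * \<rho> j)"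
    unfolding dfn_def by (intro exI[of _ "Eq (?v k) (Mul (?v i) (?v j))"]) (auto simp: pre_def)
qed

lemma dterm_var [dfn_intros]: "dterm K es (\<lambda>\<rho>. \<rho> i)"
  unfolding dterm_def by (rule dfn_atoms)

lemma dterm_const: "c \<in> set es \<Longrightarrow> dterm K es (\<lambda>\<rho>. c)"
proof -
  assume "c \<in> set es"
  then obtain i where "i < length es" "es ! i = c" by (metis in_set_conv_nth)
  then show ?thesis unfolding dterm_def dfn_def
    by (intro exI[of _ "Eq (Var (length es)) (Var i)"]) (auto simp: pre_def)
qed

lemma dterm_case_nat: "dterm K es f \<Longrightarrow> (\<And>i. dterm K es (T i)) \<Longrightarrow> dterm K es (case_nat f T i)"
  by (cases i) auto

lemma dfn_app1:
  assumes "dfn K es (\<lambda>\<rho>. D (\<lambda>i. \<rho> (Suc i)) (\<rho> 0))" "\<And>i. dterm K es (T i)" "dterm K es f"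
  shows "dfn K es (\<lambda>\<rho>. D (\<lambda>i. T i \<rho>) (f \<rho>))"
proof -
  have "dfn K es (\<lambda>\<rho>. D (\<lambda>i. case_nat f T (Suc i) \<rho>) (case_nat f T 0 \<rho>))"
    by (rule dfn_subst[OF assms(1)]) (intro dterm_case_nat assms(2,3))
  then show ?thesis by simp
qed

lemma dfn_app2:
  assumes "dfn K es (\<lambda>\<rho>. E (\<lambda>i. \<rho> (Suc (Suc i))) (\<rho> 0) (\<rho> (Suc 0)))"
    "\<And>i. dterm K es (T i)" "dterm K es f" "dterm K es g"
  shows "dfn K es (\<lambda>\<rho>. E (\<lambda>i. T i \<rho>) (f \<rho>) (g \<rho>))"
proof -
  let ?F = "case_nat f (case_nat g T)"
  have "dfn K es (\<lambda>\<rho>. E (\<lambda>i. ?F (Suc (Suc i)) \<rho>) (?F 0 \<rho>) (?F (Suc 0) \<rho>))"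
    by (rule dfn_subst[OF assms(1)]) (intro dterm_case_nat assms(2-4))
  then show ?thesis by simp
qed

lemma dfn_eq [dfn_intros]: "dterm K es f \<Longrightarrow> dterm K es g \<Longrightarrow> dfn K es (\<lambda>\<rho>. f \<rho> = g \<rho>)"
  by (rule dfn_app2[where E = "\<lambda>_. (=)" and T = "\<lambda>i \<rho>. \<rho> i"]) (rule dfn_atoms dterm_var | assumption)+

lemma dfn_less [dfn_intros]: "dterm K es f \<Longrightarrow> dterm K es g \<Longrightarrow> dfn K es (\<lambda>\<rho>. f \<rho> < g \<rho>)"
  by (rule dfn_app2[where E = "\<lambda>_. (<)" and T = "\<lambda>i \<rho>. \<rho> i"]) (rule dfn_atoms dterm_var | assumption)+

lemma dfn_le [dfn_intros]: "dterm K es f \<Longrightarrow> dterm K es g \<Longrightarrow> dfn K es (\<lambda>\<rho>. f \<rho> \<le> g \<rho>)"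
  unfolding not_less[symmetric] by (intro dfn_intros)

lemma dterm_graph:
  assumes "dfn K es (\<lambda>\<rho>. P (\<lambda>i. \<rho> (Suc i)) (\<rho> 0))" "\<And>\<rho> a. P \<rho> a \<longleftrightarrow> a = f \<rho>"
  shows "dterm K es f"
  using assms(1) unfolding dterm_def assms(2) .

lemma dterm_reindex: "dterm K es f \<Longrightarrow> dterm K es (\<lambda>\<rho>. f (\<lambda>i. \<rho> (s i)))"
  unfolding dterm_def
  by (drule dfn_reindex[OF _ order_refl, of _ _ _ "case_nat 0 (\<lambda>i. Suc (s i))"]) simp

lemma dterm_app2:
  assumes "\<And>i j k. dfn K es (\<lambda>\<rho>. \<rho> k = h (\<rho> i) (\<rho> j))" "dterm K es f" "dterm K es g"
  shows "dterm K es (\<lambda>\<rho>. h (f \<rho>) (g \<rho>))"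
proof -
  let ?F = "case_nat (\<lambda>\<rho>. \<rho> 0) (case_nat (\<lambda>\<rho>. f (\<lambda>i. \<rho> (Suc i))) (\<lambda>n \<rho>. g (\<lambda>i. \<rho> (Suc i))))"
  have "dfn K es (\<lambda>\<rho>. ?F 0 \<rho> = h (?F (Suc 0) \<rho>) (?F (Suc (Suc 0)) \<rho>))"
    by (rule dfn_subst[OF assms(1)]) (intro dterm_case_nat dterm_var dterm_reindex[OF assms(2), of Suc]
      dterm_reindex[OF assms(3), of Suc])
  then show ?thesis by (simp add: dterm_def)
qed

lemma dterm_add [dfn_intros]: "dterm K es f \<Longrightarrow> dterm K es g \<Longrightarrow> dterm K es (\<lambda>\<rho>. f \<rho> + g \<rho>)"
  by (rule dterm_app2[where h = "(+)"]) (rule dfn_atoms | assumption)+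

lemma dterm_mult [dfn_intros]: "dterm K es f \<Longrightarrow> dterm K es g \<Longrightarrow> dterm K es (\<lambda>\<rho>. f \<rho> * g \<rho>)"
  by (rule dterm_app2[where h = "(*)"]) (rule dfn_atoms | assumption)+

lemma dterm_0 [dfn_intros]: "dterm K es (\<lambda>\<rho>. 0)"
proof (rule dterm_graph)
  show "dfn K es (\<lambda>\<rho>. \<rho> 0 + \<rho> 0 = \<rho> 0)" by (intro dfn_intros)
qed simp

lemma dterm_1 [dfn_intros]: "dterm K es (\<lambda>\<rho>. 1)"
proof (rule dterm_graph)
  show "dfn K es (\<lambda>\<rho>. \<rho> 0 * \<rho> 0 = \<rho> 0 \<and> \<rho> 0 \<noteq> 0)" by (intro dfn_intros)
qed auto

lemma dterm_minus [dfn_intros]: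
  assumes "dterm K es f" shows "dterm K es (\<lambda>\<rho>. - f \<rho>)"
proof (rule dterm_graph)
  show "dfn K es (\<lambda>\<rho>. \<rho> 0 + f (\<lambda>i. \<rho> (Suc i)) = 0)"
    by (intro dfn_intros dterm_reindex[OF assms, of Suc])
qed (simp add: eq_neg_iff_add_eq_0)

lemma dterm_diff [dfn_intros]: "dterm K es f \<Longrightarrow> dterm K es g \<Longrightarrow> dterm K es (\<lambda>\<rho>. f \<rho> - g \<rho>)"
  unfolding diff_conv_add_uminus by (intro dfn_intros)

lemma dterm_inverse [dfn_intros]:
  assumes "dterm K es f" shows "dterm K es (\<lambda>\<rho>. inverse (f \<rho>))"
proof (rule dterm_graph)
  show "dfn K es (\<lambda>\<rho>. (f (\<lambda>i. \<rho> (Suc i)) = 0 \<and> \<rho> 0 = 0) \<or> \<rho> 0 * f (\<lambda>i. \<rho> (Suc i)) = 1)"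
    by (intro dfn_intros dterm_reindex[OF assms, of Suc])
  show "(f \<rho> = 0 \<and> a = 0) \<or> a * f \<rho> = 1 \<longleftrightarrow> a = inverse (f \<rho>)" for \<rho> a
    by (cases "f \<rho> = 0") (auto simp: field_simps)
qed

lemma dterm_divide [dfn_intros]: "dterm K es f \<Longrightarrow> dterm K es g \<Longrightarrow> dterm K es (\<lambda>\<rho>. f \<rho> / g \<rho>)"
  unfolding divide_inverse by (intro dfn_intros)

lemma dterm_abs [dfn_intros]:
  assumes "dterm K es f" shows "dterm K es (\<lambda>\<rho>. \<bar>f \<rho>\<bar>)"
proof (rule dterm_graph)
  show "dfn K es (\<lambda>\<rho>. (f (\<lambda>i. \<rho> (Suc i)) < 0 \<and> \<rho> 0 = - f (\<lambda>i. \<rho> (Suc i))) \<or>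
      (\<not> f (\<lambda>i. \<rho> (Suc i)) < 0 \<and> \<rho> 0 = f (\<lambda>i. \<rho> (Suc i))))"
    by (intro dfn_intros dterm_reindex[OF assms, of Suc])
qed auto

section \<open>Consequences of saturation and weak o-minimality\<close>

text \<open>\<open>definable\<close> puts the tuple before the parameters and \<open>dfn\<close>
  puts it after them; the renaming exchanges the two blocks.\<close>

lemma dfn_imp_definable:
  assumes "dfn K es (\<lambda>\<rho>. map \<rho> [0..<n] \<in> S)" "S \<subseteq> tuples n"
  shows "definable K n S"
proof -
  obtain p where p: "\<And>\<rho>. map \<rho> [0..<n] \<in> S \<longleftrightarrow> sat K (pre es \<rho>) p"
    using assms(1) unfolding dfn_def by blast
  define m where "m = length es"
  \<comment> \<open>Indices beyond both blocks are sent to \<open>n + m\<close>, where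
    \<open>e\<close> has the default value 0, in agreement with the \<open>\<rho>\<close> chosen
    below.\<close>
  define \<sigma> where "\<sigma> i = (if i < m then n + i else if i - m < n then i - m else n + m)" for i
  define e where "e i = (if i - n < m then es ! (i - n) else 0)" for i
  obtain p' where p': "\<And>e. sat K e p' = sat K (\<lambda>i. e (\<sigma> i)) p" using sat_rename by metis
  have "xs \<in> S \<longleftrightarrow> sat K (\<lambda>i. if i < n then xs ! i else e i) p'" if "length xs = n" for xs
  proof -
    define \<rho> where "\<rho> = (\<lambda>i. if i < n then xs ! i else 0)"
    have "map \<rho> [0..<n] = xs" using that by (auto simp: \<rho>_def intro: nth_equalityI)
    moreover have "pre es \<rho> = (\<lambda>i. if \<sigma> i < n then xs ! \<sigma> i else e (\<sigma> i))"
      by (auto simp: fun_eq_iff pre_def \<rho>_def \<sigma>_def e_def m_def)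
    ultimately show ?thesis using p[of \<rho>] by (simp add: p')
  qed
  then show ?thesis unfolding definable_def using assms(2) by (intro exI[of _ p'] exI[of _ e]) auto
qed

lemma definable_imp_dfn:
  assumes "definable K n S"
  obtains es where "dfn K es (\<lambda>\<rho>. map \<rho> [0..<n] \<in> S)"
proof -
  obtain p e where S: "S = {xs \<in> tuples n. sat K (\<lambda>i. if i < n then xs ! i else e i) p}"
    using assms unfolding definable_def by blast
  obtain L where L: "\<And>i. i \<in> fvars p \<Longrightarrow> i < L"
    using finite_nat_set_iff_bounded finite_fvars[of p] by metis
  define es where "es = map e [n..<n+L]"
  define \<sigma> where "\<sigma> i = (if i < n then L + i else i - n)" for i
  obtain p' where p': "\<And>e. sat K e p' = sat K (\<lambda>i. e (\<sigma> i)) p" using sat_rename by metis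
  have "map \<rho> [0..<n] \<in> S \<longleftrightarrow> sat K (pre es \<rho>) p'" for \<rho>
  proof -
    have "map \<rho> [0..<n] \<in> S \<longleftrightarrow> sat K (\<lambda>i. if i < n then map \<rho> [0..<n] ! i else e i) p"
      by (simp add: S)
    also have "\<dots> \<longleftrightarrow> sat K (\<lambda>i. pre es \<rho> (\<sigma> i)) p"
      by (rule sat_cong) (use L in \<open>auto simp: pre_def es_def \<sigma>_def dest!: L\<close>)
    finally show ?thesis by (simp add: p')
  qed
  then have "dfn K es (\<lambda>\<rho>. map \<rho> [0..<n] \<in> S)" unfolding dfn_def by blast
  then show thesis by (rule that)
qed

text \<open>Quantification over a whole tail of the environment is first-order because only the
  coordinates below \<open>N\<close> matter; the induction descends from \<open>N\<close> to
  \<open>k\<close>.\<close>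

lemma dfn_ex_env:
  assumes "dfn K es \<phi>"
  shows "dfn K es (\<lambda>\<rho>. \<exists>\<rho>'. \<phi> (\<lambda>i. if i < k then \<rho> i else \<rho>' i))"
proof -
  obtain N where N: "\<And>\<rho> \<rho>'. (\<And>i. i < N \<Longrightarrow> \<rho> i = \<rho>' i) \<Longrightarrow> \<phi> \<rho> = \<phi> \<rho>'"
    using dfn_support[OF assms] by blast
  show ?thesis
  proof (cases "k \<le> N")
    case True
    then show ?thesis
    proof (induction rule: inc_induct)
      case base
      have "\<phi> (\<lambda>i. if i < N then \<rho> i else \<rho>' i) = \<phi> \<rho>" for \<rho> \<rho>' by (rule N) simp
      then show ?case using assms by simp
    next
      case (step k)
      have "dfn K es (\<lambda>\<rho>. \<exists>a \<rho>'. \<phi> (\<lambda>i. if i < Suc k then (if i = k then a else \<rho> i) else \<rho>' i))"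
      proof (rule dfn_ex)
        have "dfn K es (\<lambda>\<rho>. \<exists>\<rho>'. \<phi> (\<lambda>i. if i < Suc k then \<rho> (if i = k then 0 else Suc i) else \<rho>' i))"
          using dfn_reindex[OF step.IH order_refl, of "\<lambda>i. if i = k then 0 else Suc i"] .
        moreover have "(\<lambda>i. if i < Suc k then (if i = k then \<rho> 0 else \<rho> (Suc i)) else \<rho>' i) =
            (\<lambda>i. if i < Suc k then \<rho> (if i = k then 0 else Suc i) else \<rho>' i)"
          for \<rho> \<rho>' :: "nat \<Rightarrow> 'a" by auto
        ultimately show "dfn K es (\<lambda>\<rho>. \<exists>\<rho>'. \<phi> (\<lambda>i. if i < Suc k
            then (if i = k then \<rho> 0 else \<rho> (Suc i)) else \<rho>' i))" by simp
      qed
      moreover have "(\<exists>a \<rho>'. \<phi> (\<lambda>i. if i < Suc k then (if i = k then a else \<rho> i) else \<rho>' i)) =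
          (\<exists>\<rho>'. \<phi> (\<lambda>i. if i < k then \<rho> i else \<rho>' i))" (is "?l = ?r") for \<rho>
      proof
        assume ?l
        then obtain a \<rho>' where *: "\<phi> (\<lambda>i. if i < Suc k then (if i = k then a else \<rho> i) else \<rho>' i)"
          by blast
        have "(\<lambda>i. if i < Suc k then (if i = k then a else \<rho> i) else \<rho>' i) =
          (\<lambda>i. if i < k then \<rho> i else (\<rho>'(k := a)) i)" by (auto simp: fun_eq_iff less_Suc_eq)
        with * show ?r by (intro exI[of _ "\<rho>'(k := a)"]) (simp only:)
      next
        assume ?r
        then obtain \<rho>' where *: "\<phi> (\<lambda>i. if i < k then \<rho> i else \<rho>' i)" by blast
        have "(\<lambda>i. if i < Suc k then (if i = k then \<rho>' k else \<rho> i) else \<rho>' i) =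
          (\<lambda>i. if i < k then \<rho> i else \<rho>' i)" by (auto simp: fun_eq_iff less_Suc_eq)
        with * show ?l by (intro exI[of _ "\<rho>' k"] exI[of _ \<rho>']) (simp only:)
      qed
      ultimately show ?case by simp
    qed
  next
    case False
    then have "\<phi> (\<lambda>i. if i < k then \<rho> i else \<rho>' i) = \<phi> \<rho>" for \<rho> \<rho>' by (intro N) simp
    then show ?thesis using assms by simp
  qed
qed

text \<open>In a decreasing sequence of conditions any finitely many are implied by a single one, so
  finite satisfiability is satisfiability of each condition.\<close>

lemma saturation1:
  assumes "aleph0_saturated K" "\<And>n. dfn K es (\<lambda>\<rho>. R n (\<rho> 0))"
    "\<And>n a. R (Suc n) a \<Longrightarrow> R n a" "\<And>n. \<exists>a. R n a"
  shows "\<exists>a. \<forall>n. R n a"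
proof -
  obtain p where p: "\<And>n \<rho>. R n (\<rho> 0) = sat K (pre es \<rho>) (p n)"
    using assms(2) unfolding dfn_def by metis
  define m where "m = length es"
  \<comment> \<open>The parameters go to the variables from 1 to \<open>m\<close> and everything
    else to the variable 0, the shape prescribed by \<open>aleph0_saturated\<close>.\<close>
  define \<sigma> where "\<sigma> i = (if i < m then Suc i else 0)" for i
  define e where "e i = es ! (i - 1)" for i
  have "\<forall>n. \<exists>q. fvars q \<subseteq> \<sigma> ` fvars (p n) \<and> (\<forall>e. sat K e q = sat K (\<lambda>i. e (\<sigma> i)) (p n))"
    using sat_rename by blast
  then obtain q where q: "\<And>n. fvars (q n) \<subseteq> \<sigma> ` fvars (p n)"
    "\<And>n e. sat K e (q n) = sat K (\<lambda>i. e (\<sigma> i)) (p n)" by metis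
  have qR: "sat K (e(0 := a)) (q n) = R n a" for a n
  proof -
    have "(\<lambda>i. (e(0 := a)) (\<sigma> i)) = pre es (\<lambda>_. a)"
      by (auto simp: fun_eq_iff pre_def \<sigma>_def e_def m_def)
    then show ?thesis using p[of n "\<lambda>_. a"] by (simp add: q(2))
  qed
  have dec: "R n a" if "R N a" "n \<le> N" for n N a
    using that(2,1) by (induction rule: dec_induct) (auto intro: assms(3))
  have "\<forall>p\<in>range q. fvars p \<subseteq> {..m}" using q(1) by (fastforce simp: \<sigma>_def split: if_splits)
  moreover have "\<exists>a. \<forall>p\<in>\<Psi>. sat K (e(0 := a)) p" if \<Psi>: "finite \<Psi>" "\<Psi> \<subseteq> range q" for \<Psi>
  proof -
    obtain I where I: "finite I" "\<Psi> = q ` I" using \<Psi> by (meson finite_subset_image)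
    obtain N where N: "\<And>i. i \<in> I \<Longrightarrow> i < N" using finite_nat_set_iff_bounded I(1) by metis
    obtain a where "R N a" using assms(4) by blast
    then have "sat K (e(0 := a)) (q i)" if "i \<in> I" for i
      unfolding qR by (rule dec[OF _ less_imp_le[OF N[OF that]]])
    then show ?thesis using I(2) by blast
  qed
  ultimately obtain a where "\<forall>p\<in>range q. sat K (e(0 := a)) p"
    using assms(1)[unfolded aleph0_saturated_def, rule_format, of "range q" m e] by blast
  then show ?thesis by (auto simp: qR)
qed

text \<open>The coordinates are realized one after another: the first is chosen so that every
  condition stays solvable in the remaining ones, and then it joins the parameters.\<close>

lemma saturation:
  assumes "aleph0_saturated K" "\<And>n. dfn K es (P n)"
    "\<And>n \<rho> \<rho>'. (\<And>i. i < N \<Longrightarrow> \<rho> i = \<rho>' i) \<Longrightarrow> P n \<rho> = P n \<rho>'"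
    "\<And>n \<rho>. P (Suc n) \<rho> \<Longrightarrow> P n \<rho>" "\<And>n. \<exists>\<rho>. P n \<rho>"
  shows "\<exists>\<rho>. \<forall>n. P n \<rho>"
  using assms(2-)
proof (induction N arbitrary: es P)
  case 0
  then have "P n \<rho>" for n \<rho> by blast
  then show ?case by blast
next
  case (Suc N)
  have "\<exists>a. \<forall>n. \<exists>\<rho>. P n (case_nat a \<rho>)"
  proof (rule saturation1[OF assms(1)])
    show "dfn K es (\<lambda>\<rho>. \<exists>\<rho>'. P n (case_nat (\<rho> 0) \<rho>'))" for n
    proof -
      have "(\<exists>\<rho>'. P n (\<lambda>i. if i < 1 then \<rho> i else \<rho>' i)) = (\<exists>\<rho>'. P n (case_nat (\<rho> 0) \<rho>'))"
        (is "?l = ?r") for \<rho>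
      proof
        assume ?l
        then obtain \<rho>' where *: "P n (\<lambda>i. if i < 1 then \<rho> i else \<rho>' i)" by blast
        have "(\<lambda>i. if i < 1 then \<rho> i else \<rho>' i) = case_nat (\<rho> 0) (\<lambda>i. \<rho>' (Suc i))"
          by (auto simp: fun_eq_iff split: nat.splits)
        with * show ?r by metis
      next
        assume ?r
        then obtain \<rho>' where *: "P n (case_nat (\<rho> 0) \<rho>')" by blast
        have "(\<lambda>i. if i < 1 then \<rho> i else \<rho>' (i - 1)) = case_nat (\<rho> 0) \<rho>'"
          by (auto simp: fun_eq_iff split: nat.splits)
        with * show ?l by (intro exI[of _ "\<lambda>i. \<rho>' (i - 1)"]) simp
      qed
      then show ?thesis using dfn_ex_env[OF Suc.prems(1), of n 1] by simp
    qed
    show "\<exists>\<rho>. P n (case_nat a \<rho>)" if "\<exists>\<rho>. P (Suc n) (case_nat a \<rho>)" for n a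
      using that Suc.prems(3) by blast
    show "\<exists>a \<rho>. P n (case_nat a \<rho>)" for n
    proof -
      obtain \<rho> where *: "P n \<rho>" using Suc.prems(4) by blast
      have "\<rho> = case_nat (\<rho> 0) (\<lambda>i. \<rho> (Suc i))" by (auto simp: fun_eq_iff split: nat.splits)
      with * show ?thesis by metis
    qed
  qed
  then obtain a where a: "\<And>n. \<exists>\<rho>. P n (case_nat a \<rho>)" by blast
  have "\<exists>\<rho>. \<forall>n. P n (case_nat a \<rho>)"
  proof (rule Suc.IH[of "a # es"])
    show "dfn K (a # es) (\<lambda>\<rho>. P n (case_nat a \<rho>))" for n
    proof -
      have "dfn K (a # es) (P n)" using Suc.prems(1) by (rule dfn_mono) auto
      have "dfn K (a # es) (\<lambda>\<rho>. P n (\<lambda>i. case_nat (\<lambda>_. a) (\<lambda>i \<rho>. \<rho> i) i \<rho>))"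
        by (rule dfn_subst[OF \<open>dfn K (a # es) (P n)\<close>])
          (rule dterm_case_nat dterm_const dterm_var | simp)+
      moreover have "(\<lambda>i. case_nat (\<lambda>_. a) (\<lambda>i \<rho>. \<rho> i) i \<rho>) = case_nat a \<rho>" for \<rho>
        by (auto simp: fun_eq_iff split: nat.splits)
      ultimately show ?thesis by simp
    qed
    show "P n (case_nat a \<rho>) = P n (case_nat a \<rho>')" if "\<And>i. i < N \<Longrightarrow> \<rho> i = \<rho>' i" for n \<rho> \<rho>'
      by (rule Suc.prems(2)) (use that in \<open>auto split: nat.splits\<close>)
  qed (use Suc.prems(3) a in blast)+
  then show ?case by blast
qed

text \<open>Counts how often \<open>D\<close> is entered from outside up to \<open>x\<close>, which
  measures the number of convex components without naming them. For fixed \<open>n\<close> it is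
  first-order in the parameters of \<open>D\<close>, as saturation requires.\<close>

primrec alt :: "('a::linorder \<Rightarrow> bool) \<Rightarrow> nat \<Rightarrow> 'a \<Rightarrow> bool" where
  "alt D 0 x \<longleftrightarrow> True"
| "alt D (Suc n) x \<longleftrightarrow> (\<exists>d. d \<le> x \<and> D d \<and> (\<exists>d'. d' < d \<and> \<not> D d' \<and> alt D n d'))"

lemma alt_mono: "alt D n x \<Longrightarrow> x \<le> y \<Longrightarrow> alt D n y"
  by (cases n) (auto intro: order_trans)

lemma alt_Suc_imp: "alt D (Suc n) x \<Longrightarrow> alt D n x"
proof (induction n arbitrary: x)
  case (Suc n)
  then obtain d d' where "d \<le> x" "D d" "d' < d" "\<not> D d'" "alt D (Suc n) d'"
    unfolding alt.simps(2)[of D "Suc n"] by blast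
  with Suc.IH show ?case by auto
qed simp

text \<open>A convex piece through \<open>d\<close> cannot reach down to a point
  \<open>d' < d\<close> outside \<open>D\<close>. So the pieces that begin below \<open>x\<close>
  strictly outnumber those that begin below \<open>d'\<close>.\<close>

lemma alt_card_le:
  assumes "finite \<C>" "\<And>C. C \<in> \<C> \<Longrightarrow> ord_convex C" "\<And>x. D x \<longleftrightarrow> x \<in> \<Union> \<C>"
  shows "alt D n x \<Longrightarrow> n \<le> card {C \<in> \<C>. \<exists>c\<in>C. c \<le> x}"
proof (induction n arbitrary: x)
  case (Suc n)
  then obtain d d' where d: "d \<le> x" "D d" "d' < d" "\<not> D d'" "alt D n d'" by auto
  then obtain C where C: "C \<in> \<C>" "d \<in> C" using assms(3) by blast
  have "\<not> (\<exists>c\<in>C. c \<le> d')"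
    using assms(2)[OF C(1)] d C assms(3)[of d'] unfolding ord_convex_def
    by (meson UnionI less_imp_le)
  then have "{C \<in> \<C>. \<exists>c\<in>C. c \<le> d'} \<subset> {C \<in> \<C>. \<exists>c\<in>C. c \<le> x}"
  proof (intro psubsetI subsetI)
    fix C' assume "C' \<in> {C \<in> \<C>. \<exists>c\<in>C. c \<le> d'}"
    then show "C' \<in> {C \<in> \<C>. \<exists>c\<in>C. c \<le> x}" using d(1,3) by (auto dest: order_trans less_imp_le)
  qed (use C d in blast)
  then have "card {C \<in> \<C>. \<exists>c\<in>C. c \<le> d'} < card {C \<in> \<C>. \<exists>c\<in>C. c \<le> x}"
    using assms(1) by (intro psubset_card_mono) auto
  with Suc.IH[OF d(5)] show ?case by simp
qed simp

lemma dfn_alt [dfn_intros]: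
  assumes D: "dfn K es (\<lambda>\<rho>. D (\<lambda>i. \<rho> (Suc i)) (\<rho> 0))"
  shows "dfn K es (\<lambda>\<rho>. alt (D (\<lambda>i. \<rho> (Suc i))) n (\<rho> 0))"
proof (induction n)
  case 0
  have "dfn K es (\<lambda>\<rho>. \<rho> 0 = \<rho> 0)" by (intro dfn_intros)
  then show ?case by simp
next
  case (Suc n)
  show ?case unfolding alt.simps
    by (intro dfn_intros dfn_app1[where D = D, OF D] dfn_app1[where D = "\<lambda>\<rho>. alt (D \<rho>) n", OF Suc])
qed

section \<open>Uniform bounds on the number of convex components\<close>

locale wom =
  fixes K :: "('a::linordered_field, 'f, 'r) expansion"
  assumes wom: "weakly_o_minimal K" and satd: "aleph0_saturated K"
begin

lemma finite_union_convex:
  assumes "dfn K es (\<lambda>\<rho>. D (\<lambda>i. \<rho> (Suc i)) (\<rho> 0))"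
  obtains \<C> where "finite \<C>" "\<And>C. C \<in> \<C> \<Longrightarrow> ord_convex C" "\<And>x. D \<tau> x \<longleftrightarrow> x \<in> \<Union> \<C>"
proof -
  obtain N where N: "\<And>\<rho> \<rho>'. (\<And>i. i < N \<Longrightarrow> \<rho> i = \<rho>' i) \<Longrightarrow>
      D (\<lambda>i. \<rho> (Suc i)) (\<rho> 0) = D (\<lambda>i. \<rho>' (Suc i)) (\<rho>' 0)"
    using dfn_support[OF assms] by blast
  define es' where "es' = 0 # es @ map \<tau> [0..<N]"
  define T where "T i = (\<lambda>_ :: nat \<Rightarrow> 'a. if i < N then \<tau> i else 0)" for i
  have "dfn K es' (\<lambda>\<rho>. D (\<lambda>i. \<rho> (Suc i)) (\<rho> 0))"
    using assms by (rule dfn_mono) (auto simp: es'_def)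
  then have "dfn K es' (\<lambda>\<rho>. D (\<lambda>i. T i \<rho>) (\<rho> 0))"
    by (rule dfn_app1) (auto simp: T_def es'_def intro!: dterm_const dterm_var)
  moreover have "D (\<lambda>i. T i \<rho>) x = D \<tau> x" for \<rho> x
    using N[of "case_nat x (\<lambda>i. T i \<rho>)" "case_nat x \<tau>"] by (simp add: T_def split: nat.splits)
  ultimately have "dfn K es' (\<lambda>\<rho>. D \<tau> (\<rho> 0))" by simp
  then have "definable K 1 ((\<lambda>x. [x]) ` {x. D \<tau> x})"
    by (intro dfn_imp_definable) (auto simp: image_iff)
  with wom obtain \<C> where "finite \<C>" "\<forall>C\<in>\<C>. ord_convex C" "{x. D \<tau> x} = \<Union> \<C>"
    unfolding weakly_o_minimal_def by metis
  then show thesis by (intro that[of \<C>]) (auto simp: set_eq_iff)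
qed

text \<open>If alternations were unbounded in the family, saturation would give a single member with
  infinitely many of them, against weak o-minimality. All counts of cuts of a given type rest on
  this bound.\<close>

lemma alt_bound:
  assumes D: "dfn K es (\<lambda>\<rho>. D (\<lambda>i. \<rho> (Suc i)) (\<rho> 0))"
  obtains B where "\<And>\<tau> x. \<not> alt (D \<tau>) B x"
proof (rule ccontr)
  assume "\<not> thesis"
  with that have ex: "\<exists>\<tau> x. alt (D \<tau>) B x" for B by blast
  obtain N where N: "\<And>\<rho> \<rho>'. (\<And>i. i < N \<Longrightarrow> \<rho> i = \<rho>' i) \<Longrightarrow>
      D (\<lambda>i. \<rho> (Suc i)) (\<rho> 0) = D (\<lambda>i. \<rho>' (Suc i)) (\<rho>' 0)"
    using dfn_support[OF D] by blast
  have "\<exists>\<rho>. \<forall>n. alt (D (\<lambda>i. \<rho> (Suc i))) n (\<rho> 0)"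
  proof (rule saturation[OF satd])
    show "dfn K es (\<lambda>\<rho>. alt (D (\<lambda>i. \<rho> (Suc i))) n (\<rho> 0))" for n by (rule dfn_alt[OF D])
    show "alt (D (\<lambda>i. \<rho> (Suc i))) n (\<rho> 0) = alt (D (\<lambda>i. \<rho>' (Suc i))) n (\<rho>' 0)"
      if eq: "\<And>i. i < Suc N \<Longrightarrow> \<rho> i = \<rho>' i" for n \<rho> \<rho>'
    proof -
      have "D (\<lambda>i. \<rho> (Suc i)) x = D (\<lambda>i. \<rho>' (Suc i)) x" for x
        using N[of "case_nat x (\<lambda>i. \<rho> (Suc i))" "case_nat x (\<lambda>i. \<rho>' (Suc i))"] eq
        by (simp split: nat.splits)
      then have "D (\<lambda>i. \<rho> (Suc i)) = D (\<lambda>i. \<rho>' (Suc i))" by blast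
      with eq[of 0] show ?thesis by simp
    qed
    show "\<exists>\<rho>. alt (D (\<lambda>i. \<rho> (Suc i))) n (\<rho> 0)" for n
    proof -
      from ex[of n] obtain \<tau> x where "alt (D \<tau>) n x" by blast
      then show ?thesis by (intro exI[of _ "case_nat x \<tau>"]) simp
    qed
  qed (rule alt_Suc_imp)
  then obtain \<tau> x where \<tau>: "\<And>n. alt (D \<tau>) n x" by blast
  obtain \<C> where \<C>: "finite \<C>" "\<And>C. C \<in> \<C> \<Longrightarrow> ord_convex C" "\<And>x. D \<tau> x \<longleftrightarrow> x \<in> \<Union> \<C>"
    using finite_union_convex[OF D, of \<tau>] by blast
  have "card {C \<in> \<C>. \<exists>c\<in>C. c \<le> x} \<le> card \<C>" by (rule card_mono[OF \<C>(1)]) blast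
  with alt_card_le[OF \<C> \<tau>, of "Suc (card \<C>)"] show False by linarith
qed

end

section \<open>Convex equivalence relations\<close>

text \<open>\<open>E\<close> has at most \<open>N\<close> classes on \<open>P\<close>. The labelling
  gives this a meaning before \<open>E\<close> is known to be an equivalence relation, and on
  subsets of its domain.\<close>

definition idx :: "('a \<Rightarrow> 'a \<Rightarrow> bool) \<Rightarrow> 'a set \<Rightarrow> nat \<Rightarrow> bool" where
  "idx E P N \<longleftrightarrow> (\<exists>f::'a \<Rightarrow> nat. (\<forall>x\<in>P. f x < N) \<and> (\<forall>x\<in>P. \<forall>y\<in>P. f x = f y \<longrightarrow> E x y))"

lemma idxI:
  assumes "finite A" "card A \<le> N" "f ` P \<subseteq> A"
    "\<And>x y. x \<in> P \<Longrightarrow> y \<in> P \<Longrightarrow> f x = f y \<Longrightarrow> E x y"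
  shows "idx E P N"
proof -
  obtain h where h: "bij_betw h A {0..<card A}" using ex_bij_betw_finite_nat[OF assms(1)] by blast
  have "h (f x) < N" if "x \<in> P" for x
  proof -
    have "f x \<in> A" using assms(3) that by auto
    then have "h (f x) \<in> {0..<card A}" using bij_betw_apply[OF h] by blast
    with assms(2) show ?thesis by simp
  qed
  moreover have "E x y" if "x \<in> P" "y \<in> P" "h (f x) = h (f y)" for x y
  proof -
    have "f x \<in> A" "f y \<in> A" using assms(3) that by auto
    then have "f x = f y" using h that(3) unfolding bij_betw_def inj_on_def by blast
    with assms(4) that show ?thesis by blast
  qed
  ultimately show ?thesis unfolding idx_def by (intro exI[of _ "h \<circ> f"]) auto
qed

text \<open>The auxiliary relation may change with the key and has to refine \<open>E\<close> only
  inside the fibre of that key. Cuts of different types are counted by different relations in this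
  way.\<close>

lemma idx_fibers:
  fixes E :: "'a \<Rightarrow> 'a \<Rightarrow> bool" and key :: "'a \<Rightarrow> 'b"
  assumes "finite A" "card A \<le> N" "key ` P \<subseteq> A"
    "\<And>b. b \<in> key ` P \<Longrightarrow> \<exists>F. idx F P M \<and>
      (\<forall>x\<in>P. \<forall>y\<in>P. key x = b \<longrightarrow> key y = b \<longrightarrow> F x y \<longrightarrow> E x y)"
  shows "idx E P (N * M)"
proof -
  have "\<forall>b. \<exists>g :: 'a \<Rightarrow> nat. b \<in> key ` P \<longrightarrow> (\<forall>x\<in>P. g x < M) \<and>
      (\<forall>x\<in>P. \<forall>y\<in>P. key x = b \<longrightarrow> key y = b \<longrightarrow> g x = g y \<longrightarrow> E x y)"
  proof
    fix b show "\<exists>g :: 'a \<Rightarrow> nat. b \<in> key ` P \<longrightarrow> (\<forall>x\<in>P. g x < M) \<and>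
      (\<forall>x\<in>P. \<forall>y\<in>P. key x = b \<longrightarrow> key y = b \<longrightarrow> g x = g y \<longrightarrow> E x y)"
    proof (cases "b \<in> key ` P")
      case True
      then obtain F where F: "idx F P M"
        "\<forall>x\<in>P. \<forall>y\<in>P. key x = b \<longrightarrow> key y = b \<longrightarrow> F x y \<longrightarrow> E x y" using assms(4) by blast
      then obtain g :: "'a \<Rightarrow> nat" where "\<forall>x\<in>P. g x < M" "\<forall>x\<in>P. \<forall>y\<in>P. g x = g y \<longrightarrow> F x y"
        unfolding idx_def by blast
      with F(2) show ?thesis by (intro exI[of _ g]) simp
    qed simp
  qed
  from choice[OF this] obtain g :: "'b \<Rightarrow> 'a \<Rightarrow> nat" where
    "\<forall>b. b \<in> key ` P \<longrightarrow> (\<forall>x\<in>P. g b x < M) \<and>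
      (\<forall>x\<in>P. \<forall>y\<in>P. key x = b \<longrightarrow> key y = b \<longrightarrow> g b x = g b y \<longrightarrow> E x y)" by blast
  then have g: "\<And>b x. b \<in> key ` P \<Longrightarrow> x \<in> P \<Longrightarrow> g b x < M"
    "\<And>b x y. b \<in> key ` P \<Longrightarrow> x \<in> P \<Longrightarrow> y \<in> P \<Longrightarrow> key x = b \<Longrightarrow> key y = b \<Longrightarrow> g b x = g b y \<Longrightarrow> E x y"
    by simp_all
  show ?thesis
  proof (rule idxI[where f = "\<lambda>x. (key x, g (key x) x)"])
    show "finite (A \<times> {..<M})" using assms(1) by simp
    show "card (A \<times> {..<M}) \<le> N * M" using assms(2) by (simp add: card_cartesian_product)
    show "(\<lambda>x. (key x, g (key x) x)) ` P \<subseteq> A \<times> {..<M}"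
    proof (rule image_subsetI)
      fix x assume x: "x \<in> P"
      then have "key x \<in> A" using assms(3) by auto
      moreover have "g (key x) x < M" by (rule g(1)[OF imageI[OF x] x])
      ultimately show "(key x, g (key x) x) \<in> A \<times> {..<M}" by simp
    qed
    show "E x y" if "x \<in> P" "y \<in> P" "(key x, g (key x) x) = (key y, g (key y) y)" for x y
      by (rule g(2)[OF imageI[OF that(1)] that(1,2)]) (use that(3) in auto)
  qed
qed

lemma idx_mono:
  assumes "idx E P N" "N \<le> M" "\<And>x y. x \<in> Q \<Longrightarrow> y \<in> Q \<Longrightarrow> E x y \<Longrightarrow> F x y" "Q \<subseteq> P"
  shows "idx F Q M"
proof -
  obtain f :: "'a \<Rightarrow> nat" where f: "\<forall>x\<in>P. f x < N" "\<forall>x\<in>P. \<forall>y\<in>P. f x = f y \<longrightarrow> E x y"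
    using assms(1) unfolding idx_def by blast
  have "f x < M" if "x \<in> Q" for x using f(1) that assms(2,4) by fastforce
  moreover have "F x y" if "x \<in> Q" "y \<in> Q" "f x = f y" for x y
    using assms(3)[OF that(1,2)] f(2) that assms(4) by blast
  ultimately show ?thesis unfolding idx_def by blast
qed

definition cequiv :: "'a::linorder set \<Rightarrow> ('a \<Rightarrow> 'a \<Rightarrow> bool) \<Rightarrow> bool" where
  "cequiv P E \<longleftrightarrow> (\<forall>x\<in>P. E x x) \<and> (\<forall>x\<in>P. \<forall>y\<in>P. E x y \<longrightarrow> E y x) \<and>
     (\<forall>x\<in>P. \<forall>y\<in>P. \<forall>z\<in>P. E x y \<longrightarrow> E y z \<longrightarrow> E x z) \<and>
     (\<forall>x\<in>P. \<forall>y\<in>P. \<forall>z\<in>P. x \<le> y \<longrightarrow> y \<le> z \<longrightarrow> E x z \<longrightarrow> E x y)"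

locale convex_equiv =
  fixes P :: "'a::linorder set" and E :: "'a \<Rightarrow> 'a \<Rightarrow> bool"
  assumes ce: "cequiv P E"
begin

lemmas refl = ce[unfolded cequiv_def, THEN conjunct1, rule_format]
lemmas sym = ce[unfolded cequiv_def, THEN conjunct2, THEN conjunct1, rule_format]
lemmas trans = ce[unfolded cequiv_def, THEN conjunct2, THEN conjunct2, THEN conjunct1, rule_format]
lemmas conv = ce[unfolded cequiv_def, THEN conjunct2, THEN conjunct2, THEN conjunct2, rule_format]

lemma conv2: "x \<in> P \<Longrightarrow> y \<in> P \<Longrightarrow> z \<in> P \<Longrightarrow> x \<le> y \<Longrightarrow> y \<le> z \<Longrightarrow> E x z \<Longrightarrow> E y z"
  using conv[of x y z] sym[of x y] trans[of y x z] by blast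

lemma less_class:
  assumes "x \<in> P" "x' \<in> P" "y \<in> P" "y' \<in> P" "x < y" "\<not> E x y" "E x x'" "E y y'"
  shows "x' < y'"
proof (rule ccontr)
  assume less: "\<not> x' < y'"
  then consider "y' \<le> x" | "x \<le> y'" "y' \<le> x'" by fastforce
  then show False
  proof cases
    case 1
    have "E y' y" using assms sym by blast
    then have "E y' x" using 1 assms conv[of y' x y] by auto
    then have "E y x" using assms trans[of y y' x] by blast
    then show False using assms sym by blast
  next
    case 2
    then have "E x y'" using assms conv[of x y' x'] by auto
    then have "E x y" using assms trans[of x y' y] sym[of y y'] by blast
    then show False using assms by blast
  qed
qed

text \<open>Finitely many labels occur in \<open>A\<close>; the largest of their chosen
  representatives lies in the last class met by \<open>A\<close>, by convexity of the
  classes.\<close>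

lemma ex_top:
  assumes "idx E P n" "A \<subseteq> P" "A \<noteq> {}"
  obtains c where "c \<in> A" "\<And>b. b \<in> A \<Longrightarrow> c \<le> b \<Longrightarrow> E c b"
proof -
  obtain f :: "'a \<Rightarrow> nat" where f: "\<And>x. x \<in> P \<Longrightarrow> f x < n" "\<And>x y. x \<in> P \<Longrightarrow> y \<in> P \<Longrightarrow> f x = f y \<Longrightarrow> E x y"
    using assms(1) unfolding idx_def by auto
  have "\<forall>k\<in>f ` A. \<exists>r\<in>A. f r = k" by auto
  then obtain r where r: "\<And>k. k \<in> f ` A \<Longrightarrow> r k \<in> A \<and> f (r k) = k" by metis
  have "f ` A \<subseteq> {..<n}" using f(1) subsetD[OF assms(2)] by (intro image_subsetI) simp
  then have fin: "finite (f ` A)" by (rule finite_subset) simp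
  define c where "c = Max (r ` f ` A)"
  have cr: "c \<in> r ` f ` A" unfolding c_def using fin assms(3) by (intro Max_in) auto
  then obtain k where "k \<in> f ` A" "c = r k" by blast
  then have cA: "c \<in> A" using r by simp
  have "E c b" if b: "b \<in> A" "c \<le> b" for b
  proof -
    have "r (f b) \<le> c" unfolding c_def using fin b(1) by (intro Max_ge) auto
    moreover have "r (f b) \<in> P" "f (r (f b)) = f b" "b \<in> P" "c \<in> P"
      using r[OF imageI[OF b(1)]] subsetD[OF assms(2)] b(1) cA by simp_all
    ultimately show ?thesis using f(2)[of "r (f b)" b] b(2) conv2[of "r (f b)" c b] by simp
  qed
  with cA show thesis by (rule that)
qed

lemma ex_bot:
  assumes "idx E P n" "A \<subseteq> P" "A \<noteq> {}"
  obtains c where "c \<in> A" "\<And>b. b \<in> A \<Longrightarrow> b \<le> c \<Longrightarrow> E b c"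
proof -
  obtain f :: "'a \<Rightarrow> nat" where f: "\<And>x. x \<in> P \<Longrightarrow> f x < n" "\<And>x y. x \<in> P \<Longrightarrow> y \<in> P \<Longrightarrow> f x = f y \<Longrightarrow> E x y"
    using assms(1) unfolding idx_def by auto
  have "\<forall>k\<in>f ` A. \<exists>r\<in>A. f r = k" by auto
  then obtain r where r: "\<And>k. k \<in> f ` A \<Longrightarrow> r k \<in> A \<and> f (r k) = k" by metis
  have "f ` A \<subseteq> {..<n}" using f(1) subsetD[OF assms(2)] by (intro image_subsetI) simp
  then have fin: "finite (f ` A)" by (rule finite_subset) simp
  define c where "c = Min (r ` f ` A)"
  have cr: "c \<in> r ` f ` A" unfolding c_def using fin assms(3) by (intro Min_in) auto
  then obtain k where "k \<in> f ` A" "c = r k" by blast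
  then have cA: "c \<in> A" using r by simp
  have "E b c" if b: "b \<in> A" "b \<le> c" for b
  proof -
    have "c \<le> r (f b)" unfolding c_def using fin b(1) by (intro Min_le) auto
    moreover have "r (f b) \<in> P" "f (r (f b)) = f b" "b \<in> P" "c \<in> P"
      using r[OF imageI[OF b(1)]] subsetD[OF assms(2)] b(1) cA by simp_all
    ultimately show ?thesis using f(2)[of b "r (f b)"] b(2) conv[of b c "r (f b)"] by simp
  qed
  with cA show thesis by (rule that)
qed

end

section \<open>Cuts and convex subgroups of a definable ordered group\<close>

text \<open>The instances are the additive group of \<open>K\<close> and the multiplicative group of
  its positive elements, both with the order of the field. Division occurs only as bisection of an
  interval, which in the second instance is a square root.\<close>

locale divisible_group = wom K for K :: "('a::linordered_field, 'f, 'r) expansion" +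
  fixes P :: "'a set" and op :: "'a \<Rightarrow> 'a \<Rightarrow> 'a" (infixl "\<oplus>" 65) and e :: 'a
  assumes op_in: "x \<in> P \<Longrightarrow> y \<in> P \<Longrightarrow> x \<oplus> y \<in> P"
    and op_assoc: "x \<in> P \<Longrightarrow> y \<in> P \<Longrightarrow> z \<in> P \<Longrightarrow> x \<oplus> y \<oplus> z = x \<oplus> (y \<oplus> z)"
    and op_comm: "x \<in> P \<Longrightarrow> y \<in> P \<Longrightarrow> x \<oplus> y = y \<oplus> x"
    and unit_in: "e \<in> P"
    and op_unit: "x \<in> P \<Longrightarrow> x \<oplus> e = x"
    and op_inv: "x \<in> P \<Longrightarrow> \<exists>y\<in>P. x \<oplus> y = e"
    and op_strict_mono: "x \<in> P \<Longrightarrow> y \<in> P \<Longrightarrow> z \<in> P \<Longrightarrow> x < y \<Longrightarrow> x \<oplus> z < y \<oplus> z"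
    and op_half: "x \<in> P \<Longrightarrow> \<exists>y\<in>P. y \<oplus> y = x"
    and dfn_carrier: "dterm K es f \<Longrightarrow> dfn K es (\<lambda>\<rho>. f \<rho> \<in> P)"
    and dterm_op: "dterm K es f \<Longrightarrow> dterm K es g \<Longrightarrow> dterm K es (\<lambda>\<rho>. f \<rho> \<oplus> g \<rho>)"
    and dterm_unit: "dterm K es (\<lambda>\<rho>. e)"
begin

section \<open>Ordered group arithmetic, stabilizers and types of cuts\<close>

definition "Pe = {g \<in> P. e \<le> g}"

lemma PeD: "g \<in> Pe \<Longrightarrow> g \<in> P" "g \<in> Pe \<Longrightarrow> e \<le> g"
  and PeI: "g \<in> P \<Longrightarrow> e \<le> g \<Longrightarrow> g \<in> Pe"
  unfolding Pe_def by auto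

lemma op_less: "x \<in> P \<Longrightarrow> y \<in> P \<Longrightarrow> z \<in> P \<Longrightarrow> x \<oplus> z < y \<oplus> z \<longleftrightarrow> x < y"
  by (metis op_strict_mono not_less_iff_gr_or_eq)

lemma op_le: "x \<in> P \<Longrightarrow> y \<in> P \<Longrightarrow> z \<in> P \<Longrightarrow> x \<oplus> z \<le> y \<oplus> z \<longleftrightarrow> x \<le> y"
  by (metis op_less not_less)

lemma op_le': "x \<in> P \<Longrightarrow> y \<in> P \<Longrightarrow> z \<in> P \<Longrightarrow> z \<oplus> x \<le> z \<oplus> y \<longleftrightarrow> x \<le> y"
  by (metis op_le op_comm)

lemma le_op: "x \<in> P \<Longrightarrow> g \<in> Pe \<Longrightarrow> x \<le> x \<oplus> g"
  by (metis PeD op_le' op_unit unit_in)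

lemma op_diff:
  assumes "x \<in> P" "y \<in> P" "x \<le> y" obtains g where "g \<in> Pe" "x \<oplus> g = y"
proof -
  obtain x' where x': "x' \<in> P" "x \<oplus> x' = e" using op_inv assms by blast
  have "x \<oplus> (x' \<oplus> y) = y" using x' assms op_assoc op_comm op_unit unit_in by metis
  moreover have "e \<le> x' \<oplus> y" using assms x' op_le op_comm by metis
  ultimately show thesis using that PeI x' assms op_in by blast
qed

lemma half_Pe:
  assumes "g \<in> Pe" obtains d where "d \<in> Pe" "d \<oplus> d = g"
proof -
  obtain d where d: "d \<in> P" "d \<oplus> d = g" using op_half assms PeD by blast
  have "e \<le> d"
  proof (rule ccontr)
    assume "\<not> e \<le> d"
    then have "d \<oplus> d < e \<oplus> d" using op_strict_mono[OF d(1) unit_in d(1)] by simp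
    moreover have "e \<oplus> d = d" using op_comm[OF unit_in d(1)] op_unit[OF d(1)] by simp
    ultimately show False using PeD(2)[OF assms] d(2) \<open>\<not> e \<le> d\<close> by simp
  qed
  then show thesis using that d PeI by blast
qed

text \<open>A class is cofinal below the cut above it, so for \<open>g\<close> at least the unit the
  class is closed under adding \<open>g\<close> exactly when that cut is invariant. These
  \<open>g\<close> are the nonnegative part of the stabilizer of the cut.\<close>

definition St :: "('a \<Rightarrow> 'a \<Rightarrow> bool) \<Rightarrow> 'a \<Rightarrow> 'a \<Rightarrow> bool" where
  "St E x g \<longleftrightarrow> (\<forall>y\<in>P. E x y \<longrightarrow> E x (y \<oplus> g))"

text \<open>Elements are identified when they lie in the same stabilizers. Stabilizers are convex
  subgroups, hence linearly ordered, and the classes on \<open>Pe\<close> are the steps of the chain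
  that they form.\<close>

definition stab_equiv :: "('a \<Rightarrow> 'a \<Rightarrow> bool) \<Rightarrow> 'a \<Rightarrow> 'a \<Rightarrow> bool" where
  "stab_equiv E g g' \<longleftrightarrow> (\<forall>x\<in>P. St E x g \<longleftrightarrow> St E x g')"

text \<open>
  The cut above the class of \<open>w\<close> has the form \<open>{y. y \<le> a + H}\<close> with \<open>H\<close> its stabilizer. Cuts of this
  form are counted separately, since otherwise a class could be a single coset of \<open>H\<close>.
\<close>

definition coset_cut :: "('a \<Rightarrow> 'a \<Rightarrow> bool) \<Rightarrow> 'a \<Rightarrow> bool" where
  "coset_cut E w \<longleftrightarrow> (\<exists>a\<in>P. E w a \<and> (\<forall>y\<in>P. E w y \<longrightarrow> (\<exists>g\<in>P. e \<le> g \<and> St E w g \<and> y \<le> a \<oplus> g)))"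

definition same_type :: "('a \<Rightarrow> 'a \<Rightarrow> bool) \<Rightarrow> 'a \<Rightarrow> 'a \<Rightarrow> bool" where
  "same_type E w x \<longleftrightarrow> (\<forall>g\<in>P. e \<le> g \<longrightarrow> (St E w g \<longleftrightarrow> St E x g)) \<and> (coset_cut E w \<longleftrightarrow> coset_cut E x)"

text \<open>A point \<open>w\<close> with \<open>\<not> E w y\<close> marks a cut between
  \<open>w\<close> and \<open>y\<close>, namely the one above its class; none of these may have the
  type of \<open>x0\<close>. Thus \<open>type_equiv\<close> is \<open>E\<close> with the cuts of all
  other types erased.\<close>

definition type_half :: "('a \<Rightarrow> 'a \<Rightarrow> bool) \<Rightarrow> 'a \<Rightarrow> 'a \<Rightarrow> 'a \<Rightarrow> bool" where
  "type_half E x0 x y \<longleftrightarrow> (\<forall>w\<in>P. x \<le> w \<and> w \<le> y \<and> \<not> E w y \<longrightarrow> \<not> same_type E w x0)"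

definition type_equiv :: "('a \<Rightarrow> 'a \<Rightarrow> bool) \<Rightarrow> 'a \<Rightarrow> 'a \<Rightarrow> 'a \<Rightarrow> bool" where
  "type_equiv E x0 x y \<longleftrightarrow> type_half E x0 x y \<and> type_half E x0 y x"

text \<open>The points of a class that are closer to its upper than to its lower end.\<close>

definition upper_part :: "('a \<Rightarrow> 'a \<Rightarrow> bool) \<Rightarrow> 'a \<Rightarrow> bool" where
  "upper_part F z \<longleftrightarrow> z \<in> P \<and> (\<forall>w\<in>P. \<forall>g\<in>P. e \<le> g \<and> w \<oplus> g = z \<and> \<not> F w z \<longrightarrow> \<not> F z (z \<oplus> g))"

lemma dfn_upper_part:
  assumes E: "dfn K es (\<lambda>\<rho>. E (\<lambda>i. \<rho> (Suc (Suc i))) (\<rho> 0) (\<rho> (Suc 0)))"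
  shows "dfn K es (\<lambda>\<rho>. upper_part (type_equiv (E (\<lambda>i. \<rho> (Suc (Suc i)))) (\<rho> (Suc 0))) (\<rho> 0))"
  unfolding upper_part_def type_equiv_def type_half_def same_type_def coset_cut_def St_def
    Ball_def Bex_def
  by (intro dfn_intros dfn_carrier dterm_op dterm_unit dfn_app2[where E = E, OF E])

lemma dfn_stab_equiv:
  assumes E: "dfn K es (\<lambda>\<rho>. E (\<lambda>i. \<rho> (Suc (Suc i))) (\<rho> 0) (\<rho> (Suc 0)))"
  shows "dfn K es (\<lambda>\<rho>. stab_equiv (E (\<lambda>i. \<rho> (Suc (Suc i)))) (\<rho> 0) (\<rho> (Suc 0)))"
  unfolding stab_equiv_def St_def Ball_def
  by (intro dfn_intros dfn_carrier dterm_op dfn_app2[where E = E, OF E])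

end

locale finite_convex_equiv = divisible_group K P op e + convex_equiv P E
  for K :: "('a::linordered_field, 'f, 'r) expansion"
    and P and op (infixl "\<oplus>" 65) and e and E +
  fixes n :: nat assumes fin: "idx E P n"
begin

lemma op_PeI: "x \<in> P \<Longrightarrow> g \<in> Pe \<Longrightarrow> x \<oplus> g \<in> P"
  using op_in PeD by blast

lemma St_antimono:
  assumes "x \<in> P" "g \<in> Pe" "h \<in> P" "g \<le> h" "St E x h" shows "St E x g"
  unfolding St_def
proof (intro ballI impI)
  fix y assume y: "y \<in> P" "E x y"
  have g: "g \<in> P" using PeD assms(2) by blast
  have "E x (y \<oplus> h)" using assms(5) y unfolding St_def by blast
  then have "E y (y \<oplus> h)" using trans[OF y(1) assms(1) op_in[OF y(1) assms(3)]] sym[OF assms(1) y(1,2)] by blast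
  moreover have "y \<oplus> g \<le> y \<oplus> h" using op_le'[OF g assms(3) y(1)] assms(4) by blast
  ultimately have "E y (y \<oplus> g)"
    using conv[OF y(1) op_in[OF y(1) g] op_in[OF y(1) assms(3)] le_op[OF y(1) assms(2)]] by blast
  then show "E x (y \<oplus> g)" using trans[OF assms(1) y(1) op_in[OF y(1) g] y(2)] by blast
qed

lemma St_double:
  assumes "x \<in> P" "g \<in> P" "St E x g" shows "St E x (g \<oplus> g)"
  unfolding St_def
proof (intro ballI impI)
  fix y assume y: "y \<in> P" "E x y"
  have "E x (y \<oplus> g)" "y \<oplus> g \<in> P" using assms(2,3) y op_in unfolding St_def by blast+
  then have "E x (y \<oplus> g \<oplus> g)" using assms(3) unfolding St_def by blast
  then show "E x (y \<oplus> (g \<oplus> g))" using op_assoc[OF y(1) assms(2,2)] by simp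
qed

lemma St_cong:
  assumes "x \<in> P" "x' \<in> P" "g \<in> P" "E x x'" shows "St E x g \<longleftrightarrow> St E x' g"
proof -
  have "St E b g" if ab: "a \<in> P" "b \<in> P" "E a b" "St E a g" for a b
    unfolding St_def
  proof (intro ballI impI)
    fix y assume y: "y \<in> P" "E b y"
    have "E a (y \<oplus> g)" using ab(4) y trans[OF ab(1,2) y(1) ab(3) y(2)] unfolding St_def by blast
    then show "E b (y \<oplus> g)" using trans[OF ab(2,1) op_in[OF y(1) assms(3)]] sym[OF ab(1,2,3)] by blast
  qed
  then show ?thesis using assms sym by blast
qed

lemma stab_equiv_cequiv: "cequiv Pe (stab_equiv E)"
  unfolding cequiv_def
proof (intro conjI ballI impI)
  fix x y z assume *: "x \<in> Pe" "y \<in> Pe" "z \<in> Pe" "x \<le> y" "y \<le> z" "stab_equiv E x z"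
  show "stab_equiv E x y" unfolding stab_equiv_def
  proof (intro ballI iffI)
    fix w assume w: "w \<in> P"
    { assume "St E w x" then have "St E w z" using * w unfolding stab_equiv_def by blast
      then show "St E w y" using St_antimono[OF w *(2) _ *(5)] PeD *(3) by blast }
    { assume "St E w y" then show "St E w x" using St_antimono[OF w *(1) _ *(4)] PeD *(2) by blast }
  qed
qed (auto simp: stab_equiv_def)

text \<open>Stabilizers are closed under the operation. This supplies the doubling condition of
  \<open>add_good\<close> and the squaring condition of \<open>val_good\<close>.\<close>

lemma stab_equiv_double:
  assumes "g \<in> Pe" shows "stab_equiv E g (g \<oplus> g)"
  unfolding stab_equiv_def
proof (intro ballI iffI)
  fix w assume w: "w \<in> P"
  have g: "g \<in> P" using PeD assms by blast
  show "St E w g \<Longrightarrow> St E w (g \<oplus> g)" by (rule St_double[OF w g])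
  show "St E w (g \<oplus> g) \<Longrightarrow> St E w g" by (rule St_antimono[OF w assms op_in[OF g g] le_op[OF g assms]])
qed

lemma stab_equiv_unit:
  assumes "u \<in> Pe" "\<And>x. x \<in> P \<Longrightarrow> E x (x \<oplus> u)" shows "stab_equiv E e u"
proof -
  have "St E w e" if "w \<in> P" for w using op_unit unfolding St_def by simp
  moreover have "St E w u" if w: "w \<in> P" for w unfolding St_def
    using trans[OF w _ op_PeI[OF _ assms(1)]] assms(2) by blast
  ultimately show ?thesis unfolding stab_equiv_def by blast
qed

text \<open>The class of \<open>g\<close> is determined by the set of labels of the cuts that
  \<open>g\<close> stabilizes. The resulting bound depends on \<open>n\<close>; it only shows that
  the chain of stabilizers is finite, so that a uniform bound for finite chains applies to
  it.\<close>

lemma idx_stab_equiv: "\<exists>m. idx (stab_equiv E) Pe m"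
proof -
  obtain f :: "'a \<Rightarrow> nat" where f: "\<forall>x\<in>P. f x < n" "\<forall>x\<in>P. \<forall>y\<in>P. f x = f y \<longrightarrow> E x y"
    using fin unfolding idx_def by blast
  define F where "F g = f ` {x \<in> P. St E x g}" for g
  have "idx (stab_equiv E) Pe (card (Pow {..<n}))"
  proof (rule idxI[where f = F])
    show "F ` Pe \<subseteq> Pow {..<n}" unfolding F_def using f(1) by blast
    fix g g' assume g: "g \<in> Pe" "g' \<in> Pe" "F g = F g'"
    have *: "St E x b" if ab: "a \<in> Pe" "b \<in> Pe" "F a = F b" "x \<in> P" "St E x a" for a b x
    proof -
      have "f x \<in> F a" using ab(4,5) unfolding F_def by blast
      then obtain y where y: "y \<in> P" "St E y b" "f y = f x" unfolding ab(3) unfolding F_def by auto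
      then have "E y x" using f(2) ab(4) by blast
      then show ?thesis using St_cong[OF y(1) ab(4)] PeD(1)[OF ab(2)] y(2) by blast
    qed
    show "stab_equiv E g g'" unfolding stab_equiv_def
      using *[OF g] *[OF g(2,1) g(3)[symmetric]] by blast
  qed simp_all
  then show ?thesis by blast
qed

lemma coset_cut_imp:
  assumes "x \<in> P" "x' \<in> P" "E x x'" "coset_cut E x" shows "coset_cut E x'"
proof -
  obtain a where a: "a \<in> P" "E x a" "\<forall>y\<in>P. E x y \<longrightarrow> (\<exists>g\<in>P. e \<le> g \<and> St E x g \<and> y \<le> a \<oplus> g)"
    using assms(4) unfolding coset_cut_def by blast
  have "E x' a" using trans[OF assms(2,1) a(1)] sym[OF assms(1,2,3)] a(2) by blast
  moreover have "\<exists>g\<in>P. e \<le> g \<and> St E x' g \<and> y \<le> a \<oplus> g" if y: "y \<in> P" "E x' y" for y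
    using a(3) y trans[OF assms(1,2) y(1) assms(3) y(2)] St_cong[OF assms(1,2) _ assms(3)] by blast
  ultimately show ?thesis unfolding coset_cut_def using a(1) by blast
qed

lemma same_type_cong:
  assumes "x \<in> P" "x' \<in> P" "E x x'" shows "same_type E x y \<longleftrightarrow> same_type E x' y"
  using coset_cut_imp[OF assms] coset_cut_imp[OF assms(2,1) sym[OF assms]] St_cong[OF assms(1,2) _ assms(3)]
  unfolding same_type_def by blast

lemma type_half_trans:
  assumes "x \<in> P" "y \<in> P" "z \<in> P" "type_half E c x y" "type_half E c y z"
  shows "type_half E c x z"
  unfolding type_half_def
proof (intro ballI impI notI)
  fix w assume w: "w \<in> P" "x \<le> w \<and> w \<le> z \<and> \<not> E w z" "same_type E w c"
  consider "w \<le> y" "\<not> E w y" | "w \<le> y" "E w y" | "y \<le> w" by force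
  then show False
  proof cases
    \<comment> \<open>The cut above the class of \<open>w\<close> is also the cut above the class of
      \<open>y\<close>, so \<open>y\<close> takes the place of \<open>w\<close> between
      \<open>y\<close> and \<open>z\<close>.\<close>
    case 2
    have "y \<le> z"
    proof (rule ccontr)
      assume "\<not> y \<le> z"
      then have "E w z" using conv[OF w(1) assms(3,2)] w 2 by simp
      then show False using w by blast
    qed
    moreover have "\<not> E y z" using trans[OF w(1) assms(2,3) 2(2)] w by blast
    moreover have "same_type E y c" using same_type_cong[OF w(1) assms(2) 2(2)] w by blast
    ultimately show False using assms(5,2) unfolding type_half_def by blast
  qed (use assms w in \<open>unfold type_half_def, blast\<close>)+
qed

lemma E_imp_type_equiv:
  assumes "x \<in> P" "y \<in> P" "E x y" shows "type_equiv E c x y"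
proof -
  have "type_half E c a b" if "a \<in> P" "b \<in> P" "E a b" for a b
    unfolding type_half_def using conv2[OF that(1) _ that(2)] that(3) by blast
  then show ?thesis using assms sym unfolding type_equiv_def by blast
qed

lemma type_equiv_cequiv: "cequiv P (type_equiv E c)"
  unfolding cequiv_def
proof (intro conjI ballI impI)
  fix x y z assume *: "x \<in> P" "y \<in> P" "z \<in> P"
  { show "type_equiv E c x x" using E_imp_type_equiv refl * by blast }
  { show "type_equiv E c x y \<Longrightarrow> type_equiv E c y x" unfolding type_equiv_def by blast }
  { assume "type_equiv E c x y" "type_equiv E c y z"
    then show "type_equiv E c x z" using type_half_trans * unfolding type_equiv_def by blast }
  { assume **: "x \<le> y" "y \<le> z" "type_equiv E c x z"
    have "type_half E c x y" unfolding type_half_def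
    proof (intro ballI impI)
      fix w assume w: "w \<in> P" "x \<le> w \<and> w \<le> y \<and> \<not> E w y"
      then have "\<not> E w z" using conv[OF w(1) *(2,3)] **(2) by blast
      then show "\<not> same_type E w c" using ** w unfolding type_equiv_def type_half_def by force
    qed
    moreover have "type_half E c y x" unfolding type_half_def
    proof (intro ballI impI)
      fix w assume w: "w \<in> P" "y \<le> w \<and> w \<le> x \<and> \<not> E w x"
      then have "w = x" using **(1) by simp
      then show "\<not> same_type E w c" using w refl[OF *(1)] by simp
    qed
    ultimately show "type_equiv E c x y" unfolding type_equiv_def by blast }
qed

section \<open>The number of cuts of one type\<close>

lemma not_type_half:
  assumes "x \<in> P" "y \<in> P" "x < y" "\<not> type_equiv E c x y"
  obtains w where "w \<in> P" "x \<le> w" "w \<le> y" "\<not> E w y" "same_type E w c"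
proof -
  have "type_half E c y x" unfolding type_half_def using assms(3) by auto
  then have "\<not> type_half E c x y" using assms(4) unfolding type_equiv_def by blast
  then show thesis using that unfolding type_half_def by blast
qed

lemma not_type_equiv:
  assumes "w \<in> P" "w \<le> y" "\<not> E w y" "same_type E w c" shows "\<not> type_equiv E c w y"
  using assms unfolding type_equiv_def type_half_def by blast

lemma same_typeD: "same_type E w c \<Longrightarrow> g \<in> Pe \<Longrightarrow> St E w g \<longleftrightarrow> St E c g"
  "same_type E w c \<Longrightarrow> coset_cut E w \<longleftrightarrow> coset_cut E c"
  unfolding same_type_def Pe_def by blast+

text \<open>An inner class of \<open>F\<close> contains a point outside the upper part before a
  point inside it. Both ends of the class have the same stabilizer, so an element \<open>d\<close>
  outside it carries a suitable point over either end. If an interval of length twice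
  \<open>d\<close> fits into the class, there are a point \<open>p\<close> within \<open>d\<close>
  of the lower end and a point \<open>q\<close> within \<open>d\<close> of the upper end, in the
  right order.\<close>

lemma class_switch:
  fixes c0 defines "F \<equiv> type_equiv E c0"
  assumes xyz: "x \<in> P" "y \<in> P" "z \<in> P" "x < y" "y < z" "\<not> F x y" "\<not> F y z"
  obtains p q where "p \<in> P" "q \<in> P" "F y p" "F y q" "p < q" "\<not> upper_part F p" "upper_part F q"
proof -
  interpret Fe: convex_equiv P F unfolding F_def by standard (rule type_equiv_cequiv)
  have EF: "F a b" if "a \<in> P" "b \<in> P" "E a b" for a b
    unfolding F_def by (rule E_imp_type_equiv[OF that])
  \<comment> \<open>\<open>c\<close> lies in the last class of \<open>E\<close> inside the
    \<open>F\<close>-class of \<open>y\<close>, so the cut above \<open>c\<close> is the upper end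
    of the \<open>F\<close>-class.\<close>
  obtain c where c: "c \<in> {u \<in> P. F y u}" "\<And>b. b \<in> {u \<in> P. F y u} \<Longrightarrow> c \<le> b \<Longrightarrow> E c b"
    by (rule ex_top[OF fin, of "{u \<in> P. F y u}"]) (use Fe.refl[OF xyz(2)] xyz(2) in blast)+
  then have cP: "c \<in> P" and yc: "F y c" by blast+
  have SSc: "same_type E c c0"
  proof -
    have cz: "c < z" by (rule Fe.less_class[OF xyz(2) cP xyz(3,3) xyz(5,7) yc Fe.refl[OF xyz(3)]])
    have "\<not> F c z" using Fe.trans[OF xyz(2) cP xyz(3) yc] xyz(7) by blast
    then obtain w where w: "w \<in> P" "c \<le> w" "w \<le> z" "\<not> E w z" "same_type E w c0"
      using not_type_half[OF cP xyz(3) cz] unfolding F_def by blast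
    \<comment> \<open>The first cut of this type at or after \<open>c\<close> must be the one above
      \<open>c\<close>; otherwise a still earlier one would separate \<open>c\<close> from
      \<open>c'\<close>.\<close>
    obtain c' where c': "c' \<in> {w \<in> P. c \<le> w \<and> same_type E w c0}"
      "\<And>b. b \<in> {w \<in> P. c \<le> w \<and> same_type E w c0} \<Longrightarrow> b \<le> c' \<Longrightarrow> E b c'"
      by (rule ex_bot[OF fin, of "{w \<in> P. c \<le> w \<and> same_type E w c0}"]) (use w in blast)+
    then have c'P: "c' \<in> P" and cc': "c \<le> c'" and SS: "same_type E c' c0" by blast+
    have "E c c'"
    proof (rule ccontr)
      assume nE: "\<not> E c c'"
      then have "\<not> F y c'" using c(2)[of c'] c'P cc' by blast
      then have "\<not> F c c'" using Fe.trans[OF xyz(2) cP c'P yc] by blast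
      moreover have "c < c'" using nE refl[OF cP] cc' by (metis order_le_less)
      ultimately obtain v where "v \<in> P" "c \<le> v" "v \<le> c'" "\<not> E v c'" "same_type E v c0"
        using not_type_half[OF cP c'P] unfolding F_def by blast
      then show False using c'(2)[of v] by blast
    qed
    then show ?thesis using same_type_cong[OF cP c'P] SS by blast
  qed
  \<comment> \<open>\<open>w\<close> lies in the last class of the right type before the
    \<open>F\<close>-class of \<open>y\<close>, so the cut above \<open>w\<close> is the lower end
    of the \<open>F\<close>-class.\<close>
  obtain w where w: "w \<in> {w \<in> P. w \<le> y \<and> \<not> F w y \<and> same_type E w c0}"
    "\<And>b. b \<in> {w \<in> P. w \<le> y \<and> \<not> F w y \<and> same_type E w c0} \<Longrightarrow> w \<le> b \<Longrightarrow> E w b"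
  proof (rule ex_top[OF fin, of "{w \<in> P. w \<le> y \<and> \<not> F w y \<and> same_type E w c0}"])
    obtain w where w: "w \<in> P" "x \<le> w" "w \<le> y" "\<not> E w y" "same_type E w c0"
      using not_type_half[OF xyz(1,2,4)] xyz(6) unfolding F_def by blast
    then show "{w \<in> P. w \<le> y \<and> \<not> F w y \<and> same_type E w c0} \<noteq> {}"
      using not_type_equiv[OF w(1,3,4,5)] unfolding F_def by blast
  qed blast+
  then have wP: "w \<in> P" and wy: "w \<le> y" "\<not> F w y" and SSw: "same_type E w c0" by blast+
  have wy': "w < y" using wy Fe.refl[OF xyz(2)] by (metis order_le_less)
  \<comment> \<open>Between the cut above \<open>w\<close> and \<open>y\<close> there is no further
    cut of this type, by the choice of \<open>w\<close>; hence a point beyond that cut and bounded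
    by a member of the \<open>F\<close>-class is in the \<open>F\<close>-class.\<close>
  have L: "F y p" if p: "p \<in> P" "y1 \<in> P" "w < p" "\<not> E w p" "p \<le> y1" "F y y1" for p y1
  proof (cases "y \<le> p")
    case True
    then show ?thesis using Fe.conv[OF xyz(2) p(1,2) _ p(5,6)] by blast
  next
    case False
    show ?thesis
    proof (rule ccontr)
      assume "\<not> F y p"
      then have "\<not> F p y" using Fe.sym[OF p(1) xyz(2)] by blast
      then obtain v where v: "v \<in> P" "p \<le> v" "v \<le> y" "\<not> E v y" "same_type E v c0"
        using not_type_half[OF p(1) xyz(2)] False unfolding F_def by (metis not_le)
      then have "\<not> F v y" using not_type_equiv unfolding F_def by blast
      then have "E w v" using w(2)[of v] v p(3) by force
      then show False using conv[OF wP p(1) v(1) less_imp_le[OF p(3)] v(2)] p(4) by blast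
    qed
  qed
  have above: "w < p" if "p \<in> P" "k \<in> P" "E w k" "k \<le> p" "\<not> E w p" for p k
  proof (rule ccontr)
    assume "\<not> w < p"
    then have "E k p" using conv[OF that(2,1) wP that(4)] sym[OF wP that(2,3)] by simp
    then show False using trans[OF wP that(2,1,3)] that(5) by blast
  qed
  obtain x1 d where d: "x1 \<in> P" "d \<in> Pe" "\<not> St E c0 d" "F y x1" "F y (x1 \<oplus> d \<oplus> d)"
  proof (cases "coset_cut E c0")
    \<comment> \<open>Here the upper cut is not that of a coset, so the class of \<open>c\<close>
      contains a point that no element of the stabilizer reaches from \<open>c\<close>. Half of this
      distance is still outside the stabilizer, which is closed under doubling.\<close>
    case False
    then have "\<not> coset_cut E c" using same_typeD(2)[OF SSc] by blast
    then obtain y' where y': "y' \<in> P" "E c y'" "\<And>g. g \<in> P \<Longrightarrow> e \<le> g \<Longrightarrow> St E c g \<Longrightarrow> \<not> y' \<le> c \<oplus> g"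
      unfolding coset_cut_def using cP refl[OF cP] by blast
    have "St E c e" unfolding St_def using op_unit by simp
    then have "c < y'" using y'(3)[OF unit_in] op_unit[OF cP] by simp
    then obtain g where g: "g \<in> Pe" "c \<oplus> g = y'" using op_diff[OF cP y'(1)] by auto
    then have ng: "\<not> St E c g" using y'(3)[of g] PeD by blast
    obtain d where d: "d \<in> Pe" "d \<oplus> d = g" using half_Pe[OF g(1)] by blast
    have dP: "d \<in> P" using PeD d(1) by blast
    have "\<not> St E c d" using St_double[OF cP dP] ng d(2) by blast
    then have "\<not> St E c0 d" using same_typeD(1)[OF SSc d(1)] by blast
    moreover have "c \<oplus> d \<oplus> d = y'" using op_assoc[OF cP dP dP] d(2) g(2) by simp
    moreover have "F y y'" using Fe.trans[OF xyz(2) cP y'(1) yc] EF[OF cP y'(1,2)] by blast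
    ultimately show thesis using that[OF cP d(1)] yc by simp
  next
    \<comment> \<open>Both ends are cuts above cosets, of \<open>a\<close> and of \<open>b\<close>.
      Their distance is halved twice: the first half moves \<open>b\<close> over the lower end into
      the class, and the second leaves room for two more steps up to \<open>a\<close>.\<close>
    case True
    then have "coset_cut E c" "coset_cut E w" using same_typeD(2) SSc SSw by blast+
    then obtain a b where a: "a \<in> P" "E c a" and b: "b \<in> P" "E w b"
      "\<And>k. k \<in> P \<Longrightarrow> E w k \<Longrightarrow> \<exists>g\<in>P. e \<le> g \<and> St E w g \<and> k \<le> b \<oplus> g"
      unfolding coset_cut_def by blast
    have ya: "F y a" using Fe.trans[OF xyz(2) cP a(1) yc] EF[OF cP a] by blast
    have "b < a" by (rule Fe.less_class[OF wP b(1) xyz(2) a(1) wy' wy(2) EF[OF wP b(1,2)] ya])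
    then obtain g where g: "g \<in> Pe" "b \<oplus> g = a" using op_diff[OF b(1) a(1)] by auto
    have "\<not> E w a" using EF[OF wP a(1)] wy(2) Fe.trans[OF wP a(1) xyz(2)] Fe.sym[OF xyz(2) a(1) ya] by blast
    then have ng: "\<not> St E w g" using b(1,2) g(2) unfolding St_def by blast
    obtain d where d: "d \<in> Pe" "d \<oplus> d = g" using half_Pe[OF g(1)] by blast
    have dP: "d \<in> P" using PeD d(1) by blast
    have nd: "\<not> St E w d" using St_double[OF wP dP] ng d(2) by blast
    obtain d1 where d1: "d1 \<in> Pe" "d1 \<oplus> d1 = d" using half_Pe[OF d(1)] by blast
    have d1P: "d1 \<in> P" using PeD d1(1) by blast
    have "\<not> St E w d1" using St_double[OF wP d1P] nd d1(2) by blast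
    then have nd1: "\<not> St E c0 d1" using same_typeD(1)[OF SSw d1(1)] by blast
    have bdP: "b \<oplus> d \<in> P" using op_in b(1) dP by blast
    have "b \<oplus> d \<oplus> d1 \<oplus> d1 = b \<oplus> d \<oplus> d" using op_assoc[OF bdP d1P d1P] d1(2) by simp
    also have bdd: "\<dots> = a" using op_assoc[OF b(1) dP dP] d(2) g(2) by simp
    finally have eq: "b \<oplus> d \<oplus> d1 \<oplus> d1 = a" .
    have nE: "\<not> E w (b \<oplus> d)"
    proof
      assume "E w (b \<oplus> d)"
      then obtain g where g: "g \<in> P" "St E w g" "b \<oplus> d \<le> b \<oplus> g" using b(3)[OF bdP] by blast
      then have "d \<le> g" using op_le'[OF dP g(1) b(1)] by blast
      then show False using St_antimono[OF wP d(1) g(1) _ g(2)] nd by blast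
    qed
    have "F y (b \<oplus> d)"
      by (rule L[OF bdP a(1) above[OF bdP b(1,2) le_op[OF b(1) d(1)] nE] nE _ ya])
        (use le_op[OF bdP d(1)] bdd in simp)
    then show thesis using that[OF bdP d1(1) nd1] eq ya by simp
  qed
  define y1 where "y1 = x1 \<oplus> d \<oplus> d"
  have dP: "d \<in> P" using PeD d(2) by blast
  have xdP: "x1 \<oplus> d \<in> P" and y1P: "y1 \<in> P" using op_in d(1) dP unfolding y1_def by blast+
  have yy1: "F y y1" using d(5) unfolding y1_def .
  have "\<not> St E w d" using same_typeD(1)[OF SSw d(2)] d(3) by blast
  \<comment> \<open>As \<open>d\<close> does not stabilize the cut above \<open>w\<close>, some
    \<open>k\<close> below this cut is carried across it, and \<open>p\<close> lands within
    \<open>d\<close> of the lower end.\<close>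
  then obtain k where k: "k \<in> P" "E w k" "\<not> E w (k \<oplus> d)" unfolding St_def by blast
  define p where "p = k \<oplus> d"
  have pP: "p \<in> P" unfolding p_def using op_in k(1) dP by blast
  have kp: "k \<le> p" unfolding p_def by (rule le_op[OF k(1) d(2)])
  have "k < x1" by (rule Fe.less_class[OF wP k(1) xyz(2) d(1) wy' wy(2) EF[OF wP k(1,2)] d(4)])
  then have px: "p < x1 \<oplus> d" unfolding p_def using op_less[OF k(1) d(1) dP] by blast
  have xy1: "x1 \<oplus> d \<le> y1" unfolding y1_def by (rule le_op[OF xdP d(2)])
  have np: "\<not> E w p" using k(3) unfolding p_def .
  have yp: "F y p" by (rule L[OF pP y1P above[OF pP k(1,2) kp np] np _ yy1]) (use px xy1 in simp)
  have pdP: "p \<oplus> d \<in> P" using op_in pP dP by blast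
  have "p \<oplus> d < y1" unfolding y1_def using op_less[OF pP xdP dP] px by blast
  then have pd: "F p (p \<oplus> d)"
    using Fe.conv[OF pP pdP y1P le_op[OF pP d(2)]] Fe.trans[OF pP xyz(2) y1P Fe.sym[OF xyz(2) pP yp] yy1] by simp
  have "\<not> F k p"
  proof
    assume "F k p"
    then have "F w p" using Fe.trans[OF wP k(1) pP EF[OF wP k(1,2)]] by blast
    then show False using Fe.trans[OF wP pP xyz(2) _ Fe.sym[OF xyz(2) pP yp]] wy(2) by blast
  qed
  then have up: "\<not> upper_part F p"
    unfolding upper_part_def using pd k(1) dP PeD(2)[OF d(2)] p_def by blast
  have "\<not> St E c d" using same_typeD(1)[OF SSc d(2)] d(3) by blast
  \<comment> \<open>The same argument at the upper end: \<open>q\<close> is inside the class and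
    \<open>q \<oplus> d\<close> is beyond it.\<close>
  then obtain q where q: "q \<in> P" "E c q" "\<not> E c (q \<oplus> d)" unfolding St_def by blast
  have qdP: "q \<oplus> d \<in> P" using op_in q(1) dP by blast
  have yq: "F y q" using Fe.trans[OF xyz(2) cP q(1) yc] EF[OF cP q(1,2)] by blast
  have nqd: "\<not> F y (q \<oplus> d)"
  proof
    assume *: "F y (q \<oplus> d)"
    have "\<not> c \<le> q \<oplus> d" using c(2)[of "q \<oplus> d"] * qdP q(3) by blast
    then have "E q (q \<oplus> d)"
      using conv[OF q(1) qdP cP le_op[OF q(1) d(2)]] sym[OF cP q(1,2)] by simp
    then show False using trans[OF cP q(1) qdP q(2)] q(3) by blast
  qed
  have nqd': "\<not> F q (q \<oplus> d)" using Fe.trans[OF xyz(2) q(1) qdP yq] nqd by blast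
  have qy1: "F q y1" using Fe.trans[OF q(1) xyz(2) y1P Fe.sym[OF xyz(2) q(1) yq] yy1] .
  have "y1 < q \<oplus> d"
    using Fe.conv[OF q(1) qdP y1P le_op[OF q(1) d(2)] _ qy1] nqd' by (metis not_le)
  then have xq: "x1 \<oplus> d < q" unfolding y1_def using op_less[OF xdP q(1) dP] by blast
  \<comment> \<open>If \<open>q \<oplus> g\<close> stays in the class then \<open>g < d\<close>;
    since \<open>q\<close> exceeds \<open>x1 \<oplus> d\<close>, the point \<open>v\<close> that is
    \<open>g\<close> below \<open>q\<close> exceeds \<open>x1\<close> and is in the class as
    well.\<close>
  have uq: "upper_part F q" unfolding upper_part_def
  proof (intro conjI ballI impI notI)
    fix v g assume v: "v \<in> P" "g \<in> P" "e \<le> g \<and> v \<oplus> g = q \<and> \<not> F v q" "F q (q \<oplus> g)"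
    have gPe: "g \<in> Pe" using PeI v by blast
    have "\<not> d \<le> g"
    proof
      assume "d \<le> g"
      then have "q \<oplus> d \<le> q \<oplus> g" using op_le'[OF dP v(2) q(1)] by blast
      then show False using Fe.conv[OF q(1) qdP op_in[OF q(1) v(2)] le_op[OF q(1) d(2)] _ v(4)] nqd' by blast
    qed
    then have gd: "x1 \<oplus> g \<le> x1 \<oplus> d" using op_le'[OF v(2) dP d(1)] by simp
    have "x1 \<le> v"
    proof (rule ccontr)
      assume "\<not> x1 \<le> v"
      then have "v \<oplus> g < x1 \<oplus> g" using op_less[OF v(1) d(1) v(2)] by simp
      then show False using gd xq v(3) by simp
    qed
    moreover have "v \<le> q" using le_op[OF v(1) gPe] v(3) by simp
    moreover have "F x1 q" using Fe.trans[OF d(1) xyz(2) q(1) Fe.sym[OF xyz(2) d(1,4)] yq] .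
    ultimately have "F v q" using Fe.conv2[OF d(1) v(1) q(1)] by blast
    then show False using v(3) by blast
  qed (rule q(1))
  show thesis by (rule that[OF pP q(1) yp yq _ up uq]) (use px xq in simp)
qed

text \<open>The set \<open>S\<close> of alternation numbers reached within a class separates all
  classes except possibly the last from each other, and the Boolean in the label marks the last
  one.\<close>

lemma idx_type_equiv:
  fixes c0 defines "F \<equiv> type_equiv E c0"
  assumes B: "\<And>x. \<not> alt (upper_part F) B x"
  shows "idx F P (card ((UNIV :: bool set) \<times> Pow {..<B}))"
proof -
  interpret Fe: convex_equiv P F unfolding F_def by standard (rule type_equiv_cequiv)
  define D where "D = upper_part F"
  have altB: "n < B" if "alt D n w" for n w
  proof (rule ccontr)
    assume "\<not> n < B"
    then have "B \<le> n" by simp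
    then have "alt D B w" using that by (induction rule: dec_induct) (auto dest: alt_Suc_imp simp del: alt.simps)
    then show False using B unfolding D_def by blast
  qed
  define S where "S y = {n. \<exists>w\<in>P. F y w \<and> alt D n w}" for y
  have main: False if xy: "x \<in> P" "y \<in> P" "x < y" "\<not> F x y" "S x = S y" "z \<in> P" "y < z" "\<not> F y z"
    for x y z
  proof -
    obtain p q where pq: "p \<in> P" "q \<in> P" "F y p" "F y q" "p < q" "\<not> D p" "D q"
      using class_switch[OF xy(1,2,6,3,7)] xy(4,8) unfolding D_def F_def by blast
    \<comment> \<open>A number of alternations reached in the class of \<open>x\<close> grows by one
      between \<open>p\<close> and \<open>q\<close> in the class of \<open>y\<close>. Equality of
      the two sets brings the larger number back to \<open>x\<close>, so the numbers are
      unbounded.\<close>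
    have "n \<in> S x" for n
    proof (induction n)
      case 0
      show ?case unfolding S_def using Fe.refl xy(1) by auto
    next
      case (Suc n)
      then obtain w where w: "w \<in> P" "F x w" "alt D n w" unfolding S_def by blast
      have "w < p" by (rule Fe.less_class[OF xy(1) w(1) xy(2) pq(1) xy(3,4) w(2) pq(3)])
      then have "alt D n p" using alt_mono[OF w(3)] by simp
      then have "alt D (Suc n) q" using pq by auto
      then show ?case using xy(5) pq unfolding S_def by blast
    qed
    then show False using altB unfolding S_def by blast
  qed
  define f where "f y = (\<exists>z\<in>P. y < z \<and> \<not> F y z, S y)" for y
  have less: "F x y" if "x \<in> P" "y \<in> P" "f x = f y" "x < y" for x y
  proof (rule ccontr)
    assume nF: "\<not> F x y"
    then have "\<exists>z\<in>P. y < z \<and> \<not> F y z" using that unfolding f_def by blast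
    then show False using main[OF that(1,2,4) nF] that(3) unfolding f_def by blast
  qed
  show ?thesis
  proof (rule idxI[OF _ order_refl, where f = f])
    show "f ` P \<subseteq> UNIV \<times> Pow {..<B}" unfolding f_def S_def using altB by blast
    fix x y assume xy: "x \<in> P" "y \<in> P" "f x = f y"
    consider "x < y" | "x = y" | "y < x" by force
    then show "F x y"
      using less[OF xy] less[OF xy(2,1) xy(3)[symmetric]] Fe.refl[OF xy(1)] Fe.sym[OF xy(2,1)]
      by cases auto
  qed simp
qed

text \<open>The key of a cut is its type: the labels of its stabilizer in the chain and the flag
  \<open>coset_cut\<close>. On the cuts of one type, \<open>E\<close> and the relation that keeps
  only this type agree, and the latter is bounded by the alternation bound.\<close>

lemma idx_from_stab_equiv:
  assumes N: "idx (stab_equiv E) Pe N" and B: "\<And>c x. \<not> alt (upper_part (type_equiv E c)) B x"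
  shows "idx E P (card (Pow {..<N} \<times> (UNIV :: bool set)) * card ((UNIV :: bool set) \<times> Pow {..<B}))"
proof -
  obtain f :: "'a \<Rightarrow> nat" where f: "\<forall>x\<in>Pe. f x < N" "\<forall>x\<in>Pe. \<forall>y\<in>Pe. f x = f y \<longrightarrow> stab_equiv E x y"
    using N unfolding idx_def by blast
  define key where "key x = (f ` {g \<in> Pe. St E x g}, coset_cut E x)" for x
  have St: "St E y g" if "key x = key y" "x \<in> P" "y \<in> P" "g \<in> Pe" "St E x g" for x y g
  proof -
    have "f g \<in> f ` {g \<in> Pe. St E x g}" using that(4,5) by blast
    then have "f g \<in> f ` {g \<in> Pe. St E y g}" using that(1) unfolding key_def by simp
    then obtain h where h: "h \<in> Pe" "St E y h" "f h = f g" by auto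
    then have "stab_equiv E h g" using f(2) that(4) by blast
    then show ?thesis using h(2) that(3) unfolding stab_equiv_def by blast
  qed
  have type: "same_type E x y" if "key x = key y" "x \<in> P" "y \<in> P" for x y
    using St[OF that] St[OF that(1)[symmetric] that(3,2)] that(1) unfolding same_type_def key_def Pe_def by blast
  show ?thesis
  proof (rule idx_fibers[where key = key, OF _ order_refl])
    show "key ` P \<subseteq> Pow {..<N} \<times> UNIV" using f(1) unfolding key_def by blast
    fix b assume "b \<in> key ` P"
    then obtain c where c: "c \<in> P" "b = key c" by blast
    have less: "E x y" if "x \<in> P" "y \<in> P" "key x = b" "type_equiv E c x y" "x < y" for x y
    proof (rule ccontr)
      assume "\<not> E x y"
      then show False
        using not_type_equiv[OF that(1) less_imp_le[OF that(5)]] type[OF _ that(1) c(1)] that(3,4) c(2) by blast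
    qed
    have "E x y" if xy: "x \<in> P" "y \<in> P" "key x = b" "key y = b" "type_equiv E c x y" for x y
    proof -
      have "type_equiv E c y x" using xy(5) unfolding type_equiv_def by blast
      moreover consider "x < y" | "x = y" | "y < x" by force
      ultimately show ?thesis using less[OF xy(1,2,3,5)] less[OF xy(2,1,4)] refl[OF xy(1)] sym[OF xy(2,1)]
        by cases auto
    qed
    then show "\<exists>F. idx F P (card ((UNIV :: bool set) \<times> Pow {..<B})) \<and>
      (\<forall>x\<in>P. \<forall>y\<in>P. key x = b \<longrightarrow> key y = b \<longrightarrow> F x y \<longrightarrow> E x y)"
      using idx_type_equiv[OF B, of c] by blast
  qed simp
qed

end

context divisible_group
begin

text \<open>The function \<open>h\<close> depends on the family only: finiteness of the member
  enters as a hypothesis, while its size \<open>n\<close> does not enter the bound. For this the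
  alternation bound is taken over the family with the element that fixes the type as a further
  parameter.\<close>

lemma stab_reduction:
  assumes E: "dfn K es (\<lambda>\<rho>. E (\<lambda>i. \<rho> (Suc (Suc i))) (\<rho> 0) (\<rho> (Suc 0)))"
  obtains h :: "nat \<Rightarrow> nat" where
    "\<And>\<tau> n N. cequiv P (E \<tau>) \<Longrightarrow> idx (E \<tau>) P n \<Longrightarrow> idx (stab_equiv (E \<tau>)) Pe N \<Longrightarrow> idx (E \<tau>) P (h N)"
proof -
  obtain B where B: "\<And>\<tau> x. \<not> alt ((\<lambda>\<tau>. upper_part (type_equiv (E (\<lambda>i. \<tau> (Suc i))) (\<tau> 0))) \<tau>) B x"
    using alt_bound[where D = "\<lambda>\<tau>. upper_part (type_equiv (E (\<lambda>i. \<tau> (Suc i))) (\<tau> 0))", OF dfn_upper_part[OF E]]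
    by blast
  show thesis
  proof (rule that)
    fix \<tau> n N assume *: "cequiv P (E \<tau>)" "idx (E \<tau>) P n" "idx (stab_equiv (E \<tau>)) Pe N"
    interpret finite_convex_equiv K P op e "E \<tau>" n by unfold_locales (use * in auto)
    show "idx (E \<tau>) P (card (Pow {..<N} \<times> (UNIV :: bool set)) * card ((UNIV :: bool set) \<times> Pow {..<B}))"
      by (rule idx_from_stab_equiv[OF *(3)]) (use B[of "case_nat c \<tau>" for c] in simp)
  qed
qed

end

text \<open>Each \<open>S g\<close> is a union of classes of \<open>E\<close>, so the labels of
  these classes recover it. It makes the auxiliary relations derived from a finite chain
  finite.\<close>

lemma idx_image:
  fixes S :: "'a \<Rightarrow> 'a set"
  assumes "idx E A n" "\<And>g. g \<in> P \<Longrightarrow> S g \<subseteq> A"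
    "\<And>g c c'. g \<in> P \<Longrightarrow> c \<in> S g \<Longrightarrow> c' \<in> A \<Longrightarrow> E c c' \<Longrightarrow> c' \<in> S g"
  shows "idx (\<lambda>g g'. S g = S g') P (card (Pow {..<n}))"
proof -
  obtain f :: "'a \<Rightarrow> nat" where f: "\<forall>x\<in>A. f x < n" "\<forall>x\<in>A. \<forall>y\<in>A. f x = f y \<longrightarrow> E x y"
    using assms(1) unfolding idx_def by blast
  have sub: "S a \<subseteq> S b" if "a \<in> P" "b \<in> P" "f ` S a = f ` S b" for a b
  proof
    fix c assume c: "c \<in> S a"
    then have "f c \<in> f ` S b" using that(3) by blast
    then obtain c' where c': "c' \<in> S b" "f c' = f c" by auto
    have "c \<in> A" "c' \<in> A" using c c'(1) assms(2) that by blast+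
    then show "c \<in> S b" using assms(3)[OF that(2) c'(1)] f(2) c'(2) by blast
  qed
  show ?thesis
  proof (rule idxI[OF _ order_refl, where f = "\<lambda>g. f ` S g"])
    show "(\<lambda>g. f ` S g) ` P \<subseteq> Pow {..<n}"
    proof (rule image_subsetI)
      fix g assume "g \<in> P"
      then show "f ` S g \<in> Pow {..<n}" using assms(2) f(1) by blast
    qed
    show "S x = S y" if "x \<in> P" "y \<in> P" "f ` S x = f ` S y" for x y
      using sub[OF that] sub[OF that(2,1) that(3)[symmetric]] by blast
  qed simp
qed

lemma idx_conj:
  assumes "idx E P n" "idx F P m" shows "idx (\<lambda>x y. E x y \<and> F x y) P (card ({..<n} \<times> {..<m}))"
proof -
  obtain f :: "'a \<Rightarrow> nat" where f: "\<forall>x\<in>P. f x < n" "\<forall>x\<in>P. \<forall>y\<in>P. f x = f y \<longrightarrow> E x y"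
    using assms(1) unfolding idx_def by blast
  obtain g :: "'a \<Rightarrow> nat" where g: "\<forall>x\<in>P. g x < m" "\<forall>x\<in>P. \<forall>y\<in>P. g x = g y \<longrightarrow> F x y"
    using assms(2) unfolding idx_def by blast
  show ?thesis
    by (rule idxI[OF _ order_refl, where f = "\<lambda>x. (f x, g x)"]) (use f g in auto)
qed

text \<open>Exhibits \<open>n + 1\<close> different classes of a convex equivalence relation, ending
  with that of \<open>x\<close>. For fixed \<open>n\<close> this is first-order, whereas
  \<open>idx\<close> quantifies over labellings.\<close>

primrec chain :: "('a::linordered_field \<Rightarrow> 'a \<Rightarrow> bool) \<Rightarrow> nat \<Rightarrow> 'a \<Rightarrow> bool" where
  "chain E 0 x \<longleftrightarrow> True"
| "chain E (Suc n) x \<longleftrightarrow> (\<exists>y. 0 \<le> y \<and> y < x \<and> \<not> E y x \<and> chain E n y)"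

lemma chain_Suc_imp: "chain E (Suc n) x \<Longrightarrow> chain E n x"
proof (induction n arbitrary: x)
  case (Suc n)
  then obtain y where "0 \<le> y" "y < x" "\<not> E y x" "chain E (Suc n) y"
    unfolding chain.simps(2)[of E "Suc n"] by blast
  with Suc.IH show ?case by auto
qed simp

text \<open>A chain ending in an earlier class can be prolonged by one to any later class. If two
  different classes had the same set of chain lengths, this set would contain all numbers.\<close>

lemma idx_chain:
  assumes "cequiv {0..} E" "\<And>x. 0 \<le> x \<Longrightarrow> \<not> chain E N x"
  shows "idx E {0..} (card (Pow {..<N}))"
proof -
  interpret convex_equiv "{0..}" E using assms(1) by unfold_locales
  define S where "S x = {n. chain E n x}" for x
  have lt: "n < N" if "chain E n x" "0 \<le> x" for n x
  proof (rule ccontr)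
    assume "\<not> n < N"
    then have "N \<le> n" by simp
    then have "chain E N x" using that(1)
      by (induction rule: dec_induct) (auto dest: chain_Suc_imp simp del: chain.simps)
    then show False using assms(2) that(2) by blast
  qed
  have less: "E x y" if "0 \<le> x" "x < y" "S x = S y" for x y
  proof (rule ccontr)
    assume nE: "\<not> E x y"
    have "n \<in> S x" for n
    proof (induction n)
      case (Suc n)
      then have "Suc n \<in> S y" unfolding S_def using that(1,2) nE by auto
      then show ?case using that(3) by simp
    qed (simp add: S_def)
    then show False using lt that(1) unfolding S_def by blast
  qed
  show ?thesis
  proof (rule idxI[OF _ order_refl, where f = S])
    show "S ` {0..} \<subseteq> Pow {..<N}" unfolding S_def using lt by auto
    fix x y assume xy: "x \<in> {0..}" "y \<in> {0..}" "S x = S y"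
    consider "x < y" | "x = y" | "y < x" by force
    then show "E x y"
    proof cases
      case 1 then show ?thesis using less[of x y] xy by simp
    next
      case 2 then show ?thesis using refl[OF xy(1)] by simp
    next
      case 3 then show ?thesis using less[of y x] sym[OF xy(2,1)] xy by simp
    qed
  qed simp
qed

lemma chain_le_idx:
  assumes "cequiv {0..} E" "idx E {0..} m" "chain E n x" "0 \<le> x"
  shows "n < m"
proof -
  interpret convex_equiv "{0..}" E using assms(1) by unfold_locales
  obtain f :: "'a \<Rightarrow> nat" where f: "\<forall>x\<in>{0..}. f x < m" "\<forall>x\<in>{0..}. \<forall>y\<in>{0..}. f x = f y \<longrightarrow> E x y"
    using assms(2) unfolding idx_def by (elim exE conjE)
  have fin: "finite (f ` {0..x})" for x
  proof (rule finite_subset)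
    show "f ` {0..x} \<subseteq> {..<m}" using f(1) by (intro image_subsetI) simp
  qed simp
  have "Suc n \<le> card (f ` {0..x})" using assms(3,4)
  proof (induction n arbitrary: x)
    case 0
    then have "f ` {0..x} \<noteq> {}" by auto
    then have "card (f ` {0..x}) > 0" using fin card_gt_0_iff by blast
    then show ?case by simp
  next
    case (Suc n)
    then obtain y where y: "0 \<le> y" "y < x" "\<not> E y x" "chain E n y" by auto
    have "f x \<notin> f ` {0..y}"
    proof
      assume "f x \<in> f ` {0..y}"
      then obtain w where w: "0 \<le> w" "w \<le> y" "f w = f x" by auto
      then have "E w x" using f(2) Suc.prems(2) by auto
      then show False using conv2[OF _ _ _ w(2) less_imp_le[OF y(2)]] w(1) y(1,3) Suc.prems(2) by simp
    qed
    then have "Suc (card (f ` {0..y})) = card (insert (f x) (f ` {0..y}))"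
      by (rule card_insert_disjoint[OF fin, symmetric])
    also have "\<dots> \<le> card (f ` {0..x})"
    proof (rule card_mono[OF fin])
      have "{0..y} \<subseteq> {0..x}" using y(2) by auto
      moreover have "x \<in> {0..x}" using Suc.prems(2) by simp
      ultimately show "insert (f x) (f ` {0..y}) \<subseteq> f ` {0..x}" by blast
    qed
    finally show ?case using Suc.IH[OF y(4,1)] by simp
  qed
  also have "\<dots> \<le> card {..<m}" by (intro card_mono image_subsetI) (use f(1) in simp_all)
  finally show ?thesis by simp
qed

section \<open>Definable families of convex equivalence relations\<close>

abbreviation dfn2 where
  "dfn2 K es E \<equiv> dfn K es (\<lambda>\<rho>. E (\<lambda>i. \<rho> (Suc (Suc i))) (\<rho> 0) (\<rho> (Suc 0)))"

text \<open>As in uniform finiteness, members with infinitely many classes are left out; the members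
  with some finite bound are to have a common one.\<close>

definition unif_bounded ::
  "('a::linordered_field, 'f, 'r) expansion \<Rightarrow> 'a set \<Rightarrow> (('a \<Rightarrow> 'a \<Rightarrow> bool) \<Rightarrow> bool) \<Rightarrow> bool" where
  "unif_bounded K P good \<longleftrightarrow> (\<forall>es E. dfn2 K es E \<longrightarrow>
     (\<exists>N. \<forall>\<tau> n. good (E \<tau>) \<longrightarrow> idx (E \<tau>) P n \<longrightarrow> idx (E \<tau>) P N))"

definition convex_ring :: "'a::linordered_field set \<Rightarrow> bool" where
  "convex_ring O' \<longleftrightarrow> 1 \<in> O' \<and> (\<forall>x\<in>O'. \<forall>y\<in>O'. x + y \<in> O' \<and> x * y \<in> O') \<and>
     (\<forall>x\<in>O'. \<forall>y. \<bar>y\<bar> \<le> \<bar>x\<bar> \<longrightarrow> y \<in> O')"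

lemma convex_ringD:
  assumes "convex_ring O'"
  shows "1 \<in> O'" "x \<in> O' \<Longrightarrow> y \<in> O' \<Longrightarrow> x + y \<in> O'" "x \<in> O' \<Longrightarrow> y \<in> O' \<Longrightarrow> x * y \<in> O'"
    "x \<in> O' \<Longrightarrow> \<bar>y\<bar> \<le> \<bar>x\<bar> \<Longrightarrow> y \<in> O'"
proof -
  have *: "1 \<in> O'" "\<forall>x\<in>O'. \<forall>y\<in>O'. x + y \<in> O' \<and> x * y \<in> O'" "\<forall>x\<in>O'. \<forall>y. \<bar>y\<bar> \<le> \<bar>x\<bar> \<longrightarrow> y \<in> O'"
    using assms unfolding convex_ring_def by blast+
  show "1 \<in> O'" by (rule *(1))
  show "x \<in> O' \<Longrightarrow> y \<in> O' \<Longrightarrow> x + y \<in> O'" "x \<in> O' \<Longrightarrow> y \<in> O' \<Longrightarrow> x * y \<in> O'"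
    using *(2) by blast+
  show "x \<in> O' \<Longrightarrow> \<bar>y\<bar> \<le> \<bar>x\<bar> \<Longrightarrow> y \<in> O'" using *(3) by blast
qed

text \<open>
  Finite chains of cuts, of convex subgroups of \<open>K\<close>, of the value group, and of the residue
  field are encoded as convex equivalence relations on \<open>K\<close>, on its nonnegative elements,
  on its elements above \<open>1\<close>, and again on its nonnegative elements.
\<close>

definition "cut_good E \<longleftrightarrow> cequiv UNIV E"
definition "add_good E \<longleftrightarrow> cequiv {0::'a::linordered_field..} E \<and> (\<forall>x\<ge>0. E x (x + x))"
definition "val_good O' E \<longleftrightarrow> cequiv {1::'a::linordered_field..} E \<and> (\<forall>x\<ge>1. E x (x * x)) \<and>
  (\<forall>u\<ge>1. u \<in> O' \<longrightarrow> E 1 u)"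
definition "res_good O' E \<longleftrightarrow> add_good E \<and> (\<forall>x\<ge>0. x = 0 \<or> inverse x \<notin> O' \<longrightarrow> E 0 x) \<and>
  (\<forall>x\<ge>0. \<forall>y\<ge>0. x \<notin> O' \<longrightarrow> y \<notin> O' \<longrightarrow> E x y)"
text \<open>Chains of cuts of the value group, pulled back to the positive elements: an element
  \<open>u \<ge> 1\<close> of the convex ring is a unit, and multiplication by it crosses no
  cut.\<close>

definition "unit_good O' E \<longleftrightarrow> cequiv {0::'a::linordered_field<..} E \<and>
  (\<forall>x>0. \<forall>u\<ge>1. u \<in> O' \<longrightarrow> E x (x * u))"

lemma dfn_fix:
  assumes "dfn K es \<phi>"
  obtains es' where "set es \<subseteq> set es'" "dfn K es' (\<lambda>\<rho>. \<phi> (\<lambda>i. if i < k then \<rho> i else \<tau> (i - k)))"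
proof -
  obtain N where N: "\<And>\<rho> \<rho>'. (\<And>i. i < N \<Longrightarrow> \<rho> i = \<rho>' i) \<Longrightarrow> \<phi> \<rho> = \<phi> \<rho>'"
    using dfn_support[OF assms] by blast
  define es' where "es' = 0 # es @ map \<tau> [0..<N]"
  define T where "T i = (if i < k then (\<lambda>\<rho>. \<rho> i) else (\<lambda>_ :: nat \<Rightarrow> 'a. if i - k < N then \<tau> (i - k) else 0))" for i
  have "dfn K es' \<phi>" by (rule dfn_mono[OF assms]) (auto simp: es'_def)
  moreover have "dterm K es' (T i)" for i
  proof (cases "i < k")
    case True
    then show ?thesis unfolding T_def using dterm_var by simp
  next
    case False
    then show ?thesis unfolding T_def by (auto simp: es'_def intro!: dterm_const)
  qed
  ultimately have "dfn K es' (\<lambda>\<rho>. \<phi> (\<lambda>i. T i \<rho>))" by (rule dfn_subst)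
  moreover have "\<phi> (\<lambda>i. T i \<rho>) = \<phi> (\<lambda>i. if i < k then \<rho> i else \<tau> (i - k))" for \<rho>
    by (rule N) (auto simp: T_def less_imp_diff_less)
  ultimately have "dfn K es' (\<lambda>\<rho>. \<phi> (\<lambda>i. if i < k then \<rho> i else \<tau> (i - k)))" by simp
  then show thesis by (rule that[rotated]) (auto simp: es'_def)
qed

lemma dfn_chain:
  assumes E: "dfn2 K es E"
  shows "dfn K es (\<lambda>\<rho>. chain (E (\<lambda>i. \<rho> (Suc i))) n (\<rho> 0))"
proof (induction n)
  case 0
  have "dfn K es (\<lambda>\<rho>. \<rho> 0 = \<rho> 0)" by (intro dfn_intros)
  then show ?case by simp
next
  case (Suc n)
  show ?case unfolding chain.simps
    by (intro dfn_intros dfn_app2[where E = E, OF E] dfn_app1[where D = "\<lambda>\<rho>. chain (E \<rho>) n", OF Suc])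
qed

section \<open>Convexity of definable subgroups and divisibility of the two groups\<close>

context wom
begin

lemma no_infinite_alternation:
  assumes "dfn K es (\<lambda>\<rho>. D (\<rho> 0))"
    and "\<And>n. D (s n)" "\<And>n. \<not> D (t n)" "\<And>n. s n < t n" "\<And>n. t n < s (Suc n)"
  shows False
proof -
  obtain B where B: "\<And>x. \<not> alt D B x"
  proof (rule alt_bound[where D = "\<lambda>_. D", OF assms(1)])
    fix B assume "\<And>\<tau> :: nat \<Rightarrow> 'a. \<And>x. \<not> alt D B x"
    then have "\<And>x. \<not> alt D B x" .
    then show thesis by (rule that)
  qed
  have "alt D n (s n)" for n
  proof (induction n)
    case (Suc n)
    have "alt D n (t n)" using alt_mono[OF Suc less_imp_le[OF assms(4)]] .
    then show ?case unfolding alt.simps using assms(2)[of "Suc n"] assms(3)[of n] assms(5)[of n]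
      by (intro exI[of _ "s (Suc n)"] exI[of _ "t n"] conjI) simp_all
  qed simp
  then show False using B by blast
qed

text \<open>The multiples of \<open>a\<close> are in the subgroup and their translates by
  \<open>b\<close> are not, which would give infinitely many alternations.\<close>

lemma definable_subgroup_convex:
  assumes D: "dfn K es (\<lambda>\<rho>. D (\<rho> 0))"
    and sub: "D 0" "\<And>x y. D x \<Longrightarrow> D y \<Longrightarrow> D (x + y)" "\<And>x y. D x \<Longrightarrow> D y \<Longrightarrow> D (x - y)"
    and a: "D a" "0 \<le> b" "b \<le> a"
  shows "D b"
proof (rule ccontr)
  assume nb: "\<not> D b"
  with a sub(1) have b: "0 < b" "b < a" by (auto simp: order_le_less)
  have s: "D (of_nat n * a)" for n
    by (induction n) (use sub a(1) in \<open>auto simp: algebra_simps\<close>)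
  show False
  proof (rule no_infinite_alternation[where D = D and s = "\<lambda>n. of_nat n * a" and t = "\<lambda>n. of_nat n * a + b"])
    show "\<not> D (of_nat n * a + b)" for n
    proof
      assume "D (of_nat n * a + b)"
      then have "D (of_nat n * a + b - of_nat n * a)" using sub(3) s by blast
      then show False using nb by simp
    qed
    show "of_nat n * a + b < of_nat (Suc n) * a" for n using b(2) by (simp add: algebra_simps)
  qed (use D s b in auto)
qed

text \<open>If \<open>c > 1\<close> were not a square, the even powers of \<open>c\<close> would be
  squares and the odd ones would not, an infinite alternation. The multiplicative group of positive
  elements is thereby divisible by 2.\<close>

lemma ex_sqrt:
  assumes "0 < (c::'a)" shows "\<exists>y>0. y * y = c"
proof -
  have *: "\<exists>y. y * y = c" if c: "1 < (c::'a)" for c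
  proof (rule ccontr)
    assume n: "\<not> (\<exists>y. y * y = c)"
    have c0: "0 < c" using c by (meson less_trans zero_less_one)
    show False
    proof (rule no_infinite_alternation[where D = "\<lambda>x. \<exists>y. y * y = x" and s = "\<lambda>n. c ^ n * c ^ n"
          and t = "\<lambda>n. c ^ n * c ^ n * c"])
      show "dfn K [] (\<lambda>\<rho>. \<exists>y. y * y = \<rho> 0)" by (intro dfn_intros)
      show "\<not> (\<exists>y. y * y = c ^ n * c ^ n * c)" for n
      proof
        assume "\<exists>y. y * y = c ^ n * c ^ n * c"
        then obtain y where y: "y * y = c ^ n * c ^ n * c" by blast
        then have "(y / c ^ n) * (y / c ^ n) = c" using c0 by simp
        then show False using n by blast
      qed
      show "c ^ n * c ^ n < c ^ n * c ^ n * c" for n using c c0 by simp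
      show "c ^ n * c ^ n * c < c ^ Suc n * c ^ Suc n" for n using c c0 by (simp add: algebra_simps)
    qed blast
  qed
  have "\<exists>y. y * y = c"
  proof (cases c "1::'a" rule: linorder_cases)
    case less
    then have "1 < inverse c" using assms by (simp add: one_less_inverse)
    then obtain y where "y * y = inverse c" using * by blast
    then have "inverse y * inverse y = c" by (metis inverse_inverse_eq inverse_mult_distrib)
    then show ?thesis by blast
  next
    case equal
    then have "1 * 1 = c" by simp
    then show ?thesis by blast
  qed (rule *)
  then obtain y where y: "y * y = c" by blast
  then have "\<bar>y\<bar> * \<bar>y\<bar> = c" "0 < \<bar>y\<bar>" using assms by auto
  then show ?thesis by blast
qed

lemma divisible_add: "divisible_group K UNIV (+) 0"
proof (unfold_locales)
  fix x :: 'a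
  show "\<exists>y\<in>UNIV. x + y = 0" by (rule bexI[of _ "- x"]) auto
  have "x / 2 + x / 2 = x" by simp
  then show "\<exists>y\<in>UNIV. y + y = x" by blast
next
  fix es and f :: "(nat \<Rightarrow> 'a) \<Rightarrow> 'a"
  have "dfn K es (\<lambda>\<rho>. \<rho> 0 = \<rho> 0)" by (intro dfn_intros)
  then show "dfn K es (\<lambda>\<rho>. f \<rho> \<in> UNIV)" by simp
qed (auto intro: dfn_intros)

lemma divisible_mult: "divisible_group K {0<..} (*) 1"
proof (unfold_locales)
  fix x :: 'a assume x: "x \<in> {0<..}"
  show "\<exists>y\<in>{0<..}. x * y = 1" by (rule bexI[of _ "inverse x"]) (use x in auto)
  show "\<exists>y\<in>{0<..}. y * y = x" using ex_sqrt[of x] x by auto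
next
  fix es and f :: "(nat \<Rightarrow> 'a) \<Rightarrow> 'a" assume "dterm K es f"
  then show "dfn K es (\<lambda>\<rho>. f \<rho> \<in> {0<..})" unfolding greaterThan_iff by (intro dfn_intros)
qed (auto intro: dfn_intros)

lemma cut_bounded:
  assumes "unif_bounded K {0..} add_good" shows "unif_bounded K UNIV cut_good"
  unfolding unif_bounded_def
proof (intro allI impI)
  fix es and E :: "(nat \<Rightarrow> 'a) \<Rightarrow> 'a \<Rightarrow> 'a \<Rightarrow> bool" assume E: "dfn2 K es E"
  interpret divisible_group K UNIV "(+)" 0 by (rule divisible_add)
  have Pe: "Pe = {0..}" unfolding Pe_def by auto
  obtain h where h: "\<And>\<tau> n N. cequiv UNIV (E \<tau>) \<Longrightarrow> idx (E \<tau>) UNIV n \<Longrightarrow> idx (stab_equiv (E \<tau>)) Pe N \<Longrightarrow> idx (E \<tau>) UNIV (h N)"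
    using stab_reduction[OF E] by blast
  obtain N where N: "\<And>\<tau> n. add_good (stab_equiv (E \<tau>)) \<Longrightarrow> idx (stab_equiv (E \<tau>)) {0..} n \<Longrightarrow> idx (stab_equiv (E \<tau>)) {0..} N"
    using assms[unfolded unif_bounded_def, rule_format, OF dfn_stab_equiv[OF E]] by blast
  have "idx (E \<tau>) UNIV (h N)" if g: "cut_good (E \<tau>)" and n: "idx (E \<tau>) UNIV n" for \<tau> n
  proof -
    have ce: "cequiv UNIV (E \<tau>)" using g unfolding cut_good_def .
    interpret finite_convex_equiv K UNIV "(+)" 0 "E \<tau>" n by unfold_locales (use ce n in auto)
    obtain m where m: "idx (stab_equiv (E \<tau>)) Pe m" using idx_stab_equiv by blast
    have "add_good (stab_equiv (E \<tau>))"
      unfolding add_good_def using stab_equiv_cequiv stab_equiv_double unfolding Pe by simp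
    then have "idx (stab_equiv (E \<tau>)) Pe N" using N m unfolding Pe by blast
    then show ?thesis by (rule h[OF ce n])
  qed
  then show "\<exists>N. \<forall>\<tau> n. cut_good (E \<tau>) \<longrightarrow> idx (E \<tau>) UNIV n \<longrightarrow> idx (E \<tau>) UNIV N" by blast
qed

lemma unit_bounded:
  assumes "unif_bounded K {1..} (val_good O')" shows "unif_bounded K {0<..} (unit_good O')"
  unfolding unif_bounded_def
proof (intro allI impI)
  fix es and E :: "(nat \<Rightarrow> 'a) \<Rightarrow> 'a \<Rightarrow> 'a \<Rightarrow> bool" assume E: "dfn2 K es E"
  interpret divisible_group K "{0<..}" "(*)" 1 by (rule divisible_mult)
  have Pe: "Pe = {1..}" unfolding Pe_def by (auto intro: less_le_trans[OF zero_less_one])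
  obtain h where h: "\<And>\<tau> n N. cequiv {0<..} (E \<tau>) \<Longrightarrow> idx (E \<tau>) {0<..} n \<Longrightarrow> idx (stab_equiv (E \<tau>)) Pe N \<Longrightarrow> idx (E \<tau>) {0<..} (h N)"
    using stab_reduction[OF E] by blast
  obtain N where N: "\<And>\<tau> n. val_good O' (stab_equiv (E \<tau>)) \<Longrightarrow> idx (stab_equiv (E \<tau>)) {1..} n \<Longrightarrow> idx (stab_equiv (E \<tau>)) {1..} N"
    using assms[unfolded unif_bounded_def, rule_format, OF dfn_stab_equiv[OF E]] by blast
  have "idx (E \<tau>) {0<..} (h N)" if g: "unit_good O' (E \<tau>)" and n: "idx (E \<tau>) {0<..} n" for \<tau> n
  proof -
    have ce: "cequiv {0<..} (E \<tau>)" using g unfolding unit_good_def by blast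
    interpret finite_convex_equiv K "{0<..}" "(*)" 1 "E \<tau>" n by unfold_locales (use ce n in auto)
    obtain m where m: "idx (stab_equiv (E \<tau>)) Pe m" using idx_stab_equiv by blast
    \<comment> \<open>Elements \<open>u \<ge> 1\<close> of the ring stabilize every cut of a
      \<open>unit_good\<close> relation, so the chain of stabilizers comes from the value
      group.\<close>
    have "stab_equiv (E \<tau>) 1 u" if u: "1 \<le> u" "u \<in> O'" for u
    proof (rule stab_equiv_unit)
      show "u \<in> Pe" using u unfolding Pe by simp
      show "E \<tau> x (x * u)" if "x \<in> {0<..}" for x using g u that unfolding unit_good_def by auto
    qed
    then have "val_good O' (stab_equiv (E \<tau>))"
      unfolding val_good_def using stab_equiv_cequiv stab_equiv_double unfolding Pe by simp
    then have "idx (stab_equiv (E \<tau>)) Pe N" using N m unfolding Pe by blast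
    then show ?thesis by (rule h[OF ce n])
  qed
  then show "\<exists>N. \<forall>\<tau> n. unit_good O' (E \<tau>) \<longrightarrow> idx (E \<tau>) {0<..} n \<longrightarrow> idx (E \<tau>) {0<..} N" by blast
qed

end

section \<open>Reduction to the value group and the residue field\<close>

lemma dfn_unop:
  assumes "dfn K es (\<lambda>\<rho>. D (\<rho> 0))" "dterm K es f" shows "dfn K es (\<lambda>\<rho>. D (f \<rho>))"
  by (rule dfn_app1[where D = "\<lambda>_. D" and T = "\<lambda>i \<rho>. \<rho> i", OF assms(1) dterm_var assms(2)])

lemma dfn_binop:
  assumes "dfn K es (\<lambda>\<rho>. E (\<rho> 0) (\<rho> (Suc 0)))" "dterm K es f" "dterm K es g"
  shows "dfn K es (\<lambda>\<rho>. E (f \<rho>) (g \<rho>))"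
  by (rule dfn_app2[where E = "\<lambda>_. E" and T = "\<lambda>i \<rho>. \<rho> i", OF assms(1) dterm_var assms(2,3)])

lemma cequiv_subset:
  assumes "cequiv P E" "Q \<subseteq> P" shows "cequiv Q E"
proof -
  interpret convex_equiv P E by unfold_locales (rule assms(1))
  show ?thesis unfolding cequiv_def
  proof (intro conjI ballI impI)
    fix x y z assume "x \<in> Q" "y \<in> Q" "z \<in> Q"
    then have *: "x \<in> P" "y \<in> P" "z \<in> P" using assms(2) by blast+
    { show "E x x" by (rule refl[OF *(1)]) }
    { show "E x y \<Longrightarrow> E y x" by (rule sym[OF *(1,2)]) }
    { show "E x y \<Longrightarrow> E y z \<Longrightarrow> E x z" by (rule trans[OF *]) }
    { show "x \<le> y \<Longrightarrow> y \<le> z \<Longrightarrow> E x z \<Longrightarrow> E x y" by (rule conv[OF *]) }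
  qed
qed

text \<open>The elements \<open>z\<close> with \<open>below E c z\<close> are the nonnegative part of the convex subgroup below \<open>c\<close>.\<close>

definition below :: "('a::linordered_field \<Rightarrow> 'a \<Rightarrow> bool) \<Rightarrow> 'a \<Rightarrow> 'a \<Rightarrow> bool" where
  "below E c z \<longleftrightarrow> 0 \<le> z \<and> z < c \<and> \<not> E z c"

text \<open>All classes from that of \<open>d\<close> on are merged, which leaves an initial segment
  of the chain with one class on top.\<close>

definition trunc :: "('a::linordered_field \<Rightarrow> 'a \<Rightarrow> bool) \<Rightarrow> 'a \<Rightarrow> 'a \<Rightarrow> 'a \<Rightarrow> bool" where
  "trunc E d x y \<longleftrightarrow> E x y \<or> ((d \<le> x \<or> E d x) \<and> (d \<le> y \<or> E d y))"

text \<open>Every class that is not the last has an immediate successor. Finite chains have this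
  property, and being first-order it passes to the chain produced by saturation.\<close>

definition discrete :: "('a::linordered_field \<Rightarrow> 'a \<Rightarrow> bool) \<Rightarrow> bool" where
  "discrete E \<longleftrightarrow> (\<forall>x y. 0 \<le> x \<and> x < y \<and> \<not> E x y \<longrightarrow>
     (\<exists>z. x < z \<and> z \<le> y \<and> \<not> E x z \<and> (\<forall>w. x \<le> w \<and> w \<le> z \<longrightarrow> E x w \<or> E w z)))"

section \<open>Chains of convex subgroups of the additive group\<close>

locale add_equiv =
  fixes E :: "'a::linordered_field \<Rightarrow> 'a \<Rightarrow> bool"
  assumes good: "add_good E"

sublocale add_equiv \<subseteq> convex_equiv "{0..}" E
  by unfold_locales (use good in \<open>simp add: add_good_def\<close>)

context add_equiv
begin

lemma double: "0 \<le> x \<Longrightarrow> E x (x + x)"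
  using good[unfolded add_good_def, THEN conjunct2] by simp

lemma refl0: "0 \<le> x \<Longrightarrow> E x x"
  by (rule refl) simp

lemma sym0: "0 \<le> x \<Longrightarrow> 0 \<le> y \<Longrightarrow> E x y \<Longrightarrow> E y x"
  by (rule sym) simp_all

lemma trans0: "0 \<le> x \<Longrightarrow> 0 \<le> y \<Longrightarrow> 0 \<le> z \<Longrightarrow> E x y \<Longrightarrow> E y z \<Longrightarrow> E x z"
  by (rule trans[of x y z]) simp_all

lemma conv0:
  assumes "0 \<le> x" "x \<le> y" "y \<le> z" "E x z" shows "E x y"
  by (rule conv[OF _ _ _ assms(2-4)]) (use assms in auto)

lemma conv20:
  assumes "0 \<le> x" "x \<le> y" "y \<le> z" "E x z" shows "E y z"
  by (rule conv2[OF _ _ _ assms(2-4)]) (use assms in auto)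

lemma below_down: "below E c z \<Longrightarrow> 0 \<le> y \<Longrightarrow> y \<le> z \<Longrightarrow> below E c y"
  unfolding below_def using conv20[of y z c] by auto

text \<open>A sum is at most twice the larger summand, and no cut separates an element from its
  double. The doubling condition of \<open>add_good\<close> is thus what makes the cuts into
  subgroups.\<close>

lemma below_add:
  assumes "below E c x" "below E c y" shows "below E c (x + y)"
proof -
  have *: "below E c (m + m)" if m: "below E c m" for m
  proof -
    have m': "0 \<le> m" "m < c" "\<not> E m c" using m unfolding below_def by auto
    have "m + m < c"
    proof (rule ccontr)
      assume "\<not> m + m < c"
      then show False using conv0[of m c "m + m"] double[OF m'(1)] m' by auto
    qed
    moreover have "\<not> E (m + m) c" using trans0[of m "m + m" c] double[OF m'(1)] m' by auto
    ultimately show ?thesis unfolding below_def using m'(1) by simp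
  qed
  have m: "below E c (max x y)" using assms by (simp add: max_def)
  have "0 \<le> x" "0 \<le> y" using assms unfolding below_def by auto
  then show ?thesis by (intro below_down[OF *[OF m]]) (auto simp: max_def)
qed

lemma below_cong:
  assumes "0 \<le> c" "0 \<le> c'" "E c c'" "below E c z" shows "below E c' z"
proof -
  have z: "0 \<le> z" "z < c" "\<not> E z c" using assms(4) unfolding below_def by auto
  have "z < c'" using less_class[of z z c c'] z assms(1-3) refl0[OF z(1)] by auto
  moreover have "\<not> E z c'" using trans0[of z c' c] sym0[of c c'] z assms(1-3) by auto
  ultimately show ?thesis unfolding below_def using z by simp
qed

text \<open>Of two different classes the later one has the earlier one below it, so a class can be
  recovered from its subgroup.\<close>

lemma below_det:
  assumes "0 \<le> c" "0 \<le> c'" "\<And>z. 0 \<le> z \<Longrightarrow> below E c z \<longleftrightarrow> below E c' z" shows "E c c'"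
proof (rule ccontr)
  assume nE: "\<not> E c c'"
  then have nE': "\<not> E c' c" using sym0 assms by blast
  consider "c < c'" | "c = c'" | "c' < c" by force
  then show False
  proof cases
    case 1
    then have "below E c' c" unfolding below_def using nE assms(1) by simp
    then show False using assms(3)[OF assms(1)] unfolding below_def by simp
  next
    case 2 then show False using nE refl0 assms(1) by simp
  next
    case 3
    then have "below E c c'" unfolding below_def using nE' assms(2) by simp
    then show False using assms(3)[OF assms(2)] unfolding below_def by simp
  qed
qed

lemma cut_up: "0 \<le> d \<Longrightarrow> 0 \<le> x \<Longrightarrow> x \<le> y \<Longrightarrow> d \<le> x \<or> E d x \<Longrightarrow> d \<le> y \<or> E d y"
  using conv0[of x y d] sym0[of d x] trans0[of d x y] by (cases "d \<le> y") auto

lemma cut_cong: "0 \<le> d \<Longrightarrow> 0 \<le> x \<Longrightarrow> 0 \<le> y \<Longrightarrow> E x y \<Longrightarrow> d \<le> x \<or> E d x \<Longrightarrow> d \<le> y \<or> E d y"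
proof -
  assume *: "0 \<le> d" "0 \<le> x" "0 \<le> y" "E x y" "d \<le> x \<or> E d x"
  show ?thesis
  proof (cases "d \<le> y")
    case False
    show ?thesis
    proof (cases "d \<le> x")
      case True
      have "E y x" by (rule sym0[OF *(2,3,4)])
      then have "E y d" using conv0[of y d x] True False * by auto
      then show ?thesis using sym0[of y d] * by auto
    next
      case nd: False
      then have "E d x" using * by blast
      then show ?thesis using trans0[of d x y] * by auto
    qed
  qed simp
qed

lemma trunc_cequiv: assumes d: "0 \<le> d" shows "cequiv {0..} (trunc E d)"
  unfolding cequiv_def
proof (intro conjI ballI impI)
  fix x y z :: 'a assume "x \<in> {0..}" "y \<in> {0..}" "z \<in> {0..}"
  then have *: "0 \<le> x" "0 \<le> y" "0 \<le> z" by auto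
  { show "trunc E d x x" unfolding trunc_def using refl0 * by blast }
  { assume "trunc E d x y" then show "trunc E d y x" unfolding trunc_def using sym0[OF *(1,2)] by blast }
  { assume "trunc E d x y" "trunc E d y z"
    then show "trunc E d x z" unfolding trunc_def
      using trans0[OF *] cut_cong[OF d *(2,1)] cut_cong[OF d *(2,3)] sym0[OF *(1,2)] by blast }
  { assume "x \<le> y" "y \<le> z" "trunc E d x z"
    then show "trunc E d x y" unfolding trunc_def
      using conv0[OF *(1)] cut_up[OF d *(1)] by blast }
qed

lemma chain_trunc:
  "chain E n x \<Longrightarrow> 0 \<le> x \<Longrightarrow> x \<le> d \<Longrightarrow> chain (trunc E d) n x"
proof (induction n arbitrary: x)
  case (Suc n)
  then obtain y where y: "0 \<le> y" "y < x" "\<not> E y x" "chain E n y" by auto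
  have "\<not> E d y"
  proof
    assume "E d y"
    then have "E y d" using sym0[of d y] y Suc.prems by auto
    then show False using conv0[of y x d] y Suc.prems by auto
  qed
  then have "\<not> trunc E d y x" unfolding trunc_def using y Suc.prems by auto
  moreover have "chain (trunc E d) n y" using Suc.IH[OF y(4,1)] y(2) Suc.prems(3) by simp
  ultimately show ?case using y by auto
qed simp

lemma discrete_if_finite:
  assumes "idx E {0..} n" shows "discrete E"
  unfolding discrete_def
proof (intro allI impI)
  fix x y assume xy: "0 \<le> x \<and> x < y \<and> \<not> E x y"
  define A where "A = {z. x < z \<and> z \<le> y \<and> \<not> E x z}"
  have "A \<subseteq> {0..}" "A \<noteq> {}" using xy unfolding A_def by auto
  then obtain z where z: "z \<in> A" "\<And>b. b \<in> A \<Longrightarrow> b \<le> z \<Longrightarrow> E b z" using ex_bot[OF assms] by blast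
  have "E x w \<or> E w z" if w: "x \<le> w" "w \<le> z" for w
  proof (cases "E x w")
    case False
    then have "x < w" using refl0[of x] xy w(1) by (cases "x = w") auto
    then have "w \<in> A" using False w(2) z(1) unfolding A_def by auto
    then show ?thesis using z(2) w(2) by blast
  qed simp
  then show "\<exists>z. x < z \<and> z \<le> y \<and> \<not> E x z \<and> (\<forall>w. x \<le> w \<and> w \<le> z \<longrightarrow> E x w \<or> E w z)"
    using z(1) unfolding A_def by blast
qed

text \<open>The truncation point climbs one class at a time to the immediate successor. A successor
  always exists, since otherwise the truncation would be the whole chain, which has chains of every
  length.\<close>

lemma ex_trunc:
  assumes "discrete E" "0 \<le> X" "\<And>n. chain E n X"
  shows "\<exists>d m. 0 \<le> d \<and> chain E n d \<and> idx (trunc E d) {0..} m"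
proof (induction n)
  case 0
  have "idx (trunc E 0) {0..} 1" unfolding idx_def trunc_def by auto
  then show ?case by (intro exI[of _ 0] exI[of _ 1]) simp
next
  case (Suc n)
  then obtain d m where d: "0 \<le> d" "chain E n d" "idx (trunc E d) {0..} m" by blast
  have "\<exists>y>d. \<not> E d y"
  proof (rule ccontr)
    assume "\<not> (\<exists>y>d. \<not> E d y)"
    then have *: "E d x" if "d \<le> x \<or> E d x" for x using that refl0[OF d(1)] by (metis order_le_less)
    have "idx E {0..} m"
    proof (rule idx_mono[OF d(3) order_refl _ order_refl])
      fix x y assume xy: "x \<in> {0..}" "y \<in> {0..}" "trunc E d x y"
      then show "E x y" using * trans0[of x d y] sym0[of d x] d(1) unfolding trunc_def by auto
    qed
    then show False using chain_le_idx[OF ce _ assms(3,2), of m m] by blast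
  qed
  then obtain y where y: "d < y" "\<not> E d y" by blast
  then obtain z where z: "d < z" "\<not> E d z" "\<And>w. d \<le> w \<Longrightarrow> w \<le> z \<Longrightarrow> E d w \<or> E w z"
    using assms(1) d(1) unfolding discrete_def by blast
  have z0: "0 \<le> z" using d(1) z(1) by simp
  obtain f :: "'a \<Rightarrow> nat" where f: "\<forall>x\<in>{0..}. f x < m" "\<forall>x\<in>{0..}. \<forall>y\<in>{0..}. f x = f y \<longrightarrow> trunc E d x y"
    using d(3) unfolding idx_def by (elim exE conjE)
  \<comment> \<open>The new label \<open>m\<close> is for the merged classes from \<open>z\<close>
    on. Below \<open>z\<close> the old labels suffice, because by the choice of \<open>z\<close>
    everything there from \<open>d\<close> on is in the class of \<open>d\<close>.\<close>
  define g where "g x = (if z \<le> x \<or> E z x then m else f x)" for x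
  have dE: "E d x" if "0 \<le> x" "\<not> (z \<le> x \<or> E z x)" "d \<le> x \<or> E d x" for x
  proof (rule ccontr)
    assume "\<not> E d x"
    then have "E x z" using that z(3)[of x] by auto
    then show False using sym0[OF that(1) z0] that(2) by blast
  qed
  have "idx (trunc E z) {0..} (Suc m)" unfolding idx_def
  proof (intro exI[of _ g] conjI ballI impI)
    fix x :: 'a assume "x \<in> {0..}"
    then show "g x < Suc m" using f(1) unfolding g_def by (simp add: less_SucI)
  next
    fix x y :: 'a assume xy: "x \<in> {0..}" "y \<in> {0..}" "g x = g y"
    have lt: "f x < m" "f y < m" using f(1) xy by blast+
    show "trunc E z x y"
    proof (cases "z \<le> x \<or> E z x")
      case True
      then have "z \<le> y \<or> E z y" using xy(3) lt unfolding g_def by (simp split: if_splits)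
      with True show ?thesis unfolding trunc_def by blast
    next
      case False
      then have nz: "\<not> (z \<le> y \<or> E z y)" and "f x = f y"
        using xy(3) lt unfolding g_def by (simp_all split: if_splits)
      then have "trunc E d x y" using f(2) xy(1,2) by blast
      then have "E x y" unfolding trunc_def
        using dE[OF _ False] dE[OF _ nz] sym0[of d x] trans0[of x d y] xy(1,2) d(1) by auto
      then show ?thesis unfolding trunc_def by blast
    qed
  qed
  moreover have "chain E (Suc n) z" using d z(1,2) by auto
  ultimately show ?case using z0 by blast
qed

text \<open>The largest subring under which all the subgroups are modules.\<close>

definition "stab_ring = {a. \<forall>c z. 0 \<le> c \<and> below E c z \<longrightarrow> below E c (\<bar>a\<bar> * z)}"

lemma stab_ring: "convex_ring stab_ring"
  unfolding convex_ring_def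
proof (intro conjI ballI allI impI)
  show "1 \<in> stab_ring" unfolding stab_ring_def by simp
  fix a assume a: "a \<in> stab_ring"
  { fix b assume ab: "\<bar>b\<bar> \<le> \<bar>a\<bar>"
    have "below E c (\<bar>b\<bar> * z)" if "0 \<le> c" "below E c z" for c z
    proof -
      have *: "below E c (\<bar>a\<bar> * z)" using a that unfolding stab_ring_def by blast
      have z: "0 \<le> z" using that(2) unfolding below_def by blast
      show ?thesis by (rule below_down[OF *]) (use z mult_right_mono[OF ab z] in auto)
    qed
    then show "b \<in> stab_ring" unfolding stab_ring_def by blast }
  fix b assume b: "b \<in> stab_ring"
  show "a * b \<in> stab_ring" unfolding stab_ring_def
  proof (intro CollectI allI impI)
    fix c z assume cz: "0 \<le> c \<and> below E c z"
    then have "below E c (\<bar>b\<bar> * z)" using b unfolding stab_ring_def by blast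
    then have "below E c (\<bar>a\<bar> * (\<bar>b\<bar> * z))" using a cz unfolding stab_ring_def by blast
    then show "below E c (\<bar>a * b\<bar> * z)" by (simp add: abs_mult mult.assoc)
  qed
  show "a + b \<in> stab_ring" unfolding stab_ring_def
  proof (intro CollectI allI impI)
    fix c z assume cz: "0 \<le> c \<and> below E c z"
    then have z: "0 \<le> z" unfolding below_def by blast
    have "below E c (\<bar>a\<bar> * z)" "below E c (\<bar>b\<bar> * z)" using a b cz unfolding stab_ring_def by blast+
    then have "below E c (\<bar>a\<bar> * z + \<bar>b\<bar> * z)" by (rule below_add)
    moreover have "\<bar>a + b\<bar> * z \<le> \<bar>a\<bar> * z + \<bar>b\<bar> * z"
      using mult_right_mono[OF abs_triangle_ineq z] by (simp add: distrib_right)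
    ultimately show "below E c (\<bar>a + b\<bar> * z)" using below_down z by simp
  qed
qed

text \<open>If \<open>x\<close> and \<open>x * u\<close> were separated, \<open>x\<close> would be
  in the subgroup below \<open>x * u\<close>. This subgroup is closed under multiplication by
  \<open>u\<close>, so \<open>x * u\<close> would be below itself.\<close>

lemma trunc_unit_good:
  assumes d: "0 \<le> d" shows "unit_good stab_ring (trunc E d)"
  unfolding unit_good_def
proof (intro conjI allI impI)
  show "cequiv {0<..} (trunc E d)" by (rule cequiv_subset[OF trunc_cequiv[OF d]]) auto
  fix x u :: 'a assume *: "0 < x" "1 \<le> u" "u \<in> stab_ring"
  have xu: "x \<le> x * u" using * by simp
  have "E x (x * u)"
  proof (rule ccontr)
    assume nE: "\<not> E x (x * u)"
    then have "x \<noteq> x * u" using refl0[of x] *(1) by auto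
    then have "x < x * u" by (rule le_neq_trans[OF xu])
    then have "below E (x * u) x" unfolding below_def using * nE by simp
    moreover have "0 \<le> x * u" using * by simp
    ultimately have "below E (x * u) (\<bar>u\<bar> * x)" using *(3) unfolding stab_ring_def by blast
    then show False using *(2) unfolding below_def by (simp add: mult.commute)
  qed
  then show "trunc E d x (x * u)" unfolding trunc_def by blast
qed

end

section \<open>Bounds from the value groups alone\<close>

context wom
begin

lemma add_bounded_if_val_bounded:
  assumes V: "\<And>O' es. convex_ring O' \<Longrightarrow> dfn K es (\<lambda>\<rho>. \<rho> 0 \<in> O') \<Longrightarrow> unif_bounded K {1..} (val_good O')"
  shows "unif_bounded K {0..} add_good"
proof (rule ccontr)
  assume "\<not> unif_bounded K {0..} add_good"
  then obtain es and E :: "(nat \<Rightarrow> 'a) \<Rightarrow> 'a \<Rightarrow> 'a \<Rightarrow> bool" where E: "dfn2 K es E"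
    and nb: "\<not> (\<exists>N. \<forall>\<tau> n. add_good (E \<tau>) \<longrightarrow> idx (E \<tau>) {0..} n \<longrightarrow> idx (E \<tau>) {0..} N)"
    unfolding unif_bounded_def by blast
  obtain N0 where N0: "\<And>\<rho> \<rho>'. (\<And>i. i < N0 \<Longrightarrow> \<rho> i = \<rho>' i) \<Longrightarrow>
      E (\<lambda>i. \<rho> (Suc (Suc i))) (\<rho> 0) (\<rho> (Suc 0)) = E (\<lambda>i. \<rho>' (Suc (Suc i))) (\<rho>' 0) (\<rho>' (Suc 0))"
    using dfn_support[OF E] by metis
  \<comment> \<open>Discreteness is part of the conditions; otherwise the chain obtained in the
    limit might have no long finite initial segments.\<close>
  define P where "P n \<rho> \<longleftrightarrow> add_good (E (\<lambda>i. \<rho> (Suc i))) \<and> discrete (E (\<lambda>i. \<rho> (Suc i))) \<and>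
      0 \<le> \<rho> 0 \<and> chain (E (\<lambda>i. \<rho> (Suc i))) n (\<rho> 0)" for n \<rho>
  have "\<exists>\<rho>. \<forall>n. P n \<rho>"
  proof (rule saturation[OF satd])
    show "dfn K es (P n)" for n
      unfolding P_def add_good_def cequiv_def discrete_def Ball_def atLeast_iff
      by (intro dfn_intros dfn_app2[where E = E, OF E] dfn_chain[OF E])
    show "P n \<rho> = P n \<rho>'" if eq: "\<And>i. i < Suc N0 \<Longrightarrow> \<rho> i = \<rho>' i" for n \<rho> \<rho>'
    proof -
      have "E (\<lambda>i. \<rho> (Suc i)) x y = E (\<lambda>i. \<rho>' (Suc i)) x y" for x y
        using N0[of "case_nat x (case_nat y (\<lambda>i. \<rho> (Suc i)))" "case_nat x (case_nat y (\<lambda>i. \<rho>' (Suc i)))"] eq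
        by (simp split: nat.splits)
      then have "E (\<lambda>i. \<rho> (Suc i)) = E (\<lambda>i. \<rho>' (Suc i))" by (intro ext)
      with eq[of 0] show ?thesis unfolding P_def by simp
    qed
    show "P n \<rho>" if "P (Suc n) \<rho>" for n \<rho>
      using that chain_Suc_imp[of "E (\<lambda>i. \<rho> (Suc i))" n "\<rho> 0"] unfolding P_def by blast
    show "\<exists>\<rho>. P n \<rho>" for n
    proof -
      \<comment> \<open>No common bound exists, so \<open>2 ^ n\<close> is not one either; by
        \<open>idx_chain\<close> the member found here has a chain of length
        \<open>n\<close>.\<close>
      obtain \<tau> k where \<tau>: "add_good (E \<tau>)" "idx (E \<tau>) {0..} k" "\<not> idx (E \<tau>) {0..} (card (Pow {..<n}))"
        using nb by blast
      interpret add_equiv "E \<tau>" by unfold_locales (rule \<tau>(1))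
      obtain x where "0 \<le> x" "chain (E \<tau>) n x" using idx_chain[OF ce, of n] \<tau>(3) by blast
      then have "P n (case_nat x \<tau>)" unfolding P_def using \<tau>(1) discrete_if_finite[OF \<tau>(2)] by simp
      then show ?thesis by blast
    qed
  qed
  then obtain \<rho> where \<rho>: "\<And>n. P n \<rho>" by blast
  define \<tau> X where "\<tau> = (\<lambda>i. \<rho> (Suc i))" and "X = \<rho> 0"
  have \<tau>: "add_good (E \<tau>)" "discrete (E \<tau>)" "0 \<le> X" "\<And>n. chain (E \<tau>) n X"
    using \<rho> unfolding P_def \<tau>_def X_def by blast+
  interpret add_equiv "E \<tau>" by unfold_locales (rule \<tau>(1))
  \<comment> \<open>The chain is now fixed: \<open>\<tau>\<close> becomes part of the parameters,
    over which its ring of scalars is definable.\<close>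
  obtain es' where es': "set es \<subseteq> set es'"
    "dfn K es' (\<lambda>\<rho>. E (\<lambda>i. if Suc (Suc i) < 2 then \<rho> (Suc (Suc i)) else \<tau> (Suc (Suc i) - 2))
      (if 0 < (2::nat) then \<rho> 0 else \<tau> (0 - 2)) (if Suc 0 < 2 then \<rho> (Suc 0) else \<tau> (Suc 0 - 2)))"
    by (rule dfn_fix[OF E, of 2 \<tau>])
  then have E\<tau>: "dfn K es' (\<lambda>\<rho>. E \<tau> (\<rho> 0) (\<rho> (Suc 0)))" by simp
  have "dfn K es' (\<lambda>\<rho>. \<rho> 0 \<in> stab_ring)" unfolding stab_ring_def mem_Collect_eq below_def
    by (intro dfn_intros dfn_binop[OF E\<tau>])
  then have ub: "unif_bounded K {0<..} (unit_good stab_ring)" using V[OF stab_ring] unit_bounded by blast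
  \<comment> \<open>The truncation point is the parameter of this family, so the bound
    \<open>N\<close> obtained from it serves all truncations at once.\<close>
  have T: "dfn2 K es' (\<lambda>\<sigma>. trunc (E \<tau>) (\<sigma> 0))" unfolding trunc_def
    by (intro dfn_intros dfn_binop[OF E\<tau>])
  obtain N where N: "\<And>(\<sigma> :: nat \<Rightarrow> 'a) n. unit_good stab_ring (trunc (E \<tau>) (\<sigma> 0)) \<Longrightarrow>
      idx (trunc (E \<tau>) (\<sigma> 0)) {0<..} n \<Longrightarrow> idx (trunc (E \<tau>) (\<sigma> 0)) {0<..} N"
    using ub[unfolded unif_bounded_def, rule_format, OF T] by blast
  obtain d m where d: "0 \<le> d" "chain (E \<tau>) (Suc N) d" "idx (trunc (E \<tau>) d) {0..} m"
    using ex_trunc[OF \<tau>(2-4)] by blast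
  have "idx (trunc (E \<tau>) d) {0<..} m" by (rule idx_mono[OF d(3) order_refl]) auto
  then have "idx (trunc (E \<tau>) d) {0<..} N" using N[of "\<lambda>_. d"] trunc_unit_good[OF d(1)] by blast
  then obtain f :: "'a \<Rightarrow> nat" where f: "\<forall>x\<in>{0<..}. f x < N"
    "\<forall>x\<in>{0<..}. \<forall>y\<in>{0<..}. f x = f y \<longrightarrow> trunc (E \<tau>) d x y" unfolding idx_def by (elim exE conjE)
  \<comment> \<open>The element 0 is outside the multiplicative group and gets the additional label
    \<open>N\<close>. A chain of length \<open>Suc N\<close> has one class too many for these
    \<open>Suc N\<close> labels.\<close>
  have "idx (trunc (E \<tau>) d) {0..} (Suc N)" unfolding idx_def
  proof (intro exI[of _ "\<lambda>x. if x = 0 then N else f x"] conjI ballI impI)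
    fix x :: 'a assume "x \<in> {0..}"
    then show "(if x = 0 then N else f x) < Suc N" using f(1) by (simp add: less_SucI)
  next
    fix x y :: 'a assume xy: "x \<in> {0..}" "y \<in> {0..}" "(if x = 0 then N else f x) = (if y = 0 then N else f y)"
    show "trunc (E \<tau>) d x y"
    proof (cases "x = 0 \<or> y = 0")
      case True
      have "f z < N" if "z \<in> {0..}" "z \<noteq> 0" for z using f(1) that by auto
      then have "x = y" using True xy by (metis less_irrefl)
      then show ?thesis using refl0[of x] xy(1) unfolding trunc_def by auto
    next
      case False
      then have "f x = f y" "x \<in> {0<..}" "y \<in> {0<..}" using xy by auto
      then show ?thesis using f(2) by blast
    qed
  qed
  then show False
    using chain_le_idx[OF trunc_cequiv[OF d(1)] _ chain_trunc[OF d(2,1) order_refl] d(1), of "Suc N"] by simp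
qed

end

section \<open>Convex subgroups compared with the modules over a valuation ring\<close>

definition isunit :: "'a::linordered_field set \<Rightarrow> 'a \<Rightarrow> bool" where
  "isunit O' u \<longleftrightarrow> 0 < u \<and> u \<in> O' \<and> inverse u \<in> O'"

text \<open>
  For \<open>H = {z. below E c z}\<close>, the positive \<open>g\<close> with \<open>reaches\<close> form the smallest module over the
  valuation ring \<open>O'\<close> containing \<open>H\<close>, and those with \<open>inside\<close> the largest one contained in \<open>H\<close>.
  They differ at most by the elements of a single value.
\<close>

definition reaches :: "('a::linordered_field \<Rightarrow> 'a \<Rightarrow> bool) \<Rightarrow> 'a set \<Rightarrow> 'a \<Rightarrow> 'a \<Rightarrow> bool" where
  "reaches E O' c g \<longleftrightarrow> (\<exists>u. isunit O' u \<and> below E c (g * u))"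

definition inside :: "('a::linordered_field \<Rightarrow> 'a \<Rightarrow> bool) \<Rightarrow> 'a set \<Rightarrow> 'a \<Rightarrow> 'a \<Rightarrow> bool" where
  "inside E O' c g \<longleftrightarrow> (\<forall>u. isunit O' u \<longrightarrow> below E c (g * u))"

text \<open>Compares the positions of elements relative to the two modules attached to each subgroup
  of the chain. Units do not change these positions, so the classes define cuts of the value
  group.\<close>

definition module_equiv :: "('a::linordered_field \<Rightarrow> 'a \<Rightarrow> bool) \<Rightarrow> 'a set \<Rightarrow> 'a \<Rightarrow> 'a \<Rightarrow> bool" where
  "module_equiv E O' g g' \<longleftrightarrow> (\<forall>c. 0 \<le> c \<longrightarrow> (reaches E O' c g \<longleftrightarrow> reaches E O' c g') \<and>
     (inside E O' c g \<longleftrightarrow> inside E O' c g'))"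

text \<open>Only the subgroups split at the value of \<open>h\<close> are taken into account.
  Division by \<open>h\<close> places them between the maximal ideal and the ring, so they become
  subgroups of the residue field.\<close>

definition residue_equiv :: "('a::linordered_field \<Rightarrow> 'a \<Rightarrow> bool) \<Rightarrow> 'a set \<Rightarrow> 'a \<Rightarrow> 'a \<Rightarrow> 'a \<Rightarrow> bool" where
  "residue_equiv E O' h x y \<longleftrightarrow> (\<forall>c. 0 \<le> c \<and> reaches E O' c h \<and> \<not> inside E O' c h \<longrightarrow>
     (below E c (x * h) \<longleftrightarrow> below E c (y * h)))"

locale add_equiv_ring = add_equiv E for E :: "'a::linordered_field \<Rightarrow> 'a \<Rightarrow> bool" +
  fixes O' :: "'a set" assumes ring: "convex_ring O'"
begin

lemma unit_1: "isunit O' 1"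
  using convex_ringD(1)[OF ring] unfolding isunit_def by simp

lemma unit_mult: "isunit O' u \<Longrightarrow> isunit O' v \<Longrightarrow> isunit O' (u * v)"
  using convex_ringD(3)[OF ring] unfolding isunit_def by simp

lemma unit_inverse: "isunit O' u \<Longrightarrow> isunit O' (inverse u)"
  unfolding isunit_def by simp

lemma reaches_down:
  assumes "0 < g" "g \<le> g'" "reaches E O' c g'" shows "reaches E O' c g"
proof -
  obtain u where u: "isunit O' u" "below E c (g' * u)" using assms(3) unfolding reaches_def by blast
  then have "0 < u" unfolding isunit_def by blast
  then have "0 \<le> g * u" "g * u \<le> g' * u" using assms(1,2) by (simp_all add: mult_right_mono)
  then have "below E c (g * u)" by (rule below_down[OF u(2)])
  then show ?thesis unfolding reaches_def using u(1) by blast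
qed

lemma inside_down:
  assumes "0 < g" "g \<le> g'" "inside E O' c g'" shows "inside E O' c g"
  unfolding inside_def
proof (intro allI impI)
  fix u assume u: "isunit O' u"
  then have b: "below E c (g' * u)" using assms(3) unfolding inside_def by blast
  have "0 < u" using u unfolding isunit_def by blast
  then have "0 \<le> g * u" "g * u \<le> g' * u" using assms(1,2) by (simp_all add: mult_right_mono)
  then show "below E c (g * u)" by (rule below_down[OF b])
qed

lemma reaches_unit: "isunit O' u \<Longrightarrow> reaches E O' c g \<Longrightarrow> reaches E O' c (g * u)"
proof -
  assume u: "isunit O' u" and "reaches E O' c g"
  then obtain v where v: "isunit O' v" "below E c (g * v)" unfolding reaches_def by blast
  have "g * u * (inverse u * v) = g * v" using u unfolding isunit_def by simp
  then show ?thesis unfolding reaches_def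
    using v unit_mult[OF unit_inverse[OF u] v(1)] by metis
qed

lemma inside_unit: "isunit O' u \<Longrightarrow> inside E O' c g \<Longrightarrow> inside E O' c (g * u)"
  unfolding inside_def using unit_mult by (simp add: mult.assoc)

lemma inside_below: "inside E O' c g \<Longrightarrow> below E c g"
  unfolding inside_def using unit_1 by (metis mult_1_right)

lemma below_reaches: "below E c g \<Longrightarrow> reaches E O' c g"
  unfolding reaches_def using unit_1 by (metis mult_1_right)

lemma reaches_cong: "0 \<le> c \<Longrightarrow> 0 \<le> c' \<Longrightarrow> E c c' \<Longrightarrow> reaches E O' c g \<Longrightarrow> reaches E O' c' g"
  unfolding reaches_def using below_cong by blast

lemma inside_cong: "0 \<le> c \<Longrightarrow> 0 \<le> c' \<Longrightarrow> E c c' \<Longrightarrow> inside E O' c g \<Longrightarrow> inside E O' c' g"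
  unfolding inside_def using below_cong by blast

lemma module_equiv_good: "unit_good O' (module_equiv E O')"
  unfolding unit_good_def
proof (intro conjI allI impI)
  show "cequiv {0<..} (module_equiv E O')" unfolding cequiv_def
  proof (intro conjI ballI impI)
    fix x y z :: 'a assume "x \<in> {0<..}" "y \<in> {0<..}" "z \<in> {0<..}"
    then have *: "0 < x" "0 < y" by auto
    { assume **: "x \<le> y" "y \<le> z" "module_equiv E O' x z"
      show "module_equiv E O' x y" unfolding module_equiv_def
      proof (intro allI impI conjI iffI)
        fix c :: 'a assume c: "0 \<le> c"
        { assume "reaches E O' c x" then have "reaches E O' c z" using **(3) c unfolding module_equiv_def by blast
          then show "reaches E O' c y" by (rule reaches_down[OF *(2) **(2)]) }
        { show "reaches E O' c y \<Longrightarrow> reaches E O' c x" by (rule reaches_down[OF *(1) **(1)]) }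
        { assume "inside E O' c x" then have "inside E O' c z" using **(3) c unfolding module_equiv_def by blast
          then show "inside E O' c y" by (rule inside_down[OF *(2) **(2)]) }
        { show "inside E O' c y \<Longrightarrow> inside E O' c x" by (rule inside_down[OF *(1) **(1)]) }
      qed }
  qed (simp_all add: module_equiv_def)
  fix x u :: 'a assume *: "0 < x" "1 \<le> u" "u \<in> O'"
  have "\<bar>inverse u\<bar> \<le> \<bar>1\<bar>" using *(2) by (simp add: inverse_le_1_iff)
  then have "inverse u \<in> O'" by (rule convex_ringD(4)[OF ring convex_ringD(1)[OF ring]])
  then have u: "isunit O' u" unfolding isunit_def using * by simp
  have eq: "x * u * inverse u = x" using *(2) by simp
  show "module_equiv E O' x (x * u)" unfolding module_equiv_def
    using reaches_unit[OF u] inside_unit[OF u] reaches_unit[OF unit_inverse[OF u], of _ "x * u"]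
      inside_unit[OF unit_inverse[OF u], of _ "x * u"] unfolding eq by blast
qed

lemma idx_module_equiv:
  assumes "idx E {0..} n" shows "\<exists>m. idx (module_equiv E O') {0<..} m"
proof -
  have 1: "idx (\<lambda>g g'. {c. 0 \<le> c \<and> reaches E O' c g} = {c. 0 \<le> c \<and> reaches E O' c g'}) {0<..} (card (Pow {..<n}))"
    by (rule idx_image[OF assms]) (auto intro: reaches_cong)
  have 2: "idx (\<lambda>g g'. {c. 0 \<le> c \<and> inside E O' c g} = {c. 0 \<le> c \<and> inside E O' c g'}) {0<..} (card (Pow {..<n}))"
    by (rule idx_image[OF assms]) (auto intro: inside_cong)
  have "idx (module_equiv E O') {0<..} (card ({..<card (Pow {..<n})} \<times> {..<card (Pow {..<n})}))"
    by (rule idx_mono[OF idx_conj[OF 1 2] order_refl _ order_refl])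
      (unfold module_equiv_def set_eq_iff mem_Collect_eq, blast)
  then show ?thesis by blast
qed

lemma residue_equiv_good:
  assumes h: "0 < h" shows "res_good O' (residue_equiv E O' h)"
proof -
  have down: "below E c (x * h)" if "below E c (y * h)" "0 \<le> x" "x \<le> y" for c x y
    by (rule below_down[OF that(1)]) (use that h in \<open>auto intro: mult_right_mono\<close>)
  have "cequiv {0..} (residue_equiv E O' h)" unfolding cequiv_def
  proof (intro conjI ballI impI)
    fix x y z :: 'a assume "x \<in> {0..}" "y \<in> {0..}" "z \<in> {0..}"
    then have *: "0 \<le> x" "0 \<le> y" by auto
    { assume **: "x \<le> y" "y \<le> z" "residue_equiv E O' h x z"
      show "residue_equiv E O' h x y" unfolding residue_equiv_def
      proof (intro allI impI iffI)
        fix c :: 'a assume c: "0 \<le> c \<and> reaches E O' c h \<and> \<not> inside E O' c h"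
        { assume "below E c (x * h)" then have "below E c (z * h)" using **(3) c unfolding residue_equiv_def by blast
          then show "below E c (y * h)" by (rule down[OF _ *(2) **(2)]) }
        { show "below E c (y * h) \<Longrightarrow> below E c (x * h)" by (rule down[OF _ *(1) **(1)]) }
      qed }
  qed (simp_all add: residue_equiv_def)
  moreover have "residue_equiv E O' h x (x + x)" if x: "0 \<le> x" for x
    unfolding residue_equiv_def
  proof (intro allI impI iffI)
    fix c :: 'a
    { assume "below E c (x * h)" then show "below E c ((x + x) * h)"
        unfolding distrib_right using below_add[of c "x * h" "x * h"] by blast }
    { assume "below E c ((x + x) * h)" then show "below E c (x * h)"
        by (rule down[OF _ x]) (use x in simp) }
  qed
  moreover have "residue_equiv E O' h 0 x" if x: "0 \<le> x" "x = 0 \<or> inverse x \<notin> O'" for x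
    unfolding residue_equiv_def
  proof (intro allI impI iffI)
    fix c :: 'a assume c: "0 \<le> c \<and> reaches E O' c h \<and> \<not> inside E O' c h"
    { show "below E c (x * h) \<Longrightarrow> below E c (0 * h)" by (rule down[OF _ order_refl x(1)]) }
    \<comment> \<open>By \<open>reaches\<close> the subgroup contains \<open>h * u\<close> for some
      unit \<open>u\<close>, and a nonnegative element of the maximal ideal is at most
      \<open>u\<close>.\<close>
    { obtain u where u: "isunit O' u" "below E c (h * u)" using c unfolding reaches_def by blast
      have "x \<le> u"
      proof (rule ccontr)
        assume n: "\<not> x \<le> u"
        have u0: "0 < u" "inverse u \<in> O'" using u unfolding isunit_def by blast+
        then have "inverse x \<le> inverse u" "0 < x" using n by (auto intro: le_imp_inverse_le)
        then have "inverse x \<in> O'" using u0 by (intro convex_ringD(4)[OF ring u0(2)]) auto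
        then show False using x(2) \<open>0 < x\<close> by simp
      qed
      then show "below E c (x * h)" using down[of c u x] u(2) x(1) by (simp add: mult.commute) }
  qed
  moreover have "residue_equiv E O' h x y" if xy: "0 \<le> x" "0 \<le> y" "x \<notin> O'" "y \<notin> O'" for x y
  proof -
    \<comment> \<open>Dually, some \<open>h * u\<close> with a unit \<open>u\<close> is missing from
      the subgroup, and a nonnegative element outside the ring is at least \<open>u\<close>.\<close>
    have "\<not> below E c (x * h)" if x: "0 \<le> x" "x \<notin> O'" and c: "\<not> inside E O' c h" for c x
    proof
      assume b: "below E c (x * h)"
      obtain u where u: "isunit O' u" "\<not> below E c (h * u)" using c unfolding inside_def by blast
      have "u \<le> x"
      proof (rule ccontr)
        assume "\<not> u \<le> x"
        moreover have "u \<in> O'" "0 < u" using u(1) unfolding isunit_def by blast+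
        ultimately have "x \<in> O'" using x(1) by (auto intro: convex_ringD(4)[OF ring \<open>u \<in> O'\<close>])
        then show False using x(2) by blast
      qed
      then have "below E c (u * h)" using u(1) unfolding isunit_def by (intro down[OF b]) auto
      then show False using u(2) by (simp add: mult.commute)
    qed
    then show ?thesis using xy unfolding residue_equiv_def by blast
  qed
  ultimately show ?thesis unfolding res_good_def add_good_def by blast
qed

lemma idx_residue_equiv:
  assumes "idx E {0..} n" shows "\<exists>m. idx (residue_equiv E O' h) {0..} m"
proof -
  have "idx (\<lambda>x y. {c. 0 \<le> c \<and> reaches E O' c h \<and> \<not> inside E O' c h \<and> below E c (x * h)} =
      {c. 0 \<le> c \<and> reaches E O' c h \<and> \<not> inside E O' c h \<and> below E c (y * h)}) {0..} (card (Pow {..<n}))"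
    (is "idx (\<lambda>x y. ?S x = ?S y) _ _")
  proof (rule idx_image[OF assms])
    fix g c c' assume "c \<in> ?S g" "c' \<in> {0..}" and E: "E c c'"
    then have *: "0 \<le> c" "0 \<le> c'" "reaches E O' c h" "\<not> inside E O' c h" "below E c (g * h)" by auto
    have "\<not> inside E O' c' h" using inside_cong[OF *(2,1) sym0[OF *(1,2) E]] *(4) by blast
    then show "c' \<in> ?S g" using * reaches_cong[OF *(1,2) E *(3)] below_cong[OF *(1,2) E *(5)] by blast
  qed auto
  then have "idx (residue_equiv E O' h) {0..} (card (Pow {..<n}))"
    by (rule idx_mono[OF _ order_refl _ order_refl])
      (unfold residue_equiv_def set_eq_iff mem_Collect_eq, blast)
  then show ?thesis by blast
qed

text \<open>A subgroup of the chain either is split at no positive element, and then the labels of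
  the module relation determine it, or it is split at some value, whose label is its key. In the
  second case the residue relation for one \<open>h\<close> of this label determines it. The sum of
  the two powers covers both cases.\<close>

lemma idx_from_modules:
  assumes M: "idx (module_equiv E O') {0<..} N1"
    and R: "\<And>h. 0 < h \<Longrightarrow> idx (residue_equiv E O' h) {0..} N2"
  shows "idx E {0..} (card (insert None (Some ` {..<N1})) * (card (Pow {..<Suc N1}) + card (Pow {..<N2})))"
proof -
  obtain f :: "'a \<Rightarrow> nat" where f: "\<forall>x\<in>{0<..}. f x < N1"
    "\<forall>x\<in>{0<..}. \<forall>y\<in>{0<..}. f x = f y \<longrightarrow> module_equiv E O' x y"
    using M unfolding idx_def by (elim exE conjE)
  define split where "split c g \<longleftrightarrow> 0 < g \<and> reaches E O' c g \<and> \<not> inside E O' c g" for c g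
  define key where "key c = (if \<exists>g. split c g then Some (f (SOME g. split c g)) else None)" for c
  have keyS: "\<exists>g. split c g \<and> f g = k" if "key c = Some k" for c k
  proof -
    have ex: "\<exists>g. split c g" using that unfolding key_def by (auto split: if_splits)
    then have "split c (SOME g. split c g)" by (rule someI_ex)
    moreover have "f (SOME g. split c g) = k" using that ex unfolding key_def by simp
    ultimately show ?thesis by blast
  qed
  show ?thesis
  proof (rule idx_fibers[where key = key, OF _ order_refl])
    show "key ` {0..} \<subseteq> insert None (Some ` {..<N1})"
    proof (rule image_subsetI)
      fix c :: 'a
      show "key c \<in> insert None (Some ` {..<N1})"
      proof (cases "key c")
        case (Some k)
        then obtain g where "split c g" "f g = k" using keyS by blast
        then have "k < N1" using f(1) unfolding split_def by auto
        then show ?thesis using Some by simp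
      qed simp
    qed
    fix b assume b: "b \<in> key ` {0..}"
    show "\<exists>F. idx F {0..} (card (Pow {..<Suc N1}) + card (Pow {..<N2})) \<and>
      (\<forall>x\<in>{0..}. \<forall>y\<in>{0..}. key x = b \<longrightarrow> key y = b \<longrightarrow> F x y \<longrightarrow> E x y)"
    proof (cases b)
      case None
      \<comment> \<open>The module relation is labelled on positive elements only, so the spare
        label \<open>N1\<close> records whether 0 is below \<open>c\<close>; it is missing exactly
        when \<open>c\<close> is in the class of 0.\<close>
      define S where "S c = f ` {g. 0 < g \<and> below E c g} \<union> (if below E c 0 then {N1} else {})" for c
      have "idx (\<lambda>x y. S x = S y) {0..} (card (Pow {..<Suc N1}) + card (Pow {..<N2}))"
      proof (rule idxI[where f = S])
        show "S ` {0..} \<subseteq> Pow {..<Suc N1}" unfolding S_def using f(1) by (auto simp: less_SucI split: if_splits)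
      qed auto
      moreover have "E x y" if xy: "0 \<le> x" "0 \<le> y" "key x = None" "key y = None" "S x = S y" for x y
      proof (rule below_det[OF xy(1,2)])
        have half: "below E b z" if "0 \<le> a" "0 \<le> b" "key a = None" "key b = None" "S a = S b" "0 \<le> z" "below E a z" for a b z
        proof (cases "z = 0")
          case True
          then have "N1 \<in> S a" using that(7) unfolding S_def by simp
          then have "N1 \<in> S b" using that(5) by simp
          then show ?thesis using f(1) True unfolding S_def by (auto split: if_splits)
        next
          case False
          then have z: "0 < z" using that(6) by simp
          then have "f z \<in> S a" using that(7) unfolding S_def by blast
          moreover have "f z \<noteq> N1" using f(1) z by auto
          ultimately have "f z \<in> f ` {g. 0 < g \<and> below E b g}" using that(5) unfolding S_def by (auto split: if_splits)
          then obtain g where g: "0 < g" "below E b g" "f g = f z" by auto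
          have "\<not> split b g" using that(4) unfolding key_def by (auto split: if_splits)
          then have "inside E O' b g" using below_reaches[OF g(2)] g(1) unfolding split_def by blast
          moreover have "module_equiv E O' g z" using f(2) g z by auto
          ultimately have "inside E O' b z" using that(2) unfolding module_equiv_def by blast
          then show ?thesis by (rule inside_below)
        qed
        show "below E x z \<longleftrightarrow> below E y z" if "0 \<le> z" for z
          using half[OF xy that] half[OF xy(2,1,4,3) xy(5)[symmetric] that] by blast
      qed
      ultimately show ?thesis using None by (intro exI[of _ "\<lambda>x y. S x = S y"]) auto
    next
      case (Some k)
      obtain c0 where "0 \<le> c0" "key c0 = Some k" using b Some by auto
      then obtain h where h: "split c0 h" "f h = k" using keyS by blast
      have h0: "0 < h" using h(1) unfolding split_def by blast
      \<comment> \<open>One \<open>h\<close> serves the whole fibre: a splitting element with the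
        same label is equivalent to \<open>h\<close> under the module relation, hence
        \<open>h\<close> splits the same subgroup.\<close>
      have sp: "reaches E O' c h \<and> \<not> inside E O' c h" if c: "0 \<le> c" "key c = Some k" for c
      proof -
        obtain g where g: "split c g" "f g = k" using keyS[OF c(2)] by blast
        then have "module_equiv E O' g h" using f(2) h h0 unfolding split_def by auto
        then show ?thesis using g(1) c(1) unfolding split_def module_equiv_def by blast
      qed
      obtain r :: "'a \<Rightarrow> nat" where r: "\<forall>x\<in>{0..}. r x < N2"
        "\<forall>x\<in>{0..}. \<forall>y\<in>{0..}. r x = r y \<longrightarrow> residue_equiv E O' h x y"
        using R[OF h0] unfolding idx_def by (elim exE conjE)
      define S where "S c = r ` {x. 0 \<le> x \<and> below E c (x * h)}" for c
      have "idx (\<lambda>x y. S x = S y) {0..} (card (Pow {..<Suc N1}) + card (Pow {..<N2}))"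
      proof (rule idxI[where f = S])
        show "S ` {0..} \<subseteq> Pow {..<N2}" unfolding S_def using r(1) by auto
      qed auto
      moreover have "E x y" if xy: "0 \<le> x" "0 \<le> y" "key x = Some k" "key y = Some k" "S x = S y" for x y
      proof (rule below_det[OF xy(1,2)])
        have half: "below E b z" if "0 \<le> a" "0 \<le> b" "key a = Some k" "key b = Some k" "S a = S b" "0 \<le> z" "below E a z" for a b z
        proof -
          have z: "z / h * h = z" "0 \<le> z / h" using h0 that(6) by simp_all
          then have "r (z / h) \<in> S a" using that(7) unfolding S_def by auto
          then have "r (z / h) \<in> S b" using that(5) by simp
          then obtain x where x: "0 \<le> x" "below E b (x * h)" "r x = r (z / h)"
            unfolding S_def by auto
          then have "residue_equiv E O' h x (z / h)" using r(2) z(2) by auto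
          then have "below E b (z / h * h)" using sp[OF that(2,4)] x(2) that(2) unfolding residue_equiv_def by blast
          then show ?thesis using z(1) by simp
        qed
        show "below E x z \<longleftrightarrow> below E y z" if "0 \<le> z" for z
          using half[OF xy that] half[OF xy(2,1,4,3) xy(5)[symmetric] that] by blast
      qed
      ultimately show ?thesis using Some by (intro exI[of _ "\<lambda>x y. S x = S y"]) auto
    qed
  qed simp
qed

end

context wom
begin

lemma add_bounded_if_val_res_bounded:
  assumes O': "convex_ring O'" "dfn K fs (\<lambda>\<rho>. \<rho> 0 \<in> O')"
    and V: "unif_bounded K {1..} (val_good O')" and R: "unif_bounded K {0..} (res_good O')"
  shows "unif_bounded K {0..} add_good"
  unfolding unif_bounded_def
proof (intro allI impI)
  fix es and E :: "(nat \<Rightarrow> 'a) \<Rightarrow> 'a \<Rightarrow> 'a \<Rightarrow> bool" assume E0: "dfn2 K es E"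
  have E: "dfn2 K (es @ fs) E" using dfn_mono[OF E0] by simp
  have Om: "dfn K (es @ fs) (\<lambda>\<rho>. \<rho> 0 \<in> O')" using dfn_mono[OF O'(2)] by simp
  have M: "dfn2 K (es @ fs) (\<lambda>\<tau>. module_equiv (E \<tau>) O')"
    unfolding module_equiv_def reaches_def inside_def below_def isunit_def
    by (intro dfn_intros dfn_app2[where E = E, OF E] dfn_unop[where D = "\<lambda>x. x \<in> O'", OF Om])
  \<comment> \<open>The scaling element is a parameter of the residue family, so that
    \<open>N2\<close> holds for all \<open>h\<close> simultaneously.\<close>
  have Q: "dfn2 K (es @ fs) (\<lambda>\<tau>. residue_equiv (E (\<lambda>i. \<tau> (Suc i))) O' (\<tau> 0))"
    unfolding residue_equiv_def reaches_def inside_def below_def isunit_def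
    by (intro dfn_intros dfn_app2[where E = E, OF E] dfn_unop[where D = "\<lambda>x. x \<in> O'", OF Om])
  obtain N1 where N1: "\<And>\<tau> n. unit_good O' (module_equiv (E \<tau>) O') \<Longrightarrow>
      idx (module_equiv (E \<tau>) O') {0<..} n \<Longrightarrow> idx (module_equiv (E \<tau>) O') {0<..} N1"
    using unit_bounded[OF V, unfolded unif_bounded_def, rule_format, OF M] by blast
  obtain N2 where N2: "\<And>\<tau> n. res_good O' (residue_equiv (E (\<lambda>i. \<tau> (Suc i))) O' (\<tau> 0)) \<Longrightarrow>
      idx (residue_equiv (E (\<lambda>i. \<tau> (Suc i))) O' (\<tau> 0)) {0..} n \<Longrightarrow>
      idx (residue_equiv (E (\<lambda>i. \<tau> (Suc i))) O' (\<tau> 0)) {0..} N2"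
    using R[unfolded unif_bounded_def, rule_format, OF Q] by blast
  have "idx (E \<tau>) {0..} (card (insert None (Some ` {..<N1})) * (card (Pow {..<Suc N1}) + card (Pow {..<N2})))"
    if g: "add_good (E \<tau>)" and n: "idx (E \<tau>) {0..} n" for \<tau> n
  proof -
    interpret add_equiv_ring "E \<tau>" O' by unfold_locales (rule g, rule O'(1))
    show ?thesis
    proof (rule idx_from_modules)
      show "idx (module_equiv (E \<tau>) O') {0<..} N1" using N1[OF module_equiv_good] idx_module_equiv[OF n] by blast
      fix h :: 'a assume h: "0 < h"
      obtain m where "idx (residue_equiv (E \<tau>) O' h) {0..} m" using idx_residue_equiv[OF n] by blast
      then show "idx (residue_equiv (E \<tau>) O' h) {0..} N2"
        using N2[of "case_nat h \<tau>" m] residue_equiv_good[OF h] by simp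
    qed
  qed
  then show "\<exists>N. \<forall>\<tau> n. add_good (E \<tau>) \<longrightarrow> idx (E \<tau>) {0..} n \<longrightarrow> idx (E \<tau>) {0..} N" by blast
qed

end

section \<open>Uniform finiteness of the imaginaries\<close>

lemma dfn_ex_list [dfn_intros]:
  assumes "dfn K es (\<lambda>\<rho>. \<phi> (map \<rho> [0..<n]) (\<lambda>i. \<rho> (n + i)))"
  shows "dfn K es (\<lambda>\<rho>. \<exists>xs. length xs = n \<and> \<phi> xs \<rho>)"
  using assms
proof (induction n arbitrary: \<phi>)
  case 0
  then show ?case by simp
next
  case (Suc n)
  let ?s = "\<lambda>j. if j < n then Suc j else if j = n then 0 else j"
  have "map (\<lambda>i. \<rho> (?s i)) [0..<Suc n] = map (\<lambda>i. \<rho> (Suc i)) [0..<n] @ [\<rho> 0]" for \<rho> :: "nat \<Rightarrow> 'a"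
    by simp
  moreover have "(\<lambda>i. \<rho> (?s (Suc n + i))) = (\<lambda>i. \<rho> (Suc (n + i)))" for \<rho> :: "nat \<Rightarrow> 'a" by simp
  ultimately have "dfn K es (\<lambda>\<rho>. \<phi> (map (\<lambda>i. \<rho> (Suc i)) [0..<n] @ [\<rho> 0]) (\<lambda>i. \<rho> (Suc (n + i))))"
    using dfn_reindex[OF Suc.prems order_refl, of ?s] by (simp only:)
  then have "dfn K es (\<lambda>\<rho>. \<exists>a. \<phi> (map \<rho> [0..<n] @ [a]) (\<lambda>i. \<rho> (n + i)))" by (rule dfn_ex)
  then have "dfn K es (\<lambda>\<rho>. \<exists>xs. length xs = n \<and> (\<exists>a. \<phi> (xs @ [a]) \<rho>))"
    by (rule Suc.IH[where \<phi> = "\<lambda>xs \<rho>. \<exists>a. \<phi> (xs @ [a]) \<rho>"])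
  moreover have "(\<exists>xs. length xs = Suc n \<and> \<phi> xs \<rho>) = (\<exists>xs. length xs = n \<and> (\<exists>a. \<phi> (xs @ [a]) \<rho>))"
    (is "?l = ?r") for \<rho>
  proof
    assume ?l
    then obtain xs where "length xs = Suc n" "\<phi> xs \<rho>" by blast
    then show ?r by (cases xs rule: rev_cases) auto
  next
    assume ?r
    then obtain xs a where "length xs = n" "\<phi> (xs @ [a]) \<rho>" by blast
    then show ?l by (intro exI[of _ "xs @ [a]"]) simp
  qed
  ultimately show ?case by (simp only:)
qed

lemma dfn_all_list [dfn_intros]:
  assumes "dfn K es (\<lambda>\<rho>. \<phi> (map \<rho> [0..<n]) (\<lambda>i. \<rho> (n + i)))"
  shows "dfn K es (\<lambda>\<rho>. \<forall>xs. length xs = n \<longrightarrow> \<phi> xs \<rho>)"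
proof -
  have "dfn K es (\<lambda>\<rho>. \<not> (\<exists>xs. length xs = n \<and> \<not> \<phi> xs \<rho>))" by (intro dfn_not dfn_ex_list assms)
  then show ?thesis by simp
qed

lemma dterm_nth_0 [dfn_intros]:
  "dterm K es (X 0) \<Longrightarrow> dterm K es (\<lambda>\<rho>. map (\<lambda>i. X i \<rho>) [0..<Suc n] ! 0)"
  by (simp add: nth_append del: upt_Suc)

abbreviation dfnL where
  "dfnL K es n F \<equiv> dfn K es (\<lambda>\<rho>. F (\<lambda>i. \<rho> (n + (n + i))) (map \<rho> [0..<n]) (map (\<lambda>i. \<rho> (n + i)) [0..<n]))"

lemma dfnL_app:
  assumes F: "dfnL K es n F" and "\<And>i. dterm K es (T i)" "\<And>i. dterm K es (X i)" "\<And>i. dterm K es (Y i)"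
  shows "dfn K es (\<lambda>\<rho>. F (\<lambda>i. T i \<rho>) (map (\<lambda>i. X i \<rho>) [0..<n]) (map (\<lambda>i. Y i \<rho>) [0..<n]))"
proof -
  define G where "G i = (if i < n then X i else if i - n < n then Y (i - n) else T (i - n - n))" for i
  have "dfn K es (\<lambda>\<rho>. F (\<lambda>i. G (n + (n + i)) \<rho>) (map (\<lambda>i. G i \<rho>) [0..<n]) (map (\<lambda>i. G (n + i) \<rho>) [0..<n]))"
    by (rule dfn_subst[OF F]) (use assms(2-4) in \<open>simp add: G_def\<close>)
  moreover have "map (\<lambda>i. G i \<rho>) [0..<n] = map (\<lambda>i. X i \<rho>) [0..<n]" for \<rho> by (simp add: G_def)
  moreover have "map (\<lambda>i. G (n + i) \<rho>) [0..<n] = map (\<lambda>i. Y i \<rho>) [0..<n]" for \<rho> by (simp add: G_def)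
  moreover have "(\<lambda>i. G (n + (n + i)) \<rho>) = (\<lambda>i. T i \<rho>)" for \<rho> by (simp add: G_def)
  ultimately show ?thesis by (simp only:)
qed

text \<open>
  \<open>proj F n x\<close> is the projection of the class of \<open>x\<close> to the first coordinate. An interval on which
  all these projections are constant meets the same classes in each of its fibres.
\<close>

definition proj :: "('a list \<Rightarrow> 'a list \<Rightarrow> bool) \<Rightarrow> nat \<Rightarrow> 'a list \<Rightarrow> 'a \<Rightarrow> bool" where
  "proj F n x c \<longleftrightarrow> (\<exists>z. length z = Suc n \<and> z ! 0 = c \<and> F x z)"

definition proj_equiv :: "('a::linorder list \<Rightarrow> 'a list \<Rightarrow> bool) \<Rightarrow> nat \<Rightarrow> 'a \<Rightarrow> 'a \<Rightarrow> bool" where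
  "proj_equiv F n a b \<longleftrightarrow> (\<forall>c d. ((a \<le> c \<and> c \<le> b) \<or> (b \<le> c \<and> c \<le> a)) \<and> ((a \<le> d \<and> d \<le> b) \<or> (b \<le> d \<and> d \<le> a)) \<longrightarrow>
     (\<forall>x. length x = Suc n \<longrightarrow> F x x \<and> proj F n x c \<longrightarrow> proj F n x d))"

text \<open>Reflexivity is left out so that the domain \<open>{x. F x x}\<close> can vary with the
  parameters.\<close>

definition partial_equiv :: "nat \<Rightarrow> ('a list \<Rightarrow> 'a list \<Rightarrow> bool) \<Rightarrow> bool" where
  "partial_equiv n F \<longleftrightarrow> (\<forall>x y. length x = n \<and> length y = n \<and> F x y \<longrightarrow> F y x) \<and>
     (\<forall>x y z. length x = n \<and> length y = n \<and> length z = n \<and> F x y \<and> F y z \<longrightarrow> F x z)"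

lemma partial_equivD:
  assumes "partial_equiv n F"
  shows "length x = n \<Longrightarrow> length y = n \<Longrightarrow> F x y \<Longrightarrow> F y x"
    "length x = n \<Longrightarrow> length y = n \<Longrightarrow> length z = n \<Longrightarrow> F x y \<Longrightarrow> F y z \<Longrightarrow> F x z"
  using assms unfolding partial_equiv_def by blast+

lemma proj_equiv_good: "cut_good (proj_equiv F n)"
  unfolding cut_good_def cequiv_def
proof (intro conjI ballI impI)
  fix a b e :: 'a
  { assume ab: "proj_equiv F n a b" and be: "proj_equiv F n b e"
    have *: "proj F n x c \<longleftrightarrow> proj F n x b"
      if c: "(a \<le> c \<and> c \<le> e) \<or> (e \<le> c \<and> c \<le> a)" and x: "length x = Suc n" "F x x" for c x
    proof -
      have "((a \<le> c \<and> c \<le> b) \<or> (b \<le> c \<and> c \<le> a)) \<or> ((b \<le> c \<and> c \<le> e) \<or> (e \<le> c \<and> c \<le> b))"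
        using c by auto
      moreover have "(a \<le> b \<and> b \<le> b) \<or> (b \<le> b \<and> b \<le> a)" "(b \<le> b \<and> b \<le> e) \<or> (e \<le> b \<and> b \<le> b)" by auto
      ultimately show ?thesis using ab be x unfolding proj_equiv_def by blast
    qed
    show "proj_equiv F n a e" unfolding proj_equiv_def using * by blast }
  { assume "a \<le> b" "b \<le> e" "proj_equiv F n a e"
    then show "proj_equiv F n a b" unfolding proj_equiv_def by (meson order_trans) }
qed (auto simp: proj_equiv_def)

lemma dfn_proj:
  assumes F: "dfnL K es (Suc n) F"
  shows "dfn K es (\<lambda>\<rho>. proj (F (\<lambda>i. \<rho> (Suc (Suc n + i)))) n (map (\<lambda>i. \<rho> (Suc i)) [0..<Suc n]) (\<rho> 0))"
  unfolding proj_def by (intro dfn_intros dfnL_app[where F = F, OF F])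

lemma dfn_proj_equiv:
  assumes F: "dfnL K es (Suc n) F"
  shows "dfn2 K es (\<lambda>\<tau>. proj_equiv (F \<tau>) n)"
  unfolding proj_equiv_def proj_def by (intro dfn_intros dfnL_app[where F = F, OF F])

text \<open>The key of a point tells which of the finitely many convex pieces contain it and which
  contain a smaller point. Between two points with equal keys no piece begins or ends.\<close>

lemma idx_interval_constant:
  fixes Q :: "'b \<Rightarrow> 'a::linorder \<Rightarrow> bool"
  assumes "finite R" "\<And>r. r \<in> R \<Longrightarrow> \<exists>\<C>. finite \<C> \<and> (\<forall>C\<in>\<C>. ord_convex C) \<and> (\<forall>x. Q r x \<longleftrightarrow> x \<in> \<Union> \<C>)"
    "\<And>a b. a \<le> b \<Longrightarrow> (\<And>r c. r \<in> R \<Longrightarrow> a \<le> c \<Longrightarrow> c \<le> b \<Longrightarrow> Q r c \<longleftrightarrow> Q r a) \<Longrightarrow> E a b \<and> E b a"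
  shows "\<exists>n. idx E (UNIV :: 'a set) n"
proof -
  have "\<forall>r\<in>R. \<exists>\<C>. finite \<C> \<and> (\<forall>C\<in>\<C>. ord_convex C) \<and> (\<forall>x. Q r x \<longleftrightarrow> x \<in> \<Union> \<C>)" using assms(2) by blast
  from bchoice[OF this] obtain \<C> where \<C>: "\<forall>r\<in>R. finite (\<C> r) \<and> (\<forall>C\<in>\<C> r. ord_convex C) \<and> (\<forall>x. Q r x \<longleftrightarrow> x \<in> \<Union> (\<C> r))"
    by (elim exE)
  define W where "W = (\<Union>r\<in>R. \<C> r)"
  have W: "finite W" unfolding W_def using assms(1) \<C> by blast
  have conv: "ord_convex C" if "C \<in> W" for C using that \<C> unfolding W_def by blast
  define key where "key a = ({C \<in> W. a \<in> C}, {C \<in> W. \<exists>c\<in>C. c < a})" for a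
  have le: "E a b \<and> E b a" if ab: "a \<le> b" "key a = key b" for a b
  proof (rule assms(3)[OF ab(1)])
    fix r c assume rc: "r \<in> R" "a \<le> c" "c \<le> b"
    have "c \<in> C \<longleftrightarrow> a \<in> C" if C: "C \<in> W" for C
    proof
      have eq: "a \<in> C \<longleftrightarrow> b \<in> C" "(\<exists>c\<in>C. c < a) \<longleftrightarrow> (\<exists>c\<in>C. c < b)" using ab(2) C unfolding key_def by blast+
      show "c \<in> C" if "a \<in> C" using conv[OF C] eq(1) that rc(2,3) unfolding ord_convex_def by blast
      assume c: "c \<in> C"
      show "a \<in> C"
      proof (cases "c = b")
        case True then show ?thesis using eq(1) c by blast
      next
        case False
        then have "c < b" using rc(3) by simp
        then obtain c' where c': "c' \<in> C" "c' < a" using eq(2) c by blast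
        then show ?thesis using conv[OF C] c rc(2) unfolding ord_convex_def by (meson less_imp_le)
      qed
    qed
    then have "\<And>C. C \<in> \<C> r \<Longrightarrow> c \<in> C \<longleftrightarrow> a \<in> C" unfolding W_def using rc(1) by blast
    then show "Q r c \<longleftrightarrow> Q r a" using \<C> rc(1) by blast
  qed
  have "idx E UNIV (card (Pow W \<times> Pow W))"
  proof (rule idxI[OF _ order_refl, where f = key])
    show "key ` UNIV \<subseteq> Pow W \<times> Pow W" unfolding key_def by blast
    fix x y assume xy: "key x = key y"
    show "E x y" using le[of x y] le[of y x] xy linorder_linear[of x y] by auto
  qed (use W in simp)
  then show ?thesis by blast
qed

context wom
begin

text \<open>\<open>N2\<close> bounds the number of pieces of the first coordinate over which the
  projections of all classes are constant, and \<open>N1\<close> bounds the classes that meet a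
  single fibre. Over one piece all fibres meet the same classes, which gives the product.\<close>

lemma partial_equiv_bounded:
  assumes cut: "unif_bounded K UNIV cut_good"
  shows "dfnL K es n F \<Longrightarrow> \<exists>N. \<forall>\<tau> m. partial_equiv n (F \<tau>) \<longrightarrow>
    idx (F \<tau>) {x. length x = n \<and> F \<tau> x x} m \<longrightarrow> idx (F \<tau>) {x. length x = n \<and> F \<tau> x x} N"
proof (induction n arbitrary: F)
  case 0
  have "idx (F \<tau>) {x. length x = 0 \<and> F \<tau> x x} 1" for \<tau>
    by (rule idxI[where A = "{0::nat}" and f = "\<lambda>_. 0"]) auto
  then show ?case by blast
next
  case (Suc n)
  note F = Suc.prems
  \<comment> \<open>The first coordinate becomes a parameter, so all fibres together form one family
    with one fewer coordinate.\<close>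
  define F' where "F' \<sigma> x y = F (\<lambda>i. \<sigma> (Suc i)) (\<sigma> 0 # x) (\<sigma> 0 # y)" for \<sigma> x y
  have F': "dfnL K es n F'"
  proof -
    have cons: "a # map f [0..<n] = map (case_nat a f) [0..<Suc n]" for a and f :: "nat \<Rightarrow> 'a"
      by (simp add: map_upt_Suc del: upt_Suc)
    have "dfn K es (\<lambda>\<rho>. F (\<lambda>i. \<rho> (n + (n + Suc i))) (map (\<lambda>i. case_nat (\<lambda>\<rho>. \<rho> (n + (n + 0))) (\<lambda>i \<rho>. \<rho> i) i \<rho>) [0..<Suc n])
      (map (\<lambda>i. case_nat (\<lambda>\<rho>. \<rho> (n + (n + 0))) (\<lambda>i \<rho>. \<rho> (n + i)) i \<rho>) [0..<Suc n]))"
      by (rule dfnL_app[OF F]) (rule dterm_var dterm_case_nat)+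
    moreover have "(\<lambda>i. case_nat (\<lambda>\<rho>. \<rho> a) g i \<rho>) = case_nat (\<rho> a) (\<lambda>i. g i \<rho>)"
      for a and g :: "nat \<Rightarrow> (nat \<Rightarrow> 'a) \<Rightarrow> 'a" and \<rho> by (auto simp: fun_eq_iff split: nat.splits)
    ultimately show ?thesis unfolding F'_def cons by (simp only:)
  qed
  obtain N1 where N1: "\<And>\<sigma> m. partial_equiv n (F' \<sigma>) \<Longrightarrow> idx (F' \<sigma>) {x. length x = n \<and> F' \<sigma> x x} m \<Longrightarrow>
      idx (F' \<sigma>) {x. length x = n \<and> F' \<sigma> x x} N1" using Suc.IH[OF F'] by blast
  obtain N2 where N2: "\<And>\<tau> m. cut_good (proj_equiv (F \<tau>) n) \<Longrightarrow> idx (proj_equiv (F \<tau>) n) UNIV m \<Longrightarrow>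
      idx (proj_equiv (F \<tau>) n) UNIV N2"
    using cut[unfolded unif_bounded_def, rule_format, OF dfn_proj_equiv[OF F]] by blast
  have "idx (F \<tau>) {x. length x = Suc n \<and> F \<tau> x x} (card {..<N2} * N1)"
    if pe: "partial_equiv (Suc n) (F \<tau>)" and m: "idx (F \<tau>) {x. length x = Suc n \<and> F \<tau> x x} m" for \<tau> m
  proof -
    define G where "G = F \<tau>"
    define A where "A = {x. length x = Suc n \<and> G x x}"
    have pe: "partial_equiv (Suc n) G" and m: "idx G A m" using pe m unfolding G_def A_def by blast+
    note sym = partial_equivD(1)[OF pe] and trans = partial_equivD(2)[OF pe]
    have proj_cong: "proj G n x c \<Longrightarrow> proj G n y c" if "length x = Suc n" "length y = Suc n" "G x y" for x y c
      unfolding proj_def using trans[OF that(2,1) _ sym[OF that]] by blast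
    obtain f :: "'a list \<Rightarrow> nat" where f: "\<forall>x\<in>A. f x < m" "\<forall>x\<in>A. \<forall>y\<in>A. f x = f y \<longrightarrow> G x y"
      using m unfolding idx_def by (elim exE conjE)
    have "\<forall>k\<in>f ` A. \<exists>r. r \<in> A \<and> f r = k" by blast
    from bchoice[OF this] obtain r where r: "\<forall>k\<in>f ` A. r k \<in> A \<and> f (r k) = k" by blast
    have "f ` A \<subseteq> {..<m}" using f(1) by blast
    then have "finite (f ` A)" by (rule finite_subset) simp
    then have finR: "finite (r ` f ` A)" by simp
    \<comment> \<open>Finitely many classes have finitely many projections, each a finite union of
      convex sets. This finiteness is the hypothesis under which the uniform bound \<open>N2\<close>
      becomes available.\<close>
    have "\<exists>k. idx (proj_equiv G n) UNIV k"
    proof (rule idx_interval_constant[OF finR, where Q = "proj G n"])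
      fix x assume "x \<in> r ` f ` A"
      then have x: "length x = Suc n" using r unfolding A_def by auto
      define \<sigma> where "\<sigma> = pre x \<tau>"
      have "map \<sigma> [0..<Suc n] = x" "(\<lambda>i. \<sigma> (Suc n + i)) = \<tau>"
        using x by (auto simp: \<sigma>_def pre_def fun_eq_iff intro!: nth_equalityI simp del: upt_Suc)
      then have Q: "proj (F (\<lambda>i. \<sigma> (Suc n + i))) n (map \<sigma> [0..<Suc n]) = proj G n x" unfolding G_def by (simp only:)
      obtain \<C> where "finite \<C>" "\<And>C. C \<in> \<C> \<Longrightarrow> ord_convex C"
        "\<And>a. proj (F (\<lambda>i. \<sigma> (Suc n + i))) n (map \<sigma> [0..<Suc n]) a \<longleftrightarrow> a \<in> \<Union> \<C>"
        using finite_union_convex[where D = "\<lambda>\<sigma>. proj (F (\<lambda>i. \<sigma> (Suc n + i))) n (map \<sigma> [0..<Suc n])",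
          of es \<sigma>] dfn_proj[OF F] by (auto simp del: upt_Suc)
      then show "\<exists>\<C>. finite \<C> \<and> (\<forall>C\<in>\<C>. ord_convex C) \<and> (\<forall>a. proj G n x a \<longleftrightarrow> a \<in> \<Union> \<C>)"
        unfolding Q by blast
    next
      fix a b :: 'a assume ab: "a \<le> b"
        and const: "\<And>x c. x \<in> r ` f ` A \<Longrightarrow> a \<le> c \<Longrightarrow> c \<le> b \<Longrightarrow> proj G n x c \<longleftrightarrow> proj G n x a"
      have "proj G n x c \<longleftrightarrow> proj G n x a" if x: "length x = Suc n" "G x x" and c: "a \<le> c" "c \<le> b" for x c
      proof -
        have xA: "x \<in> A" using x unfolding A_def by blast
        then have y: "r (f x) \<in> A" "f (r (f x)) = f x" using r by blast+
        then have "G x (r (f x))" using f(2) xA by simp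
        moreover have "length (r (f x)) = Suc n" using y unfolding A_def by blast
        ultimately show ?thesis
          using const[of "r (f x)" c] xA c proj_cong[of x "r (f x)"] proj_cong[of "r (f x)" x] sym x(1) by blast
      qed
      then have *: "proj G n x c \<longleftrightarrow> proj G n x d"
        if "length x = Suc n" "G x x" "a \<le> c" "c \<le> b" "a \<le> d" "d \<le> b" for x c d using that by blast
      have between: "a \<le> c \<and> c \<le> b" if "(a \<le> c \<and> c \<le> b) \<or> (b \<le> c \<and> c \<le> a)" for c using that ab by auto
      show "proj_equiv G n a b \<and> proj_equiv G n b a" unfolding proj_equiv_def
        using * between by blast
    qed
    then have "idx (proj_equiv G n) UNIV N2" using N2[OF proj_equiv_good] unfolding G_def by blast
    then obtain g :: "'a \<Rightarrow> nat" where g: "\<forall>a\<in>UNIV. g a < N2" "\<forall>a\<in>UNIV. \<forall>b\<in>UNIV. g a = g b \<longrightarrow> proj_equiv G n a b"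
      unfolding idx_def by (elim exE conjE)
    have "idx G A (card {..<N2} * N1)"
    proof (rule idx_fibers[where key = "\<lambda>x. g (x ! 0)", OF _ order_refl])
      show "(\<lambda>x. g (x ! 0)) ` A \<subseteq> {..<N2}" using g(1) by auto
      fix k assume "k \<in> (\<lambda>x. g (x ! 0)) ` A"
      then obtain a where a: "k = g a" by blast
      define \<sigma> where "\<sigma> = case_nat a \<tau>"
      have F'\<sigma>: "F' \<sigma> = (\<lambda>x y. G (a # x) (a # y))" unfolding F'_def \<sigma>_def G_def by simp
      have "partial_equiv n (F' \<sigma>)" unfolding partial_equiv_def F'\<sigma>
      proof (intro conjI allI impI)
        fix x y assume "length x = n \<and> length y = n \<and> G (a # x) (a # y)"
        then show "G (a # y) (a # x)" using sym[of "a # x" "a # y"] by simp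
      next
        fix x y z assume "length x = n \<and> length y = n \<and> length z = n \<and> G (a # x) (a # y) \<and> G (a # y) (a # z)"
        then show "G (a # x) (a # z)" using trans[of "a # x" "a # y" "a # z"] by simp
      qed
      moreover have "idx (F' \<sigma>) {x. length x = n \<and> F' \<sigma> x x} m" unfolding idx_def F'\<sigma>
      proof (intro exI[of _ "\<lambda>x. f (a # x)"] conjI ballI impI)
        show "f (a # x) < m" if "x \<in> {x. length x = n \<and> G (a # x) (a # x)}" for x
        proof -
          have "a # x \<in> A" using that unfolding A_def by auto
          then show ?thesis using f(1) by blast
        qed
        show "G (a # x) (a # y)" if "x \<in> {x. length x = n \<and> G (a # x) (a # x)}"
          "y \<in> {x. length x = n \<and> G (a # x) (a # x)}" "f (a # x) = f (a # y)" for x y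
        proof -
          have "a # x \<in> A" "a # y \<in> A" using that unfolding A_def by auto
          then show ?thesis using f(2) that(3) by blast
        qed
      qed
      ultimately have "idx (F' \<sigma>) {x. length x = n \<and> F' \<sigma> x x} N1" by (rule N1)
      then obtain h :: "'a list \<Rightarrow> nat" where h: "\<forall>x\<in>{x. length x = n \<and> G (a # x) (a # x)}. h x < N1"
        "\<forall>x\<in>{x. length x = n \<and> G (a # x) (a # x)}. \<forall>y\<in>{x. length x = n \<and> G (a # x) (a # x)}.
          h x = h y \<longrightarrow> G (a # x) (a # y)" unfolding idx_def F'\<sigma> by (elim exE conjE)
      \<comment> \<open>A class with a point over the piece also meets the fibre over
        \<open>a\<close>; \<open>s x\<close> picks such a point and transports the labels of this
        fibre to the whole piece.\<close>
      define s where "s x = (SOME y. length y = n \<and> G x (a # y))" for x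
      have s: "length (s x) = n" "G x (a # s x)" "G (a # s x) (a # s x)" if x: "x \<in> A" "g (x ! 0) = k" for x
      proof -
        have x': "length x = Suc n" "G x x" using x unfolding A_def by blast+
        have "proj_equiv G n (x ! 0) a" using g(2) x(2) a by blast
        moreover have "proj G n x (x ! 0)" unfolding proj_def using x' by blast
        moreover have "(x ! 0 \<le> x ! 0 \<and> x ! 0 \<le> a) \<or> (a \<le> x ! 0 \<and> x ! 0 \<le> x ! 0)"
          "(x ! 0 \<le> a \<and> a \<le> a) \<or> (a \<le> a \<and> a \<le> x ! 0)" by auto
        ultimately have "proj G n x a" using x' unfolding proj_equiv_def by blast
        then obtain z where z: "length z = Suc n" "z ! 0 = a" "G x z" unfolding proj_def by blast
        then obtain y where "z = a # y" "length y = n" by (cases z) auto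
        then have "\<exists>y. length y = n \<and> G x (a # y)" using z(3) by blast
        then have *: "length (s x) = n \<and> G x (a # s x)" unfolding s_def by (rule someI_ex)
        then show "length (s x) = n" "G x (a # s x)" by blast+
        then show "G (a # s x) (a # s x)"
          using trans[of "a # s x" x "a # s x"] sym[of x "a # s x"] x' by simp
      qed
      have "idx (\<lambda>x y. h' x = h' y) A N1" if "\<forall>x\<in>A. h' x < N1" for h' :: "'a list \<Rightarrow> nat"
        unfolding idx_def using that by blast
      \<comment> \<open>The default 0 is an admissible label: the piece has a point of
        \<open>A\<close> over it, which forces \<open>N1\<close> to be positive.\<close>
      moreover define h' where "h' x = (if g (x ! 0) = k then h (s x) else 0)" for x
      show "\<exists>H. idx H A N1 \<and> (\<forall>x\<in>A. \<forall>y\<in>A. g (x ! 0) = k \<longrightarrow> g (y ! 0) = k \<longrightarrow> H x y \<longrightarrow> G x y)"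
      proof (cases "\<exists>x\<in>A. g (x ! 0) = k")
        case True
        then obtain x where x: "x \<in> A" "g (x ! 0) = k" by blast
        then have "h (s x) < N1" using h(1) s[OF x] by simp
        then have lt: "\<forall>x\<in>A. h' x < N1" unfolding h'_def using h(1) s by auto
        have "G x y" if xy: "x \<in> A" "y \<in> A" "g (x ! 0) = k" "g (y ! 0) = k" "h' x = h' y" for x y
        proof -
          have "h (s x) = h (s y)" using xy unfolding h'_def by simp
          then have "G (a # s x) (a # s y)" using h(2) s[OF xy(1,3)] s[OF xy(2,4)] by blast
          moreover have "length x = Suc n" "length y = Suc n" using xy unfolding A_def by blast+
          ultimately show ?thesis
            using trans[of x "a # s x" y] trans[of "a # s x" "a # s y" y] sym[of y "a # s y"]
              s[OF xy(1,3)] s[OF xy(2,4)] by simp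
        qed
        then show ?thesis using calculation[OF lt] by (intro exI[of _ "\<lambda>x y. h' x = h' y"]) blast
      next
        case False
        then show ?thesis using \<open>k \<in> _\<close> by blast
      qed
    qed simp
    then show ?thesis unfolding G_def A_def .
  qed
  then show ?case by blast
qed

end

section \<open>From classes of tuples to imaginaries\<close>

lemma pullback_pairs:
  fixes R :: "('a list set \<times> 'a list set) set"
  shows "pullback {[x, y] | x y. (x, y) \<in> R} = {xs @ ys | xs ys x y. (x, y) \<in> R \<and> xs \<in> x \<and> ys \<in> y}"
proof -
  have *: "list_all2 (\<in>) xss [x, y] \<longleftrightarrow> (\<exists>xs ys. xss = [xs, ys] \<and> xs \<in> x \<and> ys \<in> y)"
    for xss :: "'a list list" and x y
    by (auto simp: list_all2_Cons2)
  show ?thesis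
  proof (intro Set.set_eqI iffI)
    fix l assume "l \<in> pullback {[x, y] | x y. (x, y) \<in> R}"
    then obtain xss x y where "l = concat xss" "(x, y) \<in> R" "list_all2 (\<in>) xss [x, y]"
      unfolding pullback_def by blast
    moreover from this(3) obtain xs ys where "xss = [xs, ys]" "xs \<in> x" "ys \<in> y" unfolding * by blast
    ultimately have "l = xs @ ys" "(x, y) \<in> R" "xs \<in> x" "ys \<in> y" by simp_all
    then show "l \<in> {xs @ ys | xs ys x y. (x, y) \<in> R \<and> xs \<in> x \<and> ys \<in> y}" by blast
  next
    fix l assume "l \<in> {xs @ ys | xs ys x y. (x, y) \<in> R \<and> xs \<in> x \<and> ys \<in> y}"
    then obtain xs ys x y where l: "l = concat [xs, ys]" "(x, y) \<in> R" "xs \<in> x" "ys \<in> y" by auto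
    then have "list_all2 (\<in>) [xs, ys] [x, y]" by simp
    then show "l \<in> pullback {[x, y] | x y. (x, y) \<in> R}" unfolding pullback_def using l(1,2) by blast
  qed
qed

lemma definable_equivD:
  assumes "definable_equiv K n E"
  shows "equiv (tuples n) E" "\<exists>es. dfn K es (\<lambda>\<rho>. (map \<rho> [0..<n], map (\<lambda>i. \<rho> (n + i)) [0..<n]) \<in> E)"
proof -
  show E: "equiv (tuples n) E" using assms unfolding definable_equiv_def by blast
  obtain es where *: "dfn K es (\<lambda>\<rho>. map \<rho> [0..<n + n] \<in> {xs @ ys | xs ys. (xs, ys) \<in> E})"
    using assms definable_imp_dfn unfolding definable_equiv_def by blast
  have "map \<rho> [0..<n + n] \<in> {xs @ ys | xs ys. (xs, ys) \<in> E} \<longleftrightarrow>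
      (map \<rho> [0..<n], map (\<lambda>i. \<rho> (n + i)) [0..<n]) \<in> E" (is "?l \<longleftrightarrow> ?r") for \<rho> :: "nat \<Rightarrow> 'a"
  proof -
    have split: "map \<rho> [0..<n + n] = map \<rho> [0..<n] @ map (\<lambda>i. \<rho> (n + i)) [0..<n]"
      by (rule nth_equalityI) (auto simp: nth_append)
    show ?thesis
    proof
      assume ?l
      then obtain xs ys where "map \<rho> [0..<n] @ map (\<lambda>i. \<rho> (n + i)) [0..<n] = xs @ ys" "(xs, ys) \<in> E"
        unfolding split by blast
      moreover from this(2) have "length xs = n" using E equiv_type by fastforce
      ultimately show ?r by simp
    next
      assume ?r
      then show ?l unfolding split by blast
    qed
  qed
  with * show "\<exists>es. dfn K es (\<lambda>\<rho>. (map \<rho> [0..<n], map (\<lambda>i. \<rho> (n + i)) [0..<n]) \<in> E)" by auto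
qed

context wom
begin

text \<open>On the representatives of the elements of \<open>A t\<close>, lying in the same element
  is a partial equivalence relation whose classes correspond to these elements. Counting imaginaries
  is thus counting classes in a power of \<open>K\<close>.\<close>

lemma eq_uniform_finiteness_if_bounded:
  assumes cut: "unif_bounded K UNIV cut_good"
  shows "eq_uniform_finiteness K"
  unfolding eq_uniform_finiteness_def uniform_finiteness_def
proof (intro allI impI)
  fix X T Y assume X: "eq_definable_set K X" and TY: "eq_definable_set K T \<and> Y \<subseteq> X \<times> T \<and> eq_definable_rel2 K Y"
  define A where "A t = {x. (x, t) \<in> Y}" for t
  have "\<exists>N. \<forall>t\<in>T. finite (A t) \<longrightarrow> card (A t) \<le> N"
  \<comment> \<open>The arity in \<open>eq_definable_rel2\<close> is existential and is identified
    by the length of an element of the pullback. The empty relation has no such element, so it is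
    treated separately.\<close>
  proof (cases "Y = {}")
    case True
    then show ?thesis unfolding A_def by simp
  next
    case False
    obtain n QX where QX: "definable_equiv K n QX" "X \<subseteq> tuples n // QX"
      using X unfolding eq_definable_set_def by blast
    obtain m QT where QT: "definable_equiv K m QT" "T \<subseteq> tuples m // QT"
      using TY unfolding eq_definable_set_def by blast
    note QXe = definable_equivD(1)[OF QX(1)] and QTe = definable_equivD(1)[OF QT(1)]
    define S where "S = {xs @ ts | xs ts x t. (x, t) \<in> Y \<and> xs \<in> x \<and> ts \<in> t}"
    have lenX: "length xs = n" if "x \<in> X" "xs \<in> x" for x xs
      using in_quotient_imp_subset[OF QXe, of x] QX(2) that by blast
    have lenT: "length ts = m" if "t \<in> T" "ts \<in> t" for t ts
      using in_quotient_imp_subset[OF QTe, of t] QT(2) that by blast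
    have neX: "\<exists>xs. xs \<in> x" if "x \<in> X" for x
      using in_quotient_imp_non_empty[OF QXe, of x] QX(2) that by blast
    have neT: "\<exists>ts. ts \<in> t" if "t \<in> T" for t
      using in_quotient_imp_non_empty[OF QTe, of t] QT(2) that by blast
    obtain k where k: "definable K k S"
      using TY unfolding eq_definable_rel2_def eq_definable_rel_def pullback_pairs S_def by blast
    have lenS: "length l = n + m" if "l \<in> S" for l using that lenX lenT TY unfolding S_def by fastforce
    obtain x t where xt: "(x, t) \<in> Y" using False by auto
    then obtain xs ts where "xs \<in> x" "ts \<in> t" using neX neT TY by blast
    then have "xs @ ts \<in> S" using xt unfolding S_def by blast
    then have "length (xs @ ts) = k" using k unfolding definable_def by blast
    then have "k = n + m" using lenS[OF \<open>xs @ ts \<in> S\<close>] by simp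
    then obtain e1 where e1: "dfn K e1 (\<lambda>\<rho>. map \<rho> [0..<n + m] \<in> S)" using definable_imp_dfn k by blast
    obtain e2 where e2: "dfn K e2 (\<lambda>\<rho>. (map \<rho> [0..<n], map (\<lambda>i. \<rho> (n + i)) [0..<n]) \<in> QX)"
      using definable_equivD(2)[OF QX(1)] by blast
    define F where "F \<tau> xs ys \<longleftrightarrow> xs @ map \<tau> [0..<m] \<in> S \<and> ys @ map \<tau> [0..<m] \<in> S \<and> (xs, ys) \<in> QX"
      for \<tau> xs ys
    have "dfnL K (e1 @ e2) n F"
    proof -
      have 1: "dfn K (e1 @ e2) (\<lambda>\<rho>. map (\<lambda>i. \<rho> (s i)) [0..<n + m] \<in> S)" for s
        by (rule dfn_reindex[OF e1]) simp
      have 2: "map (\<lambda>i. \<rho> (if i < n then i else n + i)) [0..<n + m] =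
          map \<rho> [0..<n] @ map (\<lambda>i. \<rho> (n + (n + i))) [0..<m]" for \<rho> :: "nat \<Rightarrow> 'a"
        by (rule nth_equalityI) (auto simp: nth_append)
      have 3: "map (\<lambda>i. \<rho> (n + i)) [0..<n + m] =
          map (\<lambda>i. \<rho> (n + i)) [0..<n] @ map (\<lambda>i. \<rho> (n + (n + i))) [0..<m]" for \<rho> :: "nat \<Rightarrow> 'a"
        by (rule nth_equalityI) (auto simp: nth_append)
      have 4: "dfn K (e1 @ e2) (\<lambda>\<rho>. (map \<rho> [0..<n], map (\<lambda>i. \<rho> (n + i)) [0..<n]) \<in> QX)"
        by (rule dfn_mono[OF e2]) simp
      show ?thesis unfolding F_def
        by (intro dfn_conj 1[of "\<lambda>i. if i < n then i else n + i", unfolded 2] 1[of "\<lambda>i. n + i", unfolded 3] 4)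
    qed
    from partial_equiv_bounded[OF cut this] obtain N where N: "\<And>\<tau> q. partial_equiv n (F \<tau>) \<Longrightarrow>
      idx (F \<tau>) {x. length x = n \<and> F \<tau> x x} q \<Longrightarrow> idx (F \<tau>) {x. length x = n \<and> F \<tau> x x} N" by blast
    have "card (A t) \<le> N" if t: "t \<in> T" and fin: "finite (A t)" for t
    proof -
      obtain ts where ts: "ts \<in> t" using neT t by blast
      define \<tau> where "\<tau> = pre ts (\<lambda>_. 0)"
      have map: "map \<tau> [0..<m] = ts"
        using lenT[OF t ts] by (auto simp: \<tau>_def pre_def intro!: nth_equalityI)
      have AX: "x \<in> X" "x \<in> tuples n // QX" if "x \<in> A t" for x using that TY QX(2) unfolding A_def by blast+
      have S: "xs @ ts \<in> S \<longleftrightarrow> (\<exists>x\<in>A t. xs \<in> x)" if len: "length xs = n" for xs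
      proof
        assume "xs @ ts \<in> S"
        then obtain xs' ts' x' t' where *: "xs @ ts = xs' @ ts'" "(x', t') \<in> Y" "xs' \<in> x'" "ts' \<in> t'"
          unfolding S_def by blast
        then have "x' \<in> X" "t' \<in> T" using TY by blast+
        then have "xs' = xs" "ts' = ts" using *(1,3) lenX len by auto
        moreover have "t' = t" using quotient_disj[OF QTe, of t t'] QT(2) t \<open>t' \<in> T\<close> ts *(4) \<open>ts' = ts\<close> by blast
        ultimately show "\<exists>x\<in>A t. xs \<in> x" using *(2,3) unfolding A_def by blast
      next
        assume "\<exists>x\<in>A t. xs \<in> x"
        then show "xs @ ts \<in> S" using ts unfolding S_def A_def by blast
      qed
      have F: "F \<tau> xs ys \<longleftrightarrow> (\<exists>x\<in>A t. xs \<in> x \<and> ys \<in> x)" if len: "length xs = n" "length ys = n" for xs ys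
      proof
        assume "F \<tau> xs ys"
        then obtain x y where "x \<in> A t" "xs \<in> x" "y \<in> A t" "ys \<in> y" "(xs, ys) \<in> QX"
          using S[OF len(1)] S[OF len(2)] unfolding F_def map by blast
        then show "\<exists>x\<in>A t. xs \<in> x \<and> ys \<in> x" using quotient_eqI[OF QXe AX(2) AX(2)] by blast
      next
        assume "\<exists>x\<in>A t. xs \<in> x \<and> ys \<in> x"
        then obtain x where x: "x \<in> A t" "xs \<in> x" "ys \<in> x" by blast
        then have "(xs, ys) \<in> QX" using quotient_eq_iff[OF QXe AX(2)[OF x(1)] AX(2)[OF x(1)] x(2,3)] by blast
        then show "F \<tau> xs ys" unfolding F_def map using S len x by blast
      qed
      have disj: "x = y" if "x \<in> A t" "y \<in> A t" "xs \<in> x" "xs \<in> y" for x y xs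
        using quotient_disj[OF QXe AX(2)[OF that(1)] AX(2)[OF that(2)]] that(3,4) by blast
      have pe: "partial_equiv n (F \<tau>)" unfolding partial_equiv_def
      proof (intro conjI allI impI)
        fix xs ys assume "length xs = n \<and> length ys = n \<and> F \<tau> xs ys"
        then show "F \<tau> ys xs" using F by blast
      next
        fix xs ys zs assume *: "length xs = n \<and> length ys = n \<and> length zs = n \<and> F \<tau> xs ys \<and> F \<tau> ys zs"
        then obtain x y where "x \<in> A t" "xs \<in> x" "ys \<in> x" "y \<in> A t" "ys \<in> y" "zs \<in> y" using F by blast
        then show "F \<tau> xs zs" using F[of xs zs] * disj[of x y ys] by blast
      qed
      have "idx (F \<tau>) {x. length x = n \<and> F \<tau> x x} (card (A t))"
      proof (rule idxI[OF fin order_refl, where f = "\<lambda>xs. SOME x. x \<in> A t \<and> xs \<in> x"])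
        have some: "(SOME x. x \<in> A t \<and> xs \<in> x) \<in> A t \<and> xs \<in> (SOME x. x \<in> A t \<and> xs \<in> x)"
          if "xs \<in> {x. length x = n \<and> F \<tau> x x}" for xs
        proof (rule someI_ex)
          show "\<exists>x. x \<in> A t \<and> xs \<in> x" using that F[of xs xs] by blast
        qed
        then show "(\<lambda>xs. SOME x. x \<in> A t \<and> xs \<in> x) ` {x. length x = n \<and> F \<tau> x x} \<subseteq> A t" by blast
        fix xs ys assume *: "xs \<in> {x. length x = n \<and> F \<tau> x x}" "ys \<in> {x. length x = n \<and> F \<tau> x x}"
          "(SOME x. x \<in> A t \<and> xs \<in> x) = (SOME x. x \<in> A t \<and> ys \<in> x)"
        show "F \<tau> xs ys" using some[OF *(1)] some[OF *(2)] *(1,2) unfolding *(3) using F[of xs ys] by blast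
      qed
      then have "idx (F \<tau>) {x. length x = n \<and> F \<tau> x x} N" by (rule N[OF pe])
      then obtain f :: "'a list \<Rightarrow> nat" where f: "\<forall>x\<in>{x. length x = n \<and> F \<tau> x x}. f x < N"
        "\<forall>x\<in>{x. length x = n \<and> F \<tau> x x}. \<forall>y\<in>{x. length x = n \<and> F \<tau> x x}. f x = f y \<longrightarrow> F \<tau> x y"
        unfolding idx_def by (elim exE conjE)
      have "\<forall>x\<in>A t. \<exists>xs. xs \<in> x" using neX AX by blast
      from bchoice[OF this] obtain r where r: "\<forall>x\<in>A t. r x \<in> x" by blast
      have rF: "r x \<in> {x. length x = n \<and> F \<tau> x x}" if "x \<in> A t" for x
        using r that F[of "r x" "r x"] lenX[OF AX(1)[OF that]] by blast
      have "card (A t) \<le> card {..<N}"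
      proof (rule card_inj_on_le[where f = "\<lambda>x. f (r x)"])
        show "inj_on (\<lambda>x. f (r x)) (A t)"
        proof (rule inj_onI)
          fix x y assume xy: "x \<in> A t" "y \<in> A t" "f (r x) = f (r y)"
          then have "F \<tau> (r x) (r y)" using f(2) rF by blast
          then obtain z where "z \<in> A t" "r x \<in> z" "r y \<in> z" using F rF[OF xy(1)] rF[OF xy(2)] by blast
          then show "x = y" using disj[OF xy(1) _ _, of z "r x"] disj[OF xy(2) _ _, of z "r y"] r xy(1,2) by blast
        qed
        show "(\<lambda>x. f (r x)) ` A t \<subseteq> {..<N}" using f(1) rF by blast
      qed simp
      then show ?thesis by simp
    qed
    then show ?thesis by blast
  qed
  then show "\<exists>n. \<forall>t\<in>T. infinite {x. (x, t) \<in> Y} \<longleftrightarrow> infinite {x. (x, t) \<in> Y} \<or> n < card {x. (x, t) \<in> Y}"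
    unfolding A_def not_le[symmetric] by blast
qed

end

section \<open>Families of subgroups as imaginaries\<close>

lemma definable_equivI:
  assumes E: "equiv (tuples n) E"
    and "dfn K es (\<lambda>\<rho>. (map \<rho> [0..<n], map (\<lambda>i. \<rho> (n + i)) [0..<n]) \<in> E)"
  shows "definable_equiv K n E"
proof -
  have len: "length xs = n" "length ys = n" if "(xs, ys) \<in> E" for xs ys
    using E that equiv_type by fastforce+
  have "map \<rho> [0..<n + n] \<in> {xs @ ys | xs ys. (xs, ys) \<in> E} \<longleftrightarrow>
      (map \<rho> [0..<n], map (\<lambda>i. \<rho> (n + i)) [0..<n]) \<in> E" (is "?l \<longleftrightarrow> ?r") for \<rho> :: "nat \<Rightarrow> 'a"
  proof -
    have split: "map \<rho> [0..<n + n] = map \<rho> [0..<n] @ map (\<lambda>i. \<rho> (n + i)) [0..<n]"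
      by (rule nth_equalityI) (auto simp: nth_append)
    show ?thesis
    proof
      assume ?l
      then obtain xs ys where *: "map \<rho> [0..<n] @ map (\<lambda>i. \<rho> (n + i)) [0..<n] = xs @ ys" "(xs, ys) \<in> E"
        unfolding split by blast
      then show ?r using len(1)[OF *(2)] by simp
    next
      assume ?r
      then show ?l unfolding split by blast
    qed
  qed
  then have "definable K (n + n) {xs @ ys | xs ys. (xs, ys) \<in> E}"
    by (intro dfn_imp_definable[of K es]) (use assms(2) len in auto)
  then show ?thesis using E unfolding definable_equiv_def by blast
qed

lemma definable_appendI:
  assumes "dfn K es (\<lambda>\<rho>. P (map \<rho> [0..<n]) (map (\<lambda>i. \<rho> (n + i)) [0..<m]))"
    and S: "S = {xs @ ys | xs ys. length xs = n \<and> length ys = m \<and> P xs ys}"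
  shows "definable K (n + m) S"
proof (rule dfn_imp_definable)
  have "map \<rho> [0..<n + m] \<in> S \<longleftrightarrow> P (map \<rho> [0..<n]) (map (\<lambda>i. \<rho> (n + i)) [0..<m])" for \<rho> :: "nat \<Rightarrow> 'a"
  proof -
    have split: "map \<rho> [0..<n + m] = map \<rho> [0..<n] @ map (\<lambda>i. \<rho> (n + i)) [0..<m]"
      by (rule nth_equalityI) (auto simp: nth_append)
    show ?thesis
    proof
      assume "map \<rho> [0..<n + m] \<in> S"
      then show "P (map \<rho> [0..<n]) (map (\<lambda>i. \<rho> (n + i)) [0..<m])" unfolding S split by auto
    next
      assume *: "P (map \<rho> [0..<n]) (map (\<lambda>i. \<rho> (n + i)) [0..<m])"
      show "map \<rho> [0..<n + m] \<in> S" unfolding S split mem_Collect_eq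
        by (intro exI[of _ "map \<rho> [0..<n]"] exI[of _ "map (\<lambda>i. \<rho> (n + i)) [0..<m]"] conjI *) simp_all
    qed
  qed
  then show "dfn K es (\<lambda>\<rho>. map \<rho> [0..<n + m] \<in> S)" using assms(1) by simp
qed (auto simp: S)

lemma dfn_map_eq:
  "dfn K es (\<lambda>\<rho>. map (\<lambda>i. \<rho> (s i)) [0..<n] = map (\<lambda>i. \<rho> (t i)) [0..<n])"
proof (induction n)
  case 0
  have "dfn K es (\<lambda>\<rho>. \<rho> 0 = \<rho> 0)" by (intro dfn_intros)
  then show ?case by simp
next
  case (Suc n)
  have "dfn K es (\<lambda>\<rho>. map (\<lambda>i. \<rho> (s i)) [0..<n] = map (\<lambda>i. \<rho> (t i)) [0..<n] \<and> \<rho> (s n) = \<rho> (t n))"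
    by (intro dfn_conj Suc dfn_intros)
  then show ?case by simp
qed

text \<open>Turns uniform finiteness of a collection into a bound for a family of subsets of the
  field. The sets \<open>H \<tau> c\<close> are coded by \<open>c\<close> and the relevant part of
  \<open>\<tau>\<close>, modulo equality of the sets; the codes form a set of imaginaries from the
  collection, and the members for a fixed \<open>\<tau>\<close> are a fibre of a definable family in
  it.\<close>

lemma collection_bounded:
  fixes K :: "('a::linordered_field, 'f, 'r) expansion" and H :: "(nat \<Rightarrow> 'a) \<Rightarrow> 'a \<Rightarrow> 'a \<Rightarrow> bool"
  assumes UF: "collection_uniform_finiteness K D {S. eq_definable_set K S \<and> Q S}"
    and QD: "definable_equiv K nD QD" "D \<subseteq> tuples nD // QD"
    and rD: "r ` Z \<subseteq> D"
    and V: "dfn K fs (\<lambda>\<rho>. \<rho> 0 \<in> Z \<and> map (\<lambda>i. \<rho> (Suc i)) [0..<nD] \<in> r (\<rho> 0))"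
    and H: "dfn2 K fs H" and gd: "dfn K fs (\<lambda>\<rho>. gd (\<lambda>i. \<rho> (Suc i)) (\<rho> 0))"
    and HZ: "\<And>\<tau> c z. gd \<tau> c \<Longrightarrow> H \<tau> c z \<Longrightarrow> z \<in> Z"
    and saturated: "\<And>\<tau> c z z'. gd \<tau> c \<Longrightarrow> H \<tau> c z \<Longrightarrow> z' \<in> Z \<Longrightarrow> r z' = r z \<Longrightarrow> H \<tau> c z'"
    and QH: "\<And>\<tau> c. gd \<tau> c \<Longrightarrow> Q (r ` {z. H \<tau> c z})"
  shows "\<exists>N. \<forall>\<tau>. finite {{z. H \<tau> c z} | c. gd \<tau> c} \<longrightarrow> card {{z. H \<tau> c z} | c. gd \<tau> c} \<le> N"
proof -
  obtain k1 where k1: "\<And>\<rho> \<rho>'. (\<And>i. i < k1 \<Longrightarrow> \<rho> i = \<rho>' i) \<Longrightarrow>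
      H (\<lambda>i. \<rho> (Suc (Suc i))) (\<rho> 0) (\<rho> (Suc 0)) = H (\<lambda>i. \<rho>' (Suc (Suc i))) (\<rho>' 0) (\<rho>' (Suc 0))"
    using dfn_support[OF H] by metis
  obtain k2 where k2: "\<And>\<rho> \<rho>'. (\<And>i. i < k2 \<Longrightarrow> \<rho> i = \<rho>' i) \<Longrightarrow>
      gd (\<lambda>i. \<rho> (Suc i)) (\<rho> 0) = gd (\<lambda>i. \<rho>' (Suc i)) (\<rho>' 0)"
    using dfn_support[OF gd] by metis
  \<comment> \<open>By finite support \<open>k\<close> parameters suffice, and a code is a list of
    length \<open>Suc k\<close> with \<open>c\<close> at its head.\<close>
  define k where "k = max k1 k2"
  have Hk: "H \<tau> c = H \<tau>' c" if "\<And>i. i < k \<Longrightarrow> \<tau> i = \<tau>' i" for \<tau> \<tau>' c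
  proof
    fix z show "H \<tau> c z = H \<tau>' c z"
      using k1[of "case_nat c (case_nat z \<tau>)" "case_nat c (case_nat z \<tau>')"] that
      by (simp add: k_def split: nat.splits)
  qed
  have gdk: "gd \<tau> c = gd \<tau>' c" if "\<And>i. i < k \<Longrightarrow> \<tau> i = \<tau>' i" for \<tau> \<tau>' c
    using k2[of "case_nat c \<tau>" "case_nat c \<tau>'"] that by (simp add: k_def split: nat.splits)
  define env :: "'a list \<Rightarrow> nat \<Rightarrow> 'a" where "env l i = pre l (\<lambda>_. 0) (Suc i)" for l i
  define gl where "gl l \<longleftrightarrow> gd (env l) (hd l)" for l
  define Hl where "Hl l = {z. H (env l) (hd l) z}" for l
  have hd: "hd (map \<rho> [0..<Suc k]) = \<rho> 0" for \<rho> :: "nat \<Rightarrow> 'a" by (simp add: hd_map del: upt_Suc)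
  have env: "env (map \<rho> [0..<Suc k]) i = \<rho> (Suc i)" if "i < k" for \<rho> i
    using that by (simp add: env_def pre_def del: upt_Suc)
  have gl: "gl (map \<rho> [0..<Suc k]) \<longleftrightarrow> gd (\<lambda>i. \<rho> (Suc i)) (\<rho> 0)" for \<rho>
    unfolding gl_def hd by (rule gdk) (rule env)
  have Hl: "z \<in> Hl (map \<rho> [0..<Suc k]) \<longleftrightarrow> H (\<lambda>i. \<rho> (Suc i)) (\<rho> 0) z" for \<rho> z
    unfolding Hl_def hd mem_Collect_eq by (rule fun_cong[OF Hk]) (rule env)
  have envc: "env (c # map \<tau> [0..<k]) i = \<tau> i" if "i < k" for c \<tau> i
    using that by (simp add: env_def pre_def)
  have glc: "gl (c # map \<tau> [0..<k]) \<longleftrightarrow> gd \<tau> c" for c \<tau>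
    unfolding gl_def list.sel by (rule gdk) (rule envc)
  have Hlc: "Hl (c # map \<tau> [0..<k]) = {z. H \<tau> c z}" for c \<tau>
    unfolding Hl_def list.sel using Hk[of "env (c # map \<tau> [0..<k])" \<tau> c] envc by auto
  \<comment> \<open>A sort needs an equivalence relation on all tuples, so the tuples that are no
    codes are put into a single class, which does not belong to \<open>X\<close>.\<close>
  define QX where "QX = {(l, l'). length l = Suc k \<and> length l' = Suc k \<and> (gl l \<longleftrightarrow> gl l') \<and> (gl l \<longrightarrow> Hl l = Hl l')}"
  have eqX: "equiv (tuples (Suc k)) QX"
    by (rule equivI) (auto simp: QX_def refl_on_def sym_def trans_def)
  have HlHl: "Hl (map \<rho> [0..<Suc k]) = Hl (map \<rho>' [0..<Suc k]) \<longleftrightarrow>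
      (\<forall>z. H (\<lambda>i. \<rho> (Suc i)) (\<rho> 0) z \<longleftrightarrow> H (\<lambda>i. \<rho>' (Suc i)) (\<rho>' 0) z)" for \<rho> \<rho>'
    unfolding set_eq_iff Hl ..
  note app = dfn_app2[where E = H, OF H] dfn_app1[where D = gd, OF gd]
  have dX: "definable_equiv K (Suc k) QX"
  proof (rule definable_equivI[OF eqX])
    have "(map \<rho> [0..<Suc k], map (\<lambda>i. \<rho> (Suc k + i)) [0..<Suc k]) \<in> QX \<longleftrightarrow>
        (gd (\<lambda>i. \<rho> (Suc i)) (\<rho> 0) \<longleftrightarrow> gd (\<lambda>i. \<rho> (Suc k + Suc i)) (\<rho> (Suc k + 0))) \<and>
        (gd (\<lambda>i. \<rho> (Suc i)) (\<rho> 0) \<longrightarrow> (\<forall>z. H (\<lambda>i. \<rho> (Suc i)) (\<rho> 0) z \<longleftrightarrow>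
          H (\<lambda>i. \<rho> (Suc k + Suc i)) (\<rho> (Suc k + 0)) z))" for \<rho>
      unfolding QX_def mem_Collect_eq prod.case gl HlHl by simp
    then show "dfn K fs (\<lambda>\<rho>. (map \<rho> [0..<Suc k], map (\<lambda>i. \<rho> (Suc k + i)) [0..<Suc k]) \<in> QX)"
      by (simp only:) (intro dfn_intros app)
  qed
  define cl where "cl l = QX `` {l}" for l
  have cl: "l' \<in> cl l \<longleftrightarrow> length l' = Suc k \<and> gl l' \<and> Hl l' = Hl l" if "length l = Suc k" "gl l" for l l'
    using that unfolding cl_def QX_def by auto
  have cl_eq: "cl l = cl l' \<longleftrightarrow> Hl l = Hl l'" if "length l = Suc k" "gl l" "length l' = Suc k" "gl l'" for l l'
  proof
    assume "cl l = cl l'"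
    then have "l \<in> cl l'" using cl[OF that(1,2)] that(1,2) by blast
    then show "Hl l = Hl l'" using cl[OF that(3,4)] by blast
  next
    assume "Hl l = Hl l'"
    then show "cl l = cl l'" using cl[OF that(1,2)] cl[OF that(3,4)] by blast
  qed
  define X where "X = {cl l | l. length l = Suc k \<and> gl l}"
  have X: "eq_definable_set K X"
    unfolding eq_definable_set_def
  proof (intro exI conjI)
    show "definable_equiv K (Suc k) QX" by (rule dX)
    show "X \<subseteq> tuples (Suc k) // QX" unfolding X_def cl_def quotient_def by blast
    have U: "\<Union> X = {l. length l = Suc k \<and> gl l}"
    proof (intro Set.set_eqI iffI)
      fix l assume "l \<in> \<Union> X"
      then show "l \<in> {l. length l = Suc k \<and> gl l}" unfolding X_def using cl by blast
    next
      fix l assume "l \<in> {l. length l = Suc k \<and> gl l}"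
      then have "l \<in> cl l" "cl l \<in> X" unfolding X_def using cl by blast+
      then show "l \<in> \<Union> X" by blast
    qed
    have "map \<rho> [0..<Suc k] \<in> \<Union> X \<longleftrightarrow> gd (\<lambda>i. \<rho> (Suc i)) (\<rho> 0)" for \<rho>
      unfolding U mem_Collect_eq gl by simp
    then show "definable K (Suc k) (\<Union> X)"
      by (intro dfn_imp_definable[of K fs]) (use gd U in auto)
  qed
  define R where "R = {(cl l, r z) | l z. length l = Suc k \<and> gl l \<and> z \<in> Hl l}"
  have lenD: "length ys = nD" if "d \<in> D" "ys \<in> d" for d ys
    using in_quotient_imp_subset[OF definable_equivD(1)[OF QD(1)], of d] QD(2) that by blast
  have HlZ: "z \<in> Z" if "gl l" "z \<in> Hl l" for l z using HZ that unfolding gl_def Hl_def by blast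
  define M where "M z ys \<longleftrightarrow> z \<in> Z \<and> ys \<in> r z" for z ys
  have Vs: "dfn K fs (\<lambda>\<rho>. M (\<rho> (s 0)) (map (\<lambda>i. \<rho> (s (Suc i))) [0..<nD]))" for s
    using dfn_reindex[OF V order_refl, of s] unfolding M_def .
  have sub: "{d \<in> D. (cl l, d) \<in> R} = r ` Hl l" if l: "length l = Suc k" "gl l" for l
  proof (intro Set.set_eqI iffI)
    fix d assume "d \<in> {d \<in> D. (cl l, d) \<in> R}"
    then obtain l' z where "cl l = cl l'" "d = r z" "length l' = Suc k" "gl l'" "z \<in> Hl l'"
      unfolding R_def by blast
    then show "d \<in> r ` Hl l" using cl_eq[OF l] by blast
  next
    fix d assume "d \<in> r ` Hl l"
    then show "d \<in> {d \<in> D. (cl l, d) \<in> R}" using l rD HlZ unfolding R_def by blast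
  qed
  have "imaginaries_from K D {S. eq_definable_set K S \<and> Q S} X"
    unfolding imaginaries_from_def
  proof (intro conjI exI[of _ R])
    show "R \<subseteq> X \<times> D" unfolding R_def X_def using rD HlZ by blast
    show "eq_definable_rel2 K R" unfolding eq_definable_rel2_def eq_definable_rel_def pullback_pairs
    proof (intro exI, rule definable_appendI)
      show "dfn K fs (\<lambda>\<rho>. gl (map \<rho> [0..<Suc k]) \<and>
          (\<exists>z. z \<in> Hl (map \<rho> [0..<Suc k]) \<and> M z (map (\<lambda>i. \<rho> (Suc k + i)) [0..<nD])))"
        unfolding gl Hl
        by (intro dfn_intros app) (use Vs[of "\<lambda>i. case i of 0 \<Rightarrow> 0 | Suc i \<Rightarrow> Suc (Suc k + i)"] in simp)
      show "{xs @ ys | xs ys x y. (x, y) \<in> R \<and> xs \<in> x \<and> ys \<in> y} = {xs @ ys | xs ys.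
          length xs = Suc k \<and> length ys = nD \<and> (gl xs \<and> (\<exists>z. z \<in> Hl xs \<and> M z ys))}"
        (is "?A = ?B")
      proof (intro Set.set_eqI iffI)
        fix l assume "l \<in> ?A"
        then obtain xs ys a z where *: "l = xs @ ys" "length a = Suc k" "gl a" "z \<in> Hl a" "xs \<in> cl a" "ys \<in> r z"
          unfolding R_def by blast
        moreover have "z \<in> Z" by (rule HlZ[OF *(3,4)])
        moreover have "length ys = nD" by (rule lenD[of "r z"]) (use rD \<open>z \<in> Z\<close> *(6) in auto)
        ultimately show "l \<in> ?B" using cl[OF *(2,3)] unfolding M_def by blast
      next
        fix l assume "l \<in> ?B"
        then obtain xs ys z where *: "l = xs @ ys" "length xs = Suc k" "gl xs" "z \<in> Hl xs" "ys \<in> r z"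
          unfolding M_def by blast
        then have "xs \<in> cl xs" using cl by blast
        then show "l \<in> ?A" unfolding R_def using * by blast
      qed
    qed
    show "inj_on (\<lambda>x. {d \<in> D. (x, d) \<in> R}) X"
    proof (rule inj_onI)
      fix x y assume "x \<in> X" "y \<in> X" and eq: "{d \<in> D. (x, d) \<in> R} = {d \<in> D. (y, d) \<in> R}"
      then obtain l l' where l: "x = cl l" "length l = Suc k" "gl l" and l': "y = cl l'" "length l' = Suc k" "gl l'"
        unfolding X_def by blast
      have r: "r ` Hl l = r ` Hl l'" using eq sub[OF l(2,3)] sub[OF l'(2,3)] unfolding l(1) l'(1) by simp
      \<comment> \<open>Each coded set is a union of fibres of \<open>r\<close> inside
        \<open>Z\<close>, so its image in \<open>D\<close> determines it. This is the injectivity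
        required of a set of imaginaries.\<close>
      have "Hl a \<subseteq> Hl b" if "gl a" "gl b" "r ` Hl a = r ` Hl b" for a b
      proof
        fix z assume z: "z \<in> Hl a"
        then have "r z \<in> r ` Hl b" using that(3) by blast
        then obtain z' where z': "z' \<in> Hl b" "r z = r z'" by blast
        then show "z \<in> Hl b" using saturated[of "env b" "hd b" z' z] HlZ[OF that(1) z] that(2)
          unfolding gl_def Hl_def by blast
      qed
      then have "Hl l = Hl l'" using r l(3) l'(3) by blast
      then show "x = y" using cl_eq[OF l(2,3) l'(2,3)] l(1) l'(1) by blast
    qed
    show "\<forall>x\<in>X. {d \<in> D. (x, d) \<in> R} \<in> {S. eq_definable_set K S \<and> Q S}"
    proof
      fix x assume "x \<in> X"
      then obtain l where l: "x = cl l" "length l = Suc k" "gl l" unfolding X_def by blast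
      have "Q (r ` Hl l)" using QH l(3) unfolding gl_def Hl_def by blast
      moreover have "eq_definable_set K (r ` Hl l)" unfolding eq_definable_set_def
      proof (intro exI conjI)
        show "definable_equiv K nD QD" by (rule QD(1))
        show "r ` Hl l \<subseteq> tuples nD // QD" using rD HlZ[OF l(3)] QD(2) by blast
        have "dfn K fs (\<lambda>\<rho>. \<exists>z. H (\<lambda>i. \<rho> (nD + Suc i)) (\<rho> nD) z \<and> M z (map \<rho> [0..<nD]))"
          by (intro dfn_intros app) (use Vs[of "\<lambda>i. i"] in simp)
        then obtain fs' where fs': "dfn K fs' (\<lambda>\<rho>. \<exists>z.
            H (\<lambda>i. if nD + Suc i < nD then \<rho> (nD + Suc i) else pre l (\<lambda>_. 0) (nD + Suc i - nD))
              (if nD < nD then \<rho> nD else pre l (\<lambda>_. 0) (nD - nD)) z \<and>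
            M z (map (\<lambda>i. if i < nD then \<rho> i else pre l (\<lambda>_. 0) (i - nD)) [0..<nD]))"
          by (rule dfn_fix[where k = nD and \<tau> = "pre l (\<lambda>_. 0)"])
        have "map (\<lambda>i. if i < nD then \<rho> i else pre l (\<lambda>_. 0) (i - nD)) [0..<nD] = map \<rho> [0..<nD]"
          for \<rho> :: "nat \<Rightarrow> 'a" by simp
        moreover have "(\<lambda>i. if nD + Suc i < nD then \<rho> (nD + Suc i) else pre l (\<lambda>_. 0) (nD + Suc i - nD)) = env l"
          for \<rho> :: "nat \<Rightarrow> 'a" by (auto simp: env_def fun_eq_iff)
        moreover have "(if nD < nD then \<rho> nD else pre l (\<lambda>_. 0) (nD - nD)) = hd l" for \<rho> :: "nat \<Rightarrow> 'a"
          using l(2) by (cases l) (auto simp: pre_def)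
        ultimately have fs'': "dfn K fs' (\<lambda>\<rho>. \<exists>z. H (env l) (hd l) z \<and> M z (map \<rho> [0..<nD]))"
          using fs' by (simp only:)
        have "map \<rho> [0..<nD] \<in> \<Union> (r ` Hl l) \<longleftrightarrow> (\<exists>z. H (env l) (hd l) z \<and> M z (map \<rho> [0..<nD]))" for \<rho>
          using HlZ[OF l(3)] unfolding Hl_def M_def by blast
        then have "dfn K fs' (\<lambda>\<rho>. map \<rho> [0..<nD] \<in> \<Union> (r ` Hl l))" using fs'' by (simp only:)
        moreover have "\<Union> (r ` Hl l) \<subseteq> tuples nD" using lenD rD HlZ[OF l(3)] by blast
        ultimately show "definable K nD (\<Union> (r ` Hl l))" by (rule dfn_imp_definable)
      qed
      ultimately show "{d \<in> D. (x, d) \<in> R} \<in> {S. eq_definable_set K S \<and> Q S}" unfolding l(1) sub[OF l(2,3)] by blast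
    qed
  qed (rule X)
  then have UX: "uniform_finiteness K X" using UF unfolding collection_uniform_finiteness_def by blast
  define QT :: "('a list \<times> 'a list) set" where "QT = {(l, l'). length l = k \<and> l' = l}"
  have eqT: "equiv (tuples k) QT" by (rule equivI) (auto simp: QT_def refl_on_def sym_def trans_def)
  \<comment> \<open>The parameters range over the home sort, the power of \<open>K\<close> modulo
    equality, whose elements are singletons.\<close>
  define T where "T = {{l} | l :: 'a list. length l = k}"
  have T: "eq_definable_set K T" unfolding eq_definable_set_def
  proof (intro exI conjI)
    show "definable_equiv K k QT"
    proof (rule definable_equivI[OF eqT])
      have "(map \<rho> [0..<k], map (\<lambda>i. \<rho> (k + i)) [0..<k]) \<in> QT \<longleftrightarrow>
          map (\<lambda>i. \<rho> (k + i)) [0..<k] = map (\<lambda>i. \<rho> i) [0..<k]" for \<rho> unfolding QT_def by simp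
      then show "dfn K [] (\<lambda>\<rho>. (map \<rho> [0..<k], map (\<lambda>i. \<rho> (k + i)) [0..<k]) \<in> QT)"
        by (simp only:) (rule dfn_map_eq)
    qed
    show "T \<subseteq> tuples k // QT" unfolding T_def quotient_def QT_def by auto
    have "dfn K [] (\<lambda>\<rho>. \<rho> 0 = \<rho> 0)" by (intro dfn_intros)
    moreover have "\<Union> T = tuples k" unfolding T_def by blast
    ultimately show "definable K k (\<Union> T)" by (intro dfn_imp_definable[of K "[]"]) auto
  qed
  define Y where "Y = {(cl (c # ts), {ts}) | c ts. length ts = k \<and> gl (c # ts)}"
  have YXT: "Y \<subseteq> X \<times> T" unfolding Y_def X_def T_def by fastforce
  have "eq_definable_rel2 K Y" unfolding eq_definable_rel2_def eq_definable_rel_def pullback_pairs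
  proof (intro exI, rule definable_appendI)
    have eq: "(gl (map \<rho> [0..<Suc k]) \<and> (\<exists>c. gl (c # map (\<lambda>i. \<rho> (Suc k + i)) [0..<k]) \<and>
        Hl (c # map (\<lambda>i. \<rho> (Suc k + i)) [0..<k]) = Hl (map \<rho> [0..<Suc k]))) \<longleftrightarrow>
      gd (\<lambda>i. \<rho> (Suc i)) (\<rho> 0) \<and> (\<exists>c. gd (\<lambda>i. \<rho> (Suc k + i)) c \<and>
        (\<forall>z. H (\<lambda>i. \<rho> (Suc k + i)) c z \<longleftrightarrow> H (\<lambda>i. \<rho> (Suc i)) (\<rho> 0) z))" for \<rho>
      unfolding gl glc Hlc set_eq_iff Hl mem_Collect_eq ..
    show "dfn K fs (\<lambda>\<rho>. gl (map \<rho> [0..<Suc k]) \<and> (\<exists>c. gl (c # map (\<lambda>i. \<rho> (Suc k + i)) [0..<k]) \<and>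
        Hl (c # map (\<lambda>i. \<rho> (Suc k + i)) [0..<k]) = Hl (map \<rho> [0..<Suc k])))"
      unfolding eq by (intro dfn_intros app)
    show "{xs @ ys | xs ys x y. (x, y) \<in> Y \<and> xs \<in> x \<and> ys \<in> y} = {xs @ ys | xs ys.
        length xs = Suc k \<and> length ys = k \<and> (gl xs \<and> (\<exists>c. gl (c # ys) \<and> Hl (c # ys) = Hl xs))}" (is "?A = ?B")
    proof (intro Set.set_eqI iffI)
      fix l assume "l \<in> ?A"
      then obtain xs ys c where *: "l = xs @ ys" "length ys = k" "gl (c # ys)" "xs \<in> cl (c # ys)"
        unfolding Y_def by blast
      moreover have "length (c # ys) = Suc k" using *(2) by simp
      ultimately show "l \<in> ?B" using cl[of "c # ys" xs] by blast
    next
      fix l assume "l \<in> ?B"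
      then obtain xs ys c where *: "l = xs @ ys" "length xs = Suc k" "length ys = k" "gl xs" "gl (c # ys)" "Hl (c # ys) = Hl xs"
        by blast
      then have "xs \<in> cl (c # ys)" using cl[of "c # ys" xs] by simp
      then show "l \<in> ?A" unfolding Y_def using *(1,3,5) by blast
    qed
  qed
  with UX T YXT have "\<exists>n. \<forall>t\<in>T. infinite {x. (x, t) \<in> Y} \<longleftrightarrow> infinite {x. (x, t) \<in> Y} \<or> n < card {x. (x, t) \<in> Y}"
    unfolding uniform_finiteness_def by blast
  then obtain N where N: "\<forall>t\<in>T. infinite {x. (x, t) \<in> Y} \<longleftrightarrow> infinite {x. (x, t) \<in> Y} \<or> N < card {x. (x, t) \<in> Y}"
    by (elim exE)
  show ?thesis
  proof (intro exI allI impI)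
    fix \<tau> assume fin: "finite {{z. H \<tau> c z} | c. gd \<tau> c}"
    define ts where "ts = map \<tau> [0..<k]"
    have ts: "length ts = k" unfolding ts_def by simp
    define B where "B = {x. (x, {ts}) \<in> Y}"
    have B: "B = {cl (c # ts) | c. gd \<tau> c}" unfolding B_def Y_def using ts glc[of _ \<tau>] unfolding ts_def[symmetric] by blast
    \<comment> \<open>Any representative of a code yields the coded set, so codes and sets are in
      bijection and the cardinality can be transferred.\<close>
    define hs where "hs x = Hl (SOME l. l \<in> x)" for x
    have hs: "hs (cl (c # ts)) = Hl (c # ts)" if c: "gd \<tau> c" for c
    proof -
      have g: "length (c # ts) = Suc k" "gl (c # ts)" using ts c glc[of c \<tau>] unfolding ts_def by simp_all
      then have "c # ts \<in> cl (c # ts)" using cl by blast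
      then have "(SOME l. l \<in> cl (c # ts)) \<in> cl (c # ts)" by (rule someI)
      then show ?thesis unfolding hs_def using cl[OF g] by blast
    qed
    have "inj_on hs B"
    proof (rule inj_onI)
      fix x y assume "x \<in> B" "y \<in> B" and eq: "hs x = hs y"
      then obtain c c' where c: "x = cl (c # ts)" "gd \<tau> c" "y = cl (c' # ts)" "gd \<tau> c'" unfolding B by blast
      then have "Hl (c # ts) = Hl (c' # ts)" using eq hs by simp
      then show "x = y" using cl_eq[of "c # ts" "c' # ts"] c ts glc[of _ \<tau>] unfolding ts_def by simp
    qed
    moreover have "hs ` B = {{z. H \<tau> c z} | c. gd \<tau> c}"
    proof -
      have "hs ` B = (\<lambda>c. hs (cl (c # ts))) ` {c. gd \<tau> c}" unfolding B by blast
      also have "\<dots> = (\<lambda>c. {z. H \<tau> c z}) ` {c. gd \<tau> c}"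
        by (rule image_cong[OF HOL.refl]) (use hs Hlc[of _ \<tau>] in \<open>simp add: ts_def\<close>)
      finally show ?thesis by blast
    qed
    ultimately have "finite B" "card B = card {{z. H \<tau> c z} | c. gd \<tau> c}"
      using fin finite_image_iff card_image by metis+
    moreover have "{ts} \<in> T" using ts unfolding T_def by blast
    ultimately show "card {{z. H \<tau> c z} | c. gd \<tau> c} \<le> N"
      using bspec[OF N, of "{ts}"] unfolding B_def[symmetric] by simp
  qed
qed

section \<open>Definable valuations\<close>

locale valued =
  fixes v :: "'a::linordered_field valuation"
  assumes valuation: "is_valuation v"
begin

abbreviation "G \<equiv> value_group v"
abbreviation "vle \<equiv> gle (value_group v)"

lemma oag: "ordered_abelian_group G"
  using valuation unfolding is_valuation_def by blast

sublocale G: comm_group G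
  using oag unfolding ordered_abelian_group_def by blast

lemma le_refl: "a \<in> carrier G \<Longrightarrow> vle a a"
  using oag unfolding ordered_abelian_group_def by blast

lemma le_antisym: "a \<in> carrier G \<Longrightarrow> b \<in> carrier G \<Longrightarrow> vle a b \<Longrightarrow> vle b a \<Longrightarrow> a = b"
  using oag unfolding ordered_abelian_group_def by blast

lemma le_trans: "a \<in> carrier G \<Longrightarrow> b \<in> carrier G \<Longrightarrow> c \<in> carrier G \<Longrightarrow> vle a b \<Longrightarrow> vle b c \<Longrightarrow> vle a c"
  using oag[unfolded ordered_abelian_group_def, THEN conjunct2, THEN conjunct2, THEN conjunct2, THEN conjunct1] by blast

lemma le_total: "a \<in> carrier G \<Longrightarrow> b \<in> carrier G \<Longrightarrow> vle a b \<or> vle b a"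
  using oag unfolding ordered_abelian_group_def by blast

lemma le_mult: "a \<in> carrier G \<Longrightarrow> b \<in> carrier G \<Longrightarrow> c \<in> carrier G \<Longrightarrow> vle a b \<Longrightarrow> vle (a \<otimes>\<^bsub>G\<^esub> c) (b \<otimes>\<^bsub>G\<^esub> c)"
  using oag[unfolded ordered_abelian_group_def, THEN conjunct2, THEN conjunct2, THEN conjunct2, THEN conjunct2, THEN conjunct2]
  by blast

lemmas valuation' = valuation[unfolded is_valuation_def, THEN conjunct2]

lemma val_image: "val v ` (- {0}) = carrier G"
  by (rule valuation'[THEN conjunct1])

lemma val_in: "x \<noteq> 0 \<Longrightarrow> val v x \<in> carrier G"
  using val_image by blast

lemma val_mult: "x \<noteq> 0 \<Longrightarrow> y \<noteq> 0 \<Longrightarrow> val v (x * y) = val v x \<otimes>\<^bsub>G\<^esub> val v y"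
  by (rule valuation'[THEN conjunct2, THEN conjunct1, rule_format]) simp

lemma val_add:
  "x \<noteq> 0 \<Longrightarrow> y \<noteq> 0 \<Longrightarrow> x + y \<noteq> 0 \<Longrightarrow> vle (val v x) (val v (x + y)) \<or> vle (val v y) (val v (x + y))"
  by (rule valuation'[THEN conjunct2, THEN conjunct2, rule_format]) simp

lemma val_one: "val v 1 = \<one>\<^bsub>G\<^esub>"
proof -
  have 1: "val v 1 \<in> carrier G" by (rule val_in) simp
  have "val v 1 \<otimes>\<^bsub>G\<^esub> val v 1 = val v 1" using val_mult[of 1 1] by simp
  then show ?thesis using G.l_cancel_one[OF 1 1] by simp
qed

lemma val_inverse:
  assumes "x \<noteq> 0" shows "val v (inverse x) = inv\<^bsub>G\<^esub> val v x"
proof -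
  have "val v (inverse x) \<otimes>\<^bsub>G\<^esub> val v x = \<one>\<^bsub>G\<^esub>"
    using val_mult[of "inverse x" x] val_one assms by simp
  then show ?thesis using G.inv_equality val_in assms by (metis inverse_nonzero_iff_nonzero)
qed

lemma le_val_iff:
  assumes "x \<noteq> 0" "y \<noteq> 0" shows "vle (val v x) (val v y) \<longleftrightarrow> y / x \<in> val_ring v"
proof -
  have nz: "y / x \<noteq> 0" "inverse x \<noteq> 0" using assms by auto
  have "y / x \<in> val_ring v \<longleftrightarrow> vle \<one>\<^bsub>G\<^esub> (val v (y / x))" using nz unfolding val_ring_def by simp
  also have "\<dots> \<longleftrightarrow> vle (val v x) (val v y)"
  proof
    assume "vle \<one>\<^bsub>G\<^esub> (val v (y / x))"
    then have "vle (\<one>\<^bsub>G\<^esub> \<otimes>\<^bsub>G\<^esub> val v x) (val v (y / x) \<otimes>\<^bsub>G\<^esub> val v x)"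
      by (intro le_mult val_in nz assms) simp_all
    then show "vle (val v x) (val v y)"
      using val_mult[OF nz(1) assms(1)] val_in[OF assms(1)] assms by simp
  next
    assume "vle (val v x) (val v y)"
    then have "vle (val v x \<otimes>\<^bsub>G\<^esub> val v (inverse x)) (val v y \<otimes>\<^bsub>G\<^esub> val v (inverse x))"
      by (intro le_mult val_in nz assms)
    then show "vle \<one>\<^bsub>G\<^esub> (val v (y / x))"
      using val_mult[OF assms(1) nz(2)] val_mult[OF assms(2) nz(2)] val_one assms by (simp add: divide_inverse)
  qed
  finally show ?thesis by blast
qed

lemma val_eq_iff:
  assumes "x \<noteq> 0" "y \<noteq> 0" shows "val v x = val v y \<longleftrightarrow> y / x \<in> val_ring v \<and> x / y \<in> val_ring v"
  using le_val_iff[OF assms] le_val_iff[OF assms(2,1)] le_refl[OF val_in[OF assms(1)]]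
    le_antisym[OF val_in[OF assms(1)] val_in[OF assms(2)]] by auto

lemma val_ring_one: "1 \<in> val_ring v"
  unfolding val_ring_def using val_one le_refl by simp

lemma val_ring_mult:
  assumes "x \<in> val_ring v" "y \<in> val_ring v" shows "x * y \<in> val_ring v"
proof (cases "x = 0 \<or> y = 0")
  case True then show ?thesis unfolding val_ring_def by auto
next
  case False
  then have nz: "x \<noteq> 0" "y \<noteq> 0" by auto
  then have "vle \<one>\<^bsub>G\<^esub> (val v x)" "vle \<one>\<^bsub>G\<^esub> (val v y)" using assms unfolding val_ring_def by auto
  then have "vle (\<one>\<^bsub>G\<^esub> \<otimes>\<^bsub>G\<^esub> val v y) (val v x \<otimes>\<^bsub>G\<^esub> val v y)" by (intro le_mult val_in nz) simp_all
  then have "vle (val v y) (val v (x * y))" using val_mult[OF nz] val_in[OF nz(2)] by simp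
  then have "vle \<one>\<^bsub>G\<^esub> (val v (x * y))"
    by (rule le_trans[rotated 4]) (use nz val_in \<open>vle \<one>\<^bsub>G\<^esub> (val v y)\<close> in auto)
  then show ?thesis unfolding val_ring_def by blast
qed

lemma val_ring_add:
  assumes "x \<in> val_ring v" "y \<in> val_ring v" shows "x + y \<in> val_ring v"
proof (cases "x = 0 \<or> y = 0 \<or> x + y = 0")
  case True
  then consider "x = 0" | "y = 0" | "x + y = 0" by blast
  then show ?thesis
  proof cases
    case 3 then show ?thesis unfolding val_ring_def by simp
  qed (use assms in simp_all)
next
  case False
  then have nz: "x \<noteq> 0" "y \<noteq> 0" "x + y \<noteq> 0" by auto
  then have "vle \<one>\<^bsub>G\<^esub> (val v x)" "vle \<one>\<^bsub>G\<^esub> (val v y)" using assms unfolding val_ring_def by auto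
  then have "vle \<one>\<^bsub>G\<^esub> (val v (x + y))"
    using val_add[OF nz] le_trans[OF G.one_closed val_in[OF nz(1)] val_in[OF nz(3)]]
      le_trans[OF G.one_closed val_in[OF nz(2)] val_in[OF nz(3)]] by blast
  then show ?thesis unfolding val_ring_def by blast
qed

lemma val_ring_minus:
  assumes "x \<in> val_ring v" shows "- x \<in> val_ring v"
proof -
  \<comment> \<open>By linearity of the order the ring contains \<open>- 1\<close> or its inverse,
    and these are equal.\<close>
  have "- 1 \<in> val_ring v \<or> inverse (- 1) \<in> val_ring v"
    using le_total[OF val_in[of 1] val_in[of "- 1"]] le_val_iff[of 1 "- 1"] le_val_iff[of "- 1" 1] by auto
  then have "- 1 \<in> val_ring v" by simp
  then show ?thesis using val_ring_mult[OF _ assms, of "- 1"] by simp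
qed

text \<open>The ideal is expressed through the ring alone, so that definability and convexity of the
  ring carry over to it.\<close>

lemma val_ideal: "x \<in> val_ideal v \<longleftrightarrow> x = 0 \<or> inverse x \<notin> val_ring v"
proof (cases "x = 0")
  case True then show ?thesis unfolding val_ideal_def val_ring_def by simp
next
  case False
  have i: "inverse x \<in> val_ring v \<longleftrightarrow> vle (val v x) \<one>\<^bsub>G\<^esub>"
    using le_val_iff[OF False, of 1] val_one by (simp add: divide_inverse)
  have x: "x \<in> val_ring v \<longleftrightarrow> vle \<one>\<^bsub>G\<^esub> (val v x)" unfolding val_ring_def using False by simp
  show ?thesis unfolding val_ideal_def mem_Collect_eq i x
    using le_total[OF G.one_closed val_in[OF False]] le_antisym[OF G.one_closed val_in[OF False]]
      le_refl[OF G.one_closed] False by auto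
qed

end

lemma convex_ring_ideal:
  assumes O': "convex_ring O'"
  defines "M \<equiv> {x. x = 0 \<or> inverse x \<notin> O'}"
  shows "x \<in> M \<Longrightarrow> \<bar>y\<bar> \<le> \<bar>x\<bar> \<Longrightarrow> y \<in> M" "x \<in> M \<Longrightarrow> y \<in> M \<Longrightarrow> x + y \<in> M" "x \<in> M \<Longrightarrow> - x \<in> M"
proof -
  note D = convex_ringD[OF O']
  show down: "y \<in> M" if "x \<in> M" "\<bar>y\<bar> \<le> \<bar>x\<bar>" for x y
  proof (cases "y = 0")
    case False
    then have x0: "x \<noteq> 0" using that(2) by auto
    have "\<bar>inverse x\<bar> \<le> \<bar>inverse y\<bar>" using that(2) False by (simp add: le_imp_inverse_le)
    then show ?thesis using that(1) x0 D(4)[of "inverse y" "inverse x"] unfolding M_def by auto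
  qed (simp add: M_def)
  show minus: "- x \<in> M" if "x \<in> M" for x by (rule down[OF that]) simp
  \<comment> \<open>The inverse of \<open>x\<close> is twice the inverse of \<open>x + x\<close>, so
    if the latter were in the ring, the former would be. Sums are then bounded by doubles.\<close>
  have two: "x + x \<in> M" if "x \<in> M" for x
  proof (cases "x = 0")
    case False
    have "inverse x \<in> O'" if "inverse (x + x) \<in> O'"
    proof -
      have "inverse (x + x) + inverse (x + x) = inverse x" using False by (simp add: field_simps)
      then show ?thesis using D(2)[OF that that] by simp
    qed
    then show ?thesis using that False unfolding M_def by auto
  qed (simp add: M_def)
  show "x + y \<in> M" if "x \<in> M" "y \<in> M" for x y
  proof (cases "\<bar>x\<bar> \<le> \<bar>y\<bar>")
    case True
    show ?thesis by (rule down[OF two[OF that(2)]]) (use True abs_triangle_ineq[of x y] in \<open>simp add: abs_mult\<close>)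
  next
    case False
    show ?thesis by (rule down[OF two[OF that(1)]]) (use False abs_triangle_ineq[of x y] in \<open>simp add: abs_mult\<close>)
  qed
qed

lemma finite_image_idx:
  assumes "idx E P n" "\<And>x y. x \<in> P \<Longrightarrow> y \<in> P \<Longrightarrow> E x y \<Longrightarrow> S x = S y" shows "finite (S ` P)"
proof -
  obtain f :: "'a \<Rightarrow> nat" where f: "\<forall>x\<in>P. f x < n" "\<forall>x\<in>P. \<forall>y\<in>P. f x = f y \<longrightarrow> E x y"
    using assms(1) unfolding idx_def by (elim exE conjE)
  have "\<forall>k\<in>f ` P. \<exists>r. r \<in> P \<and> f r = k" by blast
  from bchoice[OF this] obtain r where r: "\<forall>k\<in>f ` P. r k \<in> P \<and> f (r k) = k" by blast
  have "S ` P \<subseteq> (\<lambda>k. S (r k)) ` f ` P"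
  proof (rule image_subsetI)
    fix x assume x: "x \<in> P"
    then have "r (f x) \<in> P" "f (r (f x)) = f x" using r by blast+
    then have "S (r (f x)) = S x" using assms(2) f(2) x by blast
    then show "S x \<in> (\<lambda>k. S (r k)) ` f ` P" using x by (metis imageI)
  qed
  moreover have "f ` P \<subseteq> {..<n}" using f(1) by blast
  then have "finite (f ` P)" by (rule finite_subset) simp
  ultimately show ?thesis using finite_subset by blast
qed

context wom
begin

lemma definable_valuationD:
  assumes "definable_valuation K v"
  obtains n E fs where "definable_equiv K n E" "carrier (value_group v) \<subseteq> tuples n // E"
    "dfn K fs (\<lambda>\<rho>. \<rho> 0 \<noteq> 0 \<and> map (\<lambda>i. \<rho> (Suc i)) [0..<n] \<in> val v (\<rho> 0))"
    "dfn K fs (\<lambda>\<rho>. \<rho> 0 \<in> val_ring v)"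
proof -
  define G where "G = value_group v"
  have v: "is_valuation v" "eq_definable_set K (carrier G)"
    "eq_definable_rel K {[a, b] | a b. a \<in> carrier G \<and> b \<in> carrier G \<and> gle G a b}"
    "eq_definable_rel K {[{[x]}, val v x] | x. x \<noteq> 0}"
    using assms unfolding definable_valuation_def Let_def G_def by blast+
  interpret valued v by unfold_locales (rule v(1))
  obtain n E where E: "definable_equiv K n E" "carrier G \<subseteq> tuples n // E"
    using v(2) unfolding eq_definable_set_def by blast
  note Ee = definable_equivD(1)[OF E(1)]
  have len: "length ys = n" if "a \<in> carrier G" "ys \<in> a" for a ys
    using in_quotient_imp_subset[OF Ee, of a] E(2) that by blast
  have ne: "\<exists>ys. ys \<in> a" if "a \<in> carrier G" for a
    using in_quotient_imp_non_empty[OF Ee, of a] E(2) that by blast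
  have disj: "a = b" if "a \<in> carrier G" "b \<in> carrier G" "ys \<in> a" "ys \<in> b" for a b ys
    using quotient_disj[OF Ee, of a b] E(2) that by blast
  have vin: "val v x \<in> carrier G" if "x \<noteq> 0" for x using val_in[OF that] unfolding G_def .
  define S where "S = {[x] @ ys | x ys. x \<noteq> 0 \<and> ys \<in> val v x}"
  have S: "pullback {[{[x]}, val v x] | x. x \<noteq> 0} = S"
  proof -
    have "{[{[x]}, val v x] | x. x \<noteq> 0} = {[a, b] | a b. (a, b) \<in> {({[x]}, val v x) | x. x \<noteq> 0}}" by blast
    then show ?thesis unfolding S_def by (simp only: pullback_pairs) blast
  qed
  obtain k where k: "definable K k S" using v(4) unfolding eq_definable_rel_def S by blast
  \<comment> \<open>The arity of the definable graph is existential; the length of one sample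
    element identifies it.\<close>
  obtain ys where "ys \<in> val v 1" using ne vin[of 1] by auto
  then have "[1] @ ys \<in> S" unfolding S_def by force
  then have "length ([1] @ ys) = k" using k unfolding definable_def by blast
  moreover have "length ys = n" using len vin[of 1] \<open>ys \<in> val v 1\<close> by auto
  ultimately have kn: "k = Suc n" by simp
  obtain f1 where f1: "dfn K f1 (\<lambda>\<rho>. map \<rho> [0..<Suc n] \<in> S)" using definable_imp_dfn k unfolding kn by blast
  have "map \<rho> [0..<Suc n] \<in> S \<longleftrightarrow> \<rho> 0 \<noteq> 0 \<and> map (\<lambda>i. \<rho> (Suc i)) [0..<n] \<in> val v (\<rho> 0)" for \<rho> :: "nat \<Rightarrow> 'a"
    unfolding S_def by (simp add: map_upt_Suc del: upt_Suc)
  then have V: "dfn K f1 (\<lambda>\<rho>. \<rho> 0 \<noteq> 0 \<and> map (\<lambda>i. \<rho> (Suc i)) [0..<n] \<in> val v (\<rho> 0))" using f1 by (simp only:)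
  define L where "L = {xs @ ys | xs ys a b. (a \<in> carrier G \<and> b \<in> carrier G \<and> gle G a b) \<and> xs \<in> a \<and> ys \<in> b}"
  have L: "pullback {[a, b] | a b. a \<in> carrier G \<and> b \<in> carrier G \<and> gle G a b} = L"
  proof -
    have "{[a, b] | a b. a \<in> carrier G \<and> b \<in> carrier G \<and> gle G a b} =
      {[a, b] | a b. (a, b) \<in> {(a, b). a \<in> carrier G \<and> b \<in> carrier G \<and> gle G a b}}" by blast
    then show ?thesis unfolding L_def by (simp only: pullback_pairs) blast
  qed
  obtain k' where k': "definable K k' L" using v(3) unfolding eq_definable_rel_def L by blast
  have "ys @ ys \<in> L" unfolding L_def using vin[of 1] \<open>ys \<in> val v 1\<close> le_refl[of "val v 1"] unfolding G_def by auto
  then have "length (ys @ ys) = k'" using k' unfolding definable_def by blast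
  then have kn': "k' = n + n" using \<open>length ys = n\<close> by simp
  obtain f2 where f2: "dfn K f2 (\<lambda>\<rho>. map \<rho> [0..<n + n] \<in> L)" using definable_imp_dfn k' unfolding kn' by blast
  have Lap: "xs @ zs \<in> L \<longleftrightarrow> gle G a b" if "a \<in> carrier G" "b \<in> carrier G" "xs \<in> a" "zs \<in> b" for xs zs a b
  proof
    assume "xs @ zs \<in> L"
    then obtain xs' zs' a' b' where *: "xs @ zs = xs' @ zs'" "a' \<in> carrier G" "b' \<in> carrier G" "gle G a' b'" "xs' \<in> a'" "zs' \<in> b'"
      unfolding L_def by blast
    have "length xs = n" "length xs' = n" using len that(1,3) *(2,5) by blast+
    then have "xs' = xs" "zs' = zs" using *(1) by auto
    then have "a' = a" "b' = b" using disj that *(2,3,5,6) by blast+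
    then show "gle G a b" using *(4) by blast
  next
    assume "gle G a b" then show "xs @ zs \<in> L" unfolding L_def using that by blast
  qed
  define M where "M z ys \<longleftrightarrow> z \<noteq> 0 \<and> ys \<in> val v z" for z ys
  \<comment> \<open>The values of 1 and \<open>x\<close> are compared through representatives in
    \<open>K\<close>; 0 is added by hand, its value being arbitrary.\<close>
  have ring: "x \<in> val_ring v \<longleftrightarrow> x = 0 \<or> (\<exists>xs. length xs = n \<and> (\<exists>zs. length zs = n \<and> M 1 xs \<and> M x zs \<and> xs @ zs \<in> L))" for x
  proof (cases "x = 0")
    case True then show ?thesis unfolding val_ring_def by simp
  next
    case False
    obtain xs zs where xz: "xs \<in> val v 1" "zs \<in> val v x" using ne vin[of 1] vin[OF False] by (metis one_neq_zero)
    have "x \<in> val_ring v \<longleftrightarrow> gle G (val v 1) (val v x)" unfolding val_ring_def G_def using False val_one by simp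
    also have "\<dots> \<longleftrightarrow> (\<exists>xs. length xs = n \<and> (\<exists>zs. length zs = n \<and> M 1 xs \<and> M x zs \<and> xs @ zs \<in> L))"
    proof
      assume "gle G (val v 1) (val v x)"
      then have "xs @ zs \<in> L" using Lap[OF vin vin[OF False] xz] by simp
      moreover have "length xs = n" "length zs = n" using len vin[of 1] vin[OF False] xz by auto
      ultimately show "\<exists>xs. length xs = n \<and> (\<exists>zs. length zs = n \<and> M 1 xs \<and> M x zs \<and> xs @ zs \<in> L)"
        using xz False unfolding M_def by auto
    next
      assume "\<exists>xs. length xs = n \<and> (\<exists>zs. length zs = n \<and> M 1 xs \<and> M x zs \<and> xs @ zs \<in> L)"
      then obtain xs zs where "xs \<in> val v 1" "zs \<in> val v x" "xs @ zs \<in> L" unfolding M_def by blast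
      then show "gle G (val v 1) (val v x)" using Lap[OF vin[OF one_neq_zero] vin[OF False]] by blast
    qed
    finally show ?thesis using False by simp
  qed
  have M: "dfn K (f1 @ f2) (\<lambda>\<rho>. M (t \<rho>) (map (\<lambda>i. \<rho> (s i)) [0..<n]))" if t: "dterm K (f1 @ f2) t" for t s
  proof -
    have "dfn K (f1 @ f2) (\<lambda>\<rho>. \<rho> 0 \<noteq> 0 \<and> map (\<lambda>i. \<rho> (Suc i)) [0..<n] \<in> val v (\<rho> 0))" by (rule dfn_mono[OF V]) simp
    from dfn_subst[OF this, of "case_nat t (\<lambda>i \<rho>. \<rho> (s i))"]
    show ?thesis unfolding M_def using dterm_case_nat[OF t dterm_var, of s] by simp
  qed
  have Ld: "dfn K (f1 @ f2) (\<lambda>\<rho>. map (\<lambda>i. \<rho> (s i)) [0..<n] @ map (\<lambda>i. \<rho> (t i)) [0..<n] \<in> L)" for s t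
  proof -
    have "dfn K (f1 @ f2) (\<lambda>\<rho>. map (\<lambda>i. \<rho> (if i < n then s i else t (i - n))) [0..<n + n] \<in> L)"
      by (rule dfn_reindex[OF f2]) simp
    moreover have "map (\<lambda>i. \<rho> (if i < n then s i else t (i - n))) [0..<n + n] =
        map (\<lambda>i. \<rho> (s i)) [0..<n] @ map (\<lambda>i. \<rho> (t i)) [0..<n]" for \<rho> :: "nat \<Rightarrow> 'a"
      by (rule nth_equalityI) (auto simp: nth_append)
    ultimately show ?thesis by (simp only:)
  qed
  have "dfn K (f1 @ f2) (\<lambda>\<rho>. \<rho> 0 \<in> val_ring v)" unfolding ring
    by (intro dfn_intros M Ld)
  moreover have "dfn K (f1 @ f2) (\<lambda>\<rho>. \<rho> 0 \<noteq> 0 \<and> map (\<lambda>i. \<rho> (Suc i)) [0..<n] \<in> val v (\<rho> 0))"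
    by (rule dfn_mono[OF V]) simp
  ultimately show thesis using that[OF E(1) E(2)[unfolded G_def]] by blast
qed

text \<open>The valuation ring is a definable additive subgroup, so weak o-minimality makes it
  convex; closure under negation reduces the claim to absolute values.\<close>

lemma val_ring_convex:
  assumes v: "definable_valuation K v" shows "convex_ring (val_ring v)"
proof -
  obtain fs where O': "dfn K fs (\<lambda>\<rho>. \<rho> 0 \<in> val_ring v)" using definable_valuationD[OF v] by blast
  interpret valued v by unfold_locales (use v in \<open>simp add: definable_valuation_def\<close>)
  have "y \<in> val_ring v" if xy: "x \<in> val_ring v" "\<bar>y\<bar> \<le> \<bar>x\<bar>" for x y
  proof -
    have "\<bar>x\<bar> \<in> val_ring v" using xy(1) val_ring_minus by (simp add: abs_if)
    then have "\<bar>y\<bar> \<in> val_ring v"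
    proof (rule definable_subgroup_convex[where D = "\<lambda>x. x \<in> val_ring v", OF O', rotated 3])
      show "0 \<in> val_ring v" unfolding val_ring_def by simp
      show "a - b \<in> val_ring v" if "a \<in> val_ring v" "b \<in> val_ring v" for a b
        using val_ring_add[OF that(1) val_ring_minus[OF that(2)]] by simp
    qed (use xy val_ring_add in auto)
    then show ?thesis using val_ring_minus[of "\<bar>y\<bar>"] by (cases "0 \<le> y") auto
  qed
  then show ?thesis unfolding convex_ring_def using val_ring_one val_ring_add val_ring_mult by blast
qed

end

section \<open>Convex subgroups of the value group\<close>

definition mbelow :: "('a::linordered_field \<Rightarrow> 'a \<Rightarrow> bool) \<Rightarrow> 'a \<Rightarrow> 'a \<Rightarrow> bool" where
  "mbelow E c w \<longleftrightarrow> 1 \<le> w \<and> w < c \<and> \<not> E w c"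

text \<open>\<open>mbelow\<close> only has elements that are at least 1. Allowing signs and inverses
  gives a subgroup of the whole multiplicative group, whose image under the valuation is a convex
  subgroup of the value group.\<close>

definition msubgroup :: "('a::linordered_field \<Rightarrow> 'a \<Rightarrow> bool) \<Rightarrow> 'a \<Rightarrow> 'a \<Rightarrow> bool" where
  "msubgroup E c z \<longleftrightarrow> z \<noteq> 0 \<and> (\<exists>w. mbelow E c w \<and> \<bar>z\<bar> \<le> w \<and> \<bar>inverse z\<bar> \<le> w)"

locale val_equiv =
  fixes O' :: "'a::linordered_field set" and E
  assumes good: "val_good O' E"
begin

sublocale convex_equiv "{1..}" E
  by unfold_locales (use good in \<open>unfold val_good_def, blast\<close>)

lemma square: "1 \<le> x \<Longrightarrow> E x (x * x)"
  using good[unfolded val_good_def, THEN conjunct2, THEN conjunct1, rule_format] .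

lemma unit: "1 \<le> u \<Longrightarrow> u \<in> O' \<Longrightarrow> E 1 u"
  using good[unfolded val_good_def, THEN conjunct2, THEN conjunct2, rule_format] .

lemma mbelow_down: "mbelow E c z \<Longrightarrow> 1 \<le> y \<Longrightarrow> y \<le> z \<Longrightarrow> mbelow E c y"
  unfolding mbelow_def using conv2[of y z c] by auto

lemma mbelow_mult:
  assumes "mbelow E c x" "mbelow E c y" shows "mbelow E c (x * y)"
proof -
  have *: "mbelow E c (m * m)" if m: "mbelow E c m" for m
  proof -
    have m': "1 \<le> m" "m < c" "\<not> E m c" using m unfolding mbelow_def by blast+
    have "m \<le> m * m" using m'(1) mult_left_mono[of 1 m m] by simp
    then have mm: "1 \<le> m * m" "m \<le> m * m" using order_trans[OF m'(1)] by blast+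
    have E: "E m (m * m)" by (rule square[OF m'(1)])
    have in1: "m \<in> {1..}" "m * m \<in> {1..}" "c \<in> {1..}"
      unfolding atLeast_iff by (rule m'(1), rule mm(1), rule order_trans[OF m'(1) less_imp_le[OF m'(2)]])
    have "m * m < c"
    proof (rule ccontr)
      assume "\<not> m * m < c"
      then have "E m c" using conv[OF in1(1,3,2) less_imp_le[OF m'(2)] _ E] by simp
      then show False using m'(3) by blast
    qed
    moreover have "\<not> E (m * m) c" using trans[OF in1(1,2,3) E] m'(3) by blast
    ultimately show ?thesis unfolding mbelow_def using mm(1) by blast
  qed
  have m: "mbelow E c (max x y)" using assms by (simp add: max_def)
  have xy: "1 \<le> x" "1 \<le> y" using assms unfolding mbelow_def by blast+
  have "1 \<le> x * y" using mult_mono[of 1 x 1 y] xy by auto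
  moreover have "x * y \<le> max x y * max x y" using xy by (intro mult_mono) auto
  ultimately show ?thesis by (rule mbelow_down[OF *[OF m]])
qed

lemma mbelow_unit:
  assumes "1 \<le> c" "\<not> E 1 c" "1 \<le> u" "u \<in> O'" shows "mbelow E c u"
proof -
  have u: "E 1 u" by (rule unit[OF assms(3,4)])
  have "\<not> c \<le> u" using conv[of 1 c u] u assms by auto
  then have "u < c" by simp
  moreover have "\<not> E u c" using trans[of 1 u c] u assms by auto
  ultimately show ?thesis unfolding mbelow_def using assms(3) by blast
qed

lemma mbelow_cong:
  assumes "1 \<le> c" "1 \<le> c'" "E c c'" "mbelow E c w" shows "mbelow E c' w"
proof -
  have w: "1 \<le> w" "w < c" "\<not> E w c" using assms(4) unfolding mbelow_def by blast+
  have in1: "w \<in> {1..}" "c \<in> {1..}" "c' \<in> {1..}" using w assms by auto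
  have "w < c'" by (rule less_class[OF in1(1,1,2,3) w(2,3) refl[OF in1(1)] assms(3)])
  moreover have "\<not> E w c'" using trans[OF in1(1,3,2) _ sym[OF in1(2,3) assms(3)]] w(3) by blast
  ultimately show ?thesis unfolding mbelow_def using w(1) by blast
qed

text \<open>The quotient conditions say that the value of \<open>y\<close> is between those of
  \<open>z\<close> and \<open>z'\<close>. Then \<open>y\<close> is bounded by \<open>z\<close>, and
  its inverse by that of \<open>z'\<close>, up to factors from the ring, which lie in the subgroup.
  With \<open>z = z'\<close> this is invariance under units, and in general it is convexity of the
  image.\<close>

lemma msubgroup_scale:
  assumes ring: "convex_ring O'" and c: "1 \<le> c" "\<not> E 1 c"
    and z: "msubgroup E c z" "msubgroup E c z'" and y: "y \<noteq> 0" "y / z \<in> O'" "z' / y \<in> O'"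
  shows "msubgroup E c y"
proof -
  obtain w where w: "z \<noteq> 0" "mbelow E c w" "\<bar>z\<bar> \<le> w" using z(1) unfolding msubgroup_def by blast
  obtain w' where w': "z' \<noteq> 0" "mbelow E c w'" "\<bar>inverse z'\<bar> \<le> w'" using z(2) unfolding msubgroup_def by blast
  \<comment> \<open>The maximum with 1 keeps the factor in the ring and makes it an element to which
    \<open>mbelow_unit\<close> applies.\<close>
  define u where "u = max 1 \<bar>y / z\<bar>"
  define u' where "u' = max 1 \<bar>z' / y\<bar>"
  note D = convex_ringD[OF ring]
  have "u \<in> O'" using D(1) D(4)[OF y(2), of "\<bar>y / z\<bar>"] unfolding u_def by (simp add: max_def)
  then have u: "mbelow E c u" by (intro mbelow_unit c) (simp_all add: u_def)
  have "u' \<in> O'" using D(1) D(4)[OF y(3), of "\<bar>z' / y\<bar>"] unfolding u'_def by (simp add: max_def)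
  then have u': "mbelow E c u'" by (intro mbelow_unit c) (simp_all add: u'_def)
  have wu: "mbelow E c (w * u)" "mbelow E c (w' * u')" by (rule mbelow_mult[OF w(2) u], rule mbelow_mult[OF w'(2) u'])
  have ge1: "1 \<le> w * u" "1 \<le> w' * u'" using wu unfolding mbelow_def by blast+
  have "\<bar>y\<bar> = \<bar>z\<bar> * \<bar>y / z\<bar>" using w(1) by (simp add: abs_divide)
  also have "\<dots> \<le> w * u" using w(3) unfolding u_def by (intro mult_mono) auto
  also have "\<dots> \<le> (w * u) * (w' * u')" using mult_left_mono[OF ge1(2), of "w * u"] ge1(1) by simp
  finally have 1: "\<bar>y\<bar> \<le> (w * u) * (w' * u')" .
  have "inverse y = inverse z' * (z' / y)" using w'(1) y(1) by (simp add: divide_inverse)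
  then have "\<bar>inverse y\<bar> = \<bar>inverse z'\<bar> * \<bar>z' / y\<bar>" by (simp only: abs_mult[symmetric])
  also have "\<dots> \<le> w' * u'"
    by (rule mult_mono) (use w'(3) order_trans[OF abs_ge_zero w'(3)] in \<open>simp_all add: u'_def\<close>)
  also have "\<dots> \<le> (w * u) * (w' * u')" using mult_right_mono[OF ge1(1), of "w' * u'"] ge1(2) by simp
  finally have 2: "\<bar>inverse y\<bar> \<le> (w * u) * (w' * u')" .
  show ?thesis unfolding msubgroup_def using y(1) mbelow_mult[OF wu] 1 2 by blast
qed

lemma msubgroup_one: "1 \<le> c \<Longrightarrow> \<not> E 1 c \<Longrightarrow> msubgroup E c 1"
proof -
  assume c: "1 \<le> c" "\<not> E 1 c"
  then have "c \<noteq> 1" using refl[of 1] by auto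
  then have "mbelow E c 1" unfolding mbelow_def using c by simp
  then show ?thesis unfolding msubgroup_def by auto
qed

lemma msubgroup_mult:
  assumes "msubgroup E c x" "msubgroup E c y" shows "msubgroup E c (x * y)"
proof -
  obtain w where w: "x \<noteq> 0" "mbelow E c w" "\<bar>x\<bar> \<le> w" "\<bar>inverse x\<bar> \<le> w" using assms(1) unfolding msubgroup_def by blast
  obtain w' where w': "y \<noteq> 0" "mbelow E c w'" "\<bar>y\<bar> \<le> w'" "\<bar>inverse y\<bar> \<le> w'" using assms(2) unfolding msubgroup_def by blast
  have "0 \<le> w" "0 \<le> w'" using w(3) w'(3) by (meson abs_ge_zero order_trans)+
  then have "\<bar>x * y\<bar> \<le> w * w'" "\<bar>inverse (x * y)\<bar> \<le> w * w'"
    using w w' mult_mono[of "\<bar>x\<bar>" w "\<bar>y\<bar>" w'] mult_mono[of "\<bar>inverse x\<bar>" w "\<bar>inverse y\<bar>" w'] by (simp_all add: abs_mult)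
  then show ?thesis unfolding msubgroup_def using w(1) w'(1) mbelow_mult[OF w(2) w'(2)] by auto
qed

lemma msubgroup_det:
  assumes "1 \<le> c" "1 \<le> c'" "{z. msubgroup E c z} = {z. msubgroup E c' z}" shows "E c c'"
proof -
  have *: False if "1 \<le> a" "a < b" "\<not> E a b" "{z. msubgroup E a z} = {z. msubgroup E b z}" for a b
  proof -
    have "\<bar>inverse a\<bar> \<le> a" using that(1) by (auto intro: order_trans[of _ 1] simp: inverse_le_1_iff)
    then have "msubgroup E b a" unfolding msubgroup_def mbelow_def using that(1-3) by (intro conjI exI[of _ a]) auto
    then have "msubgroup E a a" using that(4) by blast
    then show False unfolding msubgroup_def mbelow_def by auto
  qed
  have in1: "c \<in> {1..}" "c' \<in> {1..}" using assms by auto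
  consider "c < c'" | "c = c'" | "c' < c" by force
  then show ?thesis
  proof cases
    case 1 then show ?thesis using *[OF assms(1) 1] assms(3) by blast
  next
    case 2 then show ?thesis using refl[OF in1(1)] by simp
  next
    case 3 then show ?thesis using *[OF assms(2) 3] assms(3) sym[OF in1(2,1)] by blast
  qed
qed

end

context wom
begin

lemma val_bounded:
  assumes v: "definable_valuation K v" and UF: "value_group_uniform_finiteness K v"
  shows "unif_bounded K {1..} (val_good (val_ring v))"
  unfolding unif_bounded_def
proof (intro allI impI)
  fix es and E :: "(nat \<Rightarrow> 'a) \<Rightarrow> 'a \<Rightarrow> 'a \<Rightarrow> bool" assume E0: "dfn2 K es E"
  interpret v: valued v by unfold_locales (use v in \<open>simp add: definable_valuation_def\<close>)
  define O' where "O' = val_ring v"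
  have ring: "convex_ring O'" unfolding O'_def by (rule val_ring_convex[OF v])
  obtain n QD fs where QD: "definable_equiv K n QD" "carrier (value_group v) \<subseteq> tuples n // QD"
    and V0: "dfn K fs (\<lambda>\<rho>. \<rho> 0 \<noteq> 0 \<and> map (\<lambda>i. \<rho> (Suc i)) [0..<n] \<in> val v (\<rho> 0))"
    and O0: "dfn K fs (\<lambda>\<rho>. \<rho> 0 \<in> val_ring v)" by (rule definable_valuationD[OF v])
  have E: "dfn2 K (es @ fs) E" by (rule dfn_mono[OF E0]) simp
  have V: "dfn K (es @ fs) (\<lambda>\<rho>. \<rho> 0 \<in> - {0} \<and> map (\<lambda>i. \<rho> (Suc i)) [0..<n] \<in> val v (\<rho> 0))"
    using dfn_mono[OF V0, of "es @ fs"] by simp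
  have Od: "dfn K (es @ fs) (\<lambda>\<rho>. \<rho> 0 \<in> O')" unfolding O'_def by (rule dfn_mono[OF O0]) simp
  \<comment> \<open>For \<open>c\<close> in the class of 1 nothing is below \<open>c\<close>, not
    even 1, so no subgroup arises; these \<open>c\<close> are excluded here.\<close>
  define gd where "gd \<tau> c \<longleftrightarrow> val_good O' (E \<tau>) \<and> 1 \<le> c \<and> \<not> E \<tau> 1 c" for \<tau> c
  define H where "H \<tau> c = msubgroup (E \<tau>) c" for \<tau> c
  have "\<exists>N. \<forall>\<tau>. finite {{z. H \<tau> c z} | c. gd \<tau> c} \<longrightarrow> card {{z. H \<tau> c z} | c. gd \<tau> c} \<le> N"
  proof (rule collection_bounded[where r = "val v" and Z = "- {0}" and H = H and gd = gd])
    show "collection_uniform_finiteness K (carrier (value_group v))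
        {S. eq_definable_set K S \<and> convex_subgroup S (value_group v)}"
      using UF unfolding value_group_uniform_finiteness_def definable_convex_subgroups_def .
    show "definable_equiv K n QD" "carrier (value_group v) \<subseteq> tuples n // QD" by (rule QD)+
    show "val v ` (- {0}) \<subseteq> carrier (value_group v)" using v.val_image by simp
    show "dfn K (es @ fs) (\<lambda>\<rho>. \<rho> 0 \<in> - {0} \<and> map (\<lambda>i. \<rho> (Suc i)) [0..<n] \<in> val v (\<rho> 0))" by (rule V)
    show "dfn2 K (es @ fs) H" unfolding H_def msubgroup_def mbelow_def
      by (intro dfn_intros dfn_app2[where E = E, OF E])
    show "dfn K (es @ fs) (\<lambda>\<rho>. gd (\<lambda>i. \<rho> (Suc i)) (\<rho> 0))"
      unfolding gd_def val_good_def cequiv_def Ball_def atLeast_iff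
      by (intro dfn_intros dfn_app2[where E = E, OF E] dfn_unop[where D = "\<lambda>x. x \<in> O'", OF Od])
    fix \<tau> c assume gd: "gd \<tau> c"
    then interpret val_equiv O' "E \<tau>" by unfold_locales (simp add: gd_def)
    have c: "1 \<le> c" "\<not> E \<tau> 1 c" using gd unfolding gd_def by blast+
    show "z \<in> - {0}" if "H \<tau> c z" for z using that unfolding H_def msubgroup_def by blast
    note scale = msubgroup_scale[OF ring c]
    show "H \<tau> c z'" if z: "H \<tau> c z" "z' \<in> - {0}" "val v z' = val v z" for z z'
    proof -
      have nz: "z \<noteq> 0" "z' \<noteq> 0" using z unfolding H_def msubgroup_def by auto
      then have "z / z' \<in> O'" "z' / z \<in> O'" using v.val_eq_iff[OF nz(2,1)] z(3) unfolding O'_def by blast+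
      then show ?thesis using scale[of z z z'] z(1) nz unfolding H_def by blast
    qed
    show "convex_subgroup (val v ` {z. H \<tau> c z}) (value_group v)"
      unfolding convex_subgroup_def
    proof (intro conjI ballI impI)
      have nz: "z \<noteq> 0" if "H \<tau> c z" for z using that unfolding H_def msubgroup_def by blast
      show "subgroup (val v ` {z. H \<tau> c z}) (value_group v)"
      proof
        show "val v ` {z. H \<tau> c z} \<subseteq> carrier (value_group v)" using v.val_in nz by blast
        show "\<one>\<^bsub>value_group v\<^esub> \<in> val v ` {z. H \<tau> c z}"
          using msubgroup_one[OF c] v.val_one unfolding H_def by (metis (mono_tags) imageI mem_Collect_eq)
      next
        fix a b assume "a \<in> val v ` {z. H \<tau> c z}" "b \<in> val v ` {z. H \<tau> c z}"
        then obtain x y where xy: "H \<tau> c x" "H \<tau> c y" "a = val v x" "b = val v y" by blast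
        have "a \<otimes>\<^bsub>value_group v\<^esub> b = val v (x * y)" unfolding xy(3,4) using v.val_mult[OF nz[OF xy(1)] nz[OF xy(2)]] by simp
        moreover have "H \<tau> c (x * y)" using msubgroup_mult xy unfolding H_def by blast
        ultimately show "a \<otimes>\<^bsub>value_group v\<^esub> b \<in> val v ` {z. H \<tau> c z}" by blast
      next
        fix a assume "a \<in> val v ` {z. H \<tau> c z}"
        then obtain x where x: "H \<tau> c x" "a = val v x" by blast
        have "H \<tau> c (inverse x)" using x(1) unfolding H_def msubgroup_def by auto
        then show "inv\<^bsub>value_group v\<^esub> a \<in> val v ` {z. H \<tau> c z}"
          unfolding x(2) v.val_inverse[OF nz[OF x(1)], symmetric] by blast
      qed
      fix a b d assume "a \<in> val v ` {z. H \<tau> c z}" "b \<in> val v ` {z. H \<tau> c z}" "d \<in> carrier (value_group v)"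
        and le: "gle (value_group v) a d \<and> gle (value_group v) d b"
      then obtain x z y where x: "H \<tau> c x" "a = val v x" and z: "H \<tau> c z" "b = val v z" and y: "y \<noteq> 0" "d = val v y"
        using v.val_image by (metis (no_types, lifting) ComplD imageE mem_Collect_eq singletonI)
      have "y / x \<in> O'" "z / y \<in> O'" using le v.le_val_iff[OF nz[OF x(1)] y(1)] v.le_val_iff[OF y(1) nz[OF z(1)]]
        unfolding x(2) y(2) z(2) O'_def by blast+
      then have "H \<tau> c y" using scale[of x z y] x(1) z(1) y(1) unfolding H_def by blast
      then show "d \<in> val v ` {z. H \<tau> c z}" unfolding y(2) by blast
    qed
  qed
  then obtain N where N: "\<And>\<tau>. finite {{z. H \<tau> c z} | c. gd \<tau> c} \<Longrightarrow> card {{z. H \<tau> c z} | c. gd \<tau> c} \<le> N"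
    by blast
  have "idx (E \<tau>) {1..} (Suc N)" if g: "val_good (val_ring v) (E \<tau>)" and n: "idx (E \<tau>) {1..} m" for \<tau> m
  proof -
    interpret val_equiv O' "E \<tau>" by unfold_locales (use g in \<open>simp add: O'_def\<close>)
    define S where "S c = {z. H \<tau> c z}" for c
    define A where "A = {{z. H \<tau> c z} | c. gd \<tau> c}"
    have "S x = S y" if "x \<in> {1..}" "y \<in> {1..}" "E \<tau> x y" for x y
      using mbelow_cong[of x y] mbelow_cong[of y x] sym[OF that] that unfolding S_def H_def msubgroup_def by auto
    then have fin: "finite (S ` {1..})" by (rule finite_image_idx[OF n])
    have "A \<subseteq> S ` {1..}" unfolding A_def S_def gd_def by auto
    then have finA: "finite A" by (rule finite_subset[OF _ fin])
    then have cA: "card A \<le> N" using N[of \<tau>] unfolding A_def by blast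
    show ?thesis
    \<comment> \<open>The empty set stands for the excluded class of 1 and accounts for
      \<open>Suc N\<close>.\<close>
    proof (rule idxI[where f = S and A = "insert {} A"])
      show "card (insert {} A) \<le> Suc N" using cA card_insert_le_m1[of "Suc N" A "{}"] by simp
      show "S ` {1..} \<subseteq> insert {} A"
      proof (rule image_subsetI)
        fix c :: 'a assume c: "c \<in> {1..}"
        show "S c \<in> insert {} A"
        proof (cases "E \<tau> 1 c")
          case True
          have "\<not> mbelow (E \<tau>) c w" for w unfolding mbelow_def using conv2[of 1 w c] True by auto
          then show ?thesis unfolding S_def H_def msubgroup_def by simp
        next
          case False
          then have "gd \<tau> c" using g c unfolding gd_def O'_def by auto
          then show ?thesis unfolding A_def S_def by blast
        qed
      qed
      show "E \<tau> x y" if "x \<in> {1..}" "y \<in> {1..}" "S x = S y" for x y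
        using msubgroup_det[of x y] that unfolding S_def H_def by simp
    qed (use finA in simp)
  qed
  then show "\<exists>N. \<forall>\<tau> n. val_good (val_ring v) (E \<tau>) \<longrightarrow> idx (E \<tau>) {1..} n \<longrightarrow> idx (E \<tau>) {1..} N" by blast
qed

section \<open>Convex subgroups of the residue field\<close>

lemma res_bounded:
  assumes v: "definable_valuation K v" and UF: "residue_field_uniform_finiteness K v"
  shows "unif_bounded K {0..} (res_good (val_ring v))"
  unfolding unif_bounded_def
proof (intro allI impI)
  fix es and E :: "(nat \<Rightarrow> 'a) \<Rightarrow> 'a \<Rightarrow> 'a \<Rightarrow> bool" assume E0: "dfn2 K es E"
  interpret v: valued v by unfold_locales (use v in \<open>simp add: definable_valuation_def\<close>)
  define O' where "O' = val_ring v"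
  have ring: "convex_ring O'" unfolding O'_def by (rule val_ring_convex[OF v])
  define M where "M = val_ideal v"
  have M_eq: "M = {x. x = 0 \<or> inverse x \<notin> O'}" unfolding M_def O'_def using v.val_ideal by blast
  note MD = convex_ring_ideal[OF ring, folded M_eq]
  note D = convex_ringD[OF ring]
  have M0: "0 \<in> M" unfolding M_eq by simp
  have Mdiff: "x - y \<in> M" if "x \<in> M" "y \<in> M" for x y using MD(2)[OF that(1) MD(3)[OF that(2)]] by simp
  define r where "r = residue_class v"
  define G where "G = residue_add_group v"
  have r: "[y] \<in> r x \<longleftrightarrow> y - x \<in> M" for x y unfolding r_def residue_class_def M_def by simp
  have r_list: "l \<in> r x \<Longrightarrow> \<exists>y. l = [y]" for l x unfolding r_def residue_class_def by blast
  have r_eq: "r x = r y \<longleftrightarrow> x - y \<in> M" for x y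
  proof
    assume "r x = r y" then have "[x] \<in> r y" using r[of x x] M0 by simp
    then show "x - y \<in> M" using r by blast
  next
    assume xy: "x - y \<in> M"
    have "z - x \<in> M \<longleftrightarrow> z - y \<in> M" for z
      using MD(2)[OF _ xy, of "z - x"] Mdiff[OF _ xy, of "z - y"] by auto
    then show "r x = r y" unfolding r_def residue_class_def M_def[symmetric] by auto
  qed
  have carrier: "carrier G = r ` O'" and one: "\<one>\<^bsub>G\<^esub> = r 0"
    and gle: "gle G P Q \<longleftrightarrow> (\<exists>x y. [x] \<in> P \<and> [y] \<in> Q \<and> x \<le> y)" for P Q
    unfolding G_def residue_add_group_def r_def O'_def by simp_all
  have mult_def: "P \<otimes>\<^bsub>G\<^esub> Q = {[x + y] | x y. [x] \<in> P \<and> [y] \<in> Q}" for P Q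
    unfolding G_def residue_add_group_def by simp
  have mult: "r x \<otimes>\<^bsub>G\<^esub> r y = r (x + y)" for x y
  proof (intro Set.set_eqI iffI)
    fix l assume "l \<in> r x \<otimes>\<^bsub>G\<^esub> r y"
    then obtain a b where ab: "l = [a + b]" "a - x \<in> M" "b - y \<in> M" unfolding mult_def using r by blast
    have "(a - x) + (b - y) \<in> M" by (rule MD(2)[OF ab(2,3)])
    then show "l \<in> r (x + y)" unfolding ab(1) r by (simp add: algebra_simps)
  next
    fix l assume l: "l \<in> r (x + y)"
    then obtain z where z: "l = [z]" using r_list by blast
    have "[z - y] \<in> r x" "[y] \<in> r y" using l M0 unfolding z r by (simp_all add: algebra_simps)
    moreover have "l = [(z - y) + y]" using z by simp
    ultimately show "l \<in> r x \<otimes>\<^bsub>G\<^esub> r y" unfolding mult_def by blast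
  qed
  have minus: "- x \<in> O'" if "x \<in> O'" for x using D(4)[OF that, of "- x"] by simp
  have zero: "0 \<in> O'" using D(4)[OF D(1), of 0] by simp
  have "group G"
  proof (rule groupI)
    fix x y z assume "x \<in> carrier G" "y \<in> carrier G" "z \<in> carrier G"
    then show "x \<otimes>\<^bsub>G\<^esub> y \<otimes>\<^bsub>G\<^esub> z = x \<otimes>\<^bsub>G\<^esub> (y \<otimes>\<^bsub>G\<^esub> z)" unfolding carrier by (auto simp: mult add.assoc)
  next
    fix x assume "x \<in> carrier G"
    then obtain a where a: "a \<in> O'" "x = r a" unfolding carrier by blast
    then have "r (- a) \<otimes>\<^bsub>G\<^esub> x = \<one>\<^bsub>G\<^esub>" unfolding one by (simp add: mult)
    then show "\<exists>y\<in>carrier G. y \<otimes>\<^bsub>G\<^esub> x = \<one>\<^bsub>G\<^esub>" unfolding carrier using minus[OF a(1)] by blast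
  qed (use zero D(2) in \<open>auto simp: carrier one mult\<close>)
  then interpret G: group G .
  obtain fs where O0: "dfn K fs (\<lambda>\<rho>. \<rho> 0 \<in> val_ring v)" using definable_valuationD[OF v] by blast
  have E: "dfn2 K (es @ fs) E" by (rule dfn_mono[OF E0]) simp
  have Od: "dfn K (es @ fs) (\<lambda>\<rho>. \<rho> 0 \<in> O')" unfolding O'_def by (rule dfn_mono[OF O0]) simp
  note O_app = dfn_unop[where D = "\<lambda>x. x \<in> O'", OF Od]
  define QD where "QD = {([x], [y]) | x y. x - y \<in> M}"
  have eqD: "equiv (tuples 1) QD"
  proof (rule equivI)
    show "QD \<subseteq> tuples 1 \<times> tuples 1" unfolding QD_def by auto
    show "refl_on (tuples 1) QD" unfolding refl_on_def QD_def using M0 by (auto simp: length_Suc_conv)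
    show "sym QD" unfolding sym_def QD_def using MD(3) by (auto simp: algebra_simps) (metis minus_diff_eq)
    show "trans QD"
    proof (rule transI)
      fix a b c assume "(a, b) \<in> QD" "(b, c) \<in> QD"
      then obtain x y z where "a = [x]" "c = [z]" "x - y \<in> M" "y - z \<in> M" unfolding QD_def by auto
      then show "(a, c) \<in> QD" unfolding QD_def using MD(2)[of "x - y" "y - z"] by auto
    qed
  qed
  have dD: "definable_equiv K 1 QD"
  proof (rule definable_equivI[OF eqD])
    have "(map \<rho> [0..<1], map (\<lambda>i. \<rho> (1 + i)) [0..<1]) \<in> QD \<longleftrightarrow>
        \<rho> 0 - \<rho> (Suc 0) = 0 \<or> inverse (\<rho> 0 - \<rho> (Suc 0)) \<notin> O'" for \<rho> unfolding QD_def M_eq by simp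
    then show "dfn K (es @ fs) (\<lambda>\<rho>. (map \<rho> [0..<1], map (\<lambda>i. \<rho> (1 + i)) [0..<1]) \<in> QD)"
      by (simp only:) (intro dfn_intros O_app)
  qed
  \<comment> \<open>The class of 0 is excluded because nothing is below its elements. Every other
    \<open>c\<close> is above the whole maximal ideal, so its subgroup is a union of residue
    classes.\<close>
  define gd where "gd \<tau> c \<longleftrightarrow> res_good O' (E \<tau>) \<and> 0 \<le> c \<and> \<not> E \<tau> 0 c" for \<tau> c
  define H where "H \<tau> c z \<longleftrightarrow> below (E \<tau>) c \<bar>z\<bar>" for \<tau> c z
  have "\<exists>N. \<forall>\<tau>. finite {{z. H \<tau> c z} | c. gd \<tau> c} \<longrightarrow> card {{z. H \<tau> c z} | c. gd \<tau> c} \<le> N"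
  proof (rule collection_bounded[where r = r and Z = O' and H = H and gd = gd])
    show "collection_uniform_finiteness K (carrier G) {S. eq_definable_set K S \<and> convex_subgroup S G}"
      using UF unfolding residue_field_uniform_finiteness_def definable_convex_subgroups_def G_def .
    show "definable_equiv K 1 QD" by (rule dD)
    show "carrier G \<subseteq> tuples 1 // QD"
    proof
      fix d assume "d \<in> carrier G"
      then obtain x where x: "d = r x" unfolding carrier by blast
      have "r x = QD `` {[x]}" unfolding QD_def r_def residue_class_def M_def[symmetric]
        using MD(3) by (auto simp: algebra_simps) (metis minus_diff_eq)+
      then show "d \<in> tuples 1 // QD" unfolding x by (simp add: quotientI)
    qed
    show "r ` O' \<subseteq> carrier G" unfolding carrier by simp
    have "\<rho> 0 \<in> O' \<and> map (\<lambda>i. \<rho> (Suc i)) [0..<1] \<in> r (\<rho> 0) \<longleftrightarrow> \<rho> 0 \<in> O' \<and>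
        (\<rho> (Suc 0) - \<rho> 0 = 0 \<or> inverse (\<rho> (Suc 0) - \<rho> 0) \<notin> O')" for \<rho> using r[of "\<rho> (Suc 0)" "\<rho> 0"] unfolding M_eq by simp
    then show "dfn K (es @ fs) (\<lambda>\<rho>. \<rho> 0 \<in> O' \<and> map (\<lambda>i. \<rho> (Suc i)) [0..<1] \<in> r (\<rho> 0))"
      by (simp only:) (intro dfn_intros O_app)
    show "dfn2 K (es @ fs) H" unfolding H_def below_def
      by (intro dfn_intros dfn_app2[where E = E, OF E])
    show "dfn K (es @ fs) (\<lambda>\<rho>. gd (\<lambda>i. \<rho> (Suc i)) (\<rho> 0))"
      unfolding gd_def res_good_def add_good_def cequiv_def Ball_def atLeast_iff
      by (intro dfn_intros dfn_app2[where E = E, OF E] O_app)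
    fix \<tau> c assume gd: "gd \<tau> c"
    then have res: "res_good O' (E \<tau>)" and c: "0 \<le> c" "\<not> E \<tau> 0 c" unfolding gd_def by blast+
    interpret add_equiv "E \<tau>" by unfold_locales (use res in \<open>simp add: res_good_def\<close>)
    have EM: "E \<tau> 0 x" if "0 \<le> x" "x \<in> M" for x using res that unfolding res_good_def M_eq by blast
    have EO: "E \<tau> x y" if "0 \<le> x" "0 \<le> y" "x \<notin> O'" "y \<notin> O'" for x y using res that unfolding res_good_def by blast
    have bM: "below (E \<tau>) c \<bar>x\<bar>" if "x \<in> M" for x
    proof -
      have "\<bar>x\<bar> \<in> M" by (rule MD(1)[OF that]) simp
      then have x: "E \<tau> 0 \<bar>x\<bar>" by (intro EM) auto
      have "\<not> c \<le> \<bar>x\<bar>" using conv0[of 0 c "\<bar>x\<bar>"] x c by auto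
      then have "\<bar>x\<bar> < c" by simp
      moreover have "\<not> E \<tau> \<bar>x\<bar> c" using trans0[of 0 "\<bar>x\<bar>" c] x c by auto
      ultimately show ?thesis unfolding below_def by simp
    qed
    \<comment> \<open>The nonnegative elements outside the ring form part of one class; if
      \<open>z\<close> were outside, so would be the larger \<open>c\<close>, and the two could not
      be separated.\<close>
    have HZ: "z \<in> O'" if "H \<tau> c z" for z
    proof (rule ccontr)
      assume "z \<notin> O'"
      then have z: "\<bar>z\<bar> \<notin> O'" using D(4)[of "\<bar>z\<bar>" z] by auto
      have b: "\<bar>z\<bar> < c" "\<not> E \<tau> \<bar>z\<bar> c" using that unfolding H_def below_def by blast+
      have "c \<notin> O'" using z D(4)[of c "\<bar>z\<bar>"] b(1) by auto
      then show False using EO[of "\<bar>z\<bar>" c] z c b by auto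
    qed
    then show "z \<in> O'" if "H \<tau> c z" for z using that .
    have Hadd: "H \<tau> c (x + y)" if "H \<tau> c x" "H \<tau> c y" for x y
      using below_down[OF below_add[OF that[unfolded H_def]], of "\<bar>x + y\<bar>"] abs_triangle_ineq[of x y] unfolding H_def by simp
    have HM: "H \<tau> c x" if "x \<in> M" for x using bM[OF that] unfolding H_def .
    have Hcong: "H \<tau> c y" if "H \<tau> c x" "y - x \<in> M" for x y using Hadd[OF that(1) HM[OF that(2)]] by simp
    show "H \<tau> c z'" if "H \<tau> c z" "z' \<in> O'" "r z' = r z" for z z' using Hcong[OF that(1)] that(3) r_eq by blast
    have Hneg: "H \<tau> c (- x)" if "H \<tau> c x" for x using that unfolding H_def by simp
    show "convex_subgroup (r ` {z. H \<tau> c z}) G" unfolding convex_subgroup_def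
    proof (intro conjI ballI impI)
      show "subgroup (r ` {z. H \<tau> c z}) G"
      proof
        show "r ` {z. H \<tau> c z} \<subseteq> carrier G" unfolding carrier using HZ by blast
        show "\<one>\<^bsub>G\<^esub> \<in> r ` {z. H \<tau> c z}" unfolding one using HM[OF M0] by blast
      next
        fix a b assume "a \<in> r ` {z. H \<tau> c z}" "b \<in> r ` {z. H \<tau> c z}"
        then obtain x y where "H \<tau> c x" "H \<tau> c y" "a = r x" "b = r y" by blast
        then show "a \<otimes>\<^bsub>G\<^esub> b \<in> r ` {z. H \<tau> c z}" using Hadd by (auto simp: mult)
      next
        fix a assume "a \<in> r ` {z. H \<tau> c z}"
        then obtain x where x: "H \<tau> c x" "a = r x" by blast
        have "inv\<^bsub>G\<^esub> a = r (- x)"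
          by (rule G.inv_equality) (use HZ[OF x(1)] minus in \<open>auto simp: x(2) mult one carrier\<close>)
        then show "inv\<^bsub>G\<^esub> a \<in> r ` {z. H \<tau> c z}" using Hneg[OF x(1)] by blast
      qed
      fix a b d assume "a \<in> r ` {z. H \<tau> c z}" "b \<in> r ` {z. H \<tau> c z}" "d \<in> carrier G" and le: "gle G a d \<and> gle G d b"
      then obtain x z y where x: "H \<tau> c x" "a = r x" and z: "H \<tau> c z" "b = r z" and y: "d = r y"
        unfolding carrier by blast
      obtain x1 y1 where 1: "x1 - x \<in> M" "y1 - y \<in> M" "x1 \<le> y1" using le unfolding gle x(2) y r by blast
      obtain y2 z2 where 2: "y2 - y \<in> M" "z2 - z \<in> M" "y2 \<le> z2" using le unfolding gle z(2) y r by blast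
      have "H \<tau> c x1" "H \<tau> c z2" using Hcong x(1) z(1) 1(1) 2(2) by blast+
      \<comment> \<open>The order of the residue field only compares some representatives.
        Corrections by elements of the ideal, which stay in the subgroup, enclose \<open>y\<close>
        itself between two elements of the subgroup.\<close>
      then have Hx: "H \<tau> c (x1 - (y1 - y))" "H \<tau> c (z2 - (y2 - y))"
        using Hadd[OF _ HM[OF MD(3)[OF 1(2)]], of x1] Hadd[OF _ HM[OF MD(3)[OF 2(1)]], of z2]
        by (simp_all only: diff_conv_add_uminus)
      have "x1 - (y1 - y) \<le> y" "y \<le> z2 - (y2 - y)" using 1(3) 2(3) by (simp_all add: algebra_simps)
      then have "\<bar>y\<bar> \<le> max \<bar>x1 - (y1 - y)\<bar> \<bar>z2 - (y2 - y)\<bar>" by linarith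
      moreover have "below (E \<tau>) c (max \<bar>x1 - (y1 - y)\<bar> \<bar>z2 - (y2 - y)\<bar>)" using Hx unfolding H_def by (simp add: max_def)
      ultimately have "H \<tau> c y" unfolding H_def using below_down by simp
      then show "d \<in> r ` {z. H \<tau> c z}" unfolding y by blast
    qed
  qed
  then obtain N where N: "\<And>\<tau>. finite {{z. H \<tau> c z} | c. gd \<tau> c} \<Longrightarrow> card {{z. H \<tau> c z} | c. gd \<tau> c} \<le> N"
    by blast
  have "idx (E \<tau>) {0..} (Suc N)" if g: "res_good (val_ring v) (E \<tau>)" and n: "idx (E \<tau>) {0..} m" for \<tau> m
  proof -
    interpret add_equiv "E \<tau>" by unfold_locales (use g in \<open>simp add: res_good_def\<close>)
    define S where "S c = {z. H \<tau> c z}" for c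
    define A where "A = {{z. H \<tau> c z} | c. gd \<tau> c}"
    have "S x = S y" if "x \<in> {0..}" "y \<in> {0..}" "E \<tau> x y" for x y
      using below_cong[of x y] below_cong[of y x] sym[OF that] that unfolding S_def H_def by auto
    then have fin: "finite (S ` {0..})" by (rule finite_image_idx[OF n])
    have "A \<subseteq> S ` {0..}" unfolding A_def S_def gd_def by auto
    then have finA: "finite A" by (rule finite_subset[OF _ fin])
    then have cA: "card A \<le> N" using N[of \<tau>] unfolding A_def by blast
    show ?thesis
    \<comment> \<open>One additional label, the empty set, is for the excluded class of 0.\<close>
    proof (rule idxI[where f = S and A = "insert {} A"])
      show "card (insert {} A) \<le> Suc N" using cA card_insert_le_m1[of "Suc N" A "{}"] by simp
      show "S ` {0..} \<subseteq> insert {} A"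
      proof (rule image_subsetI)
        fix c :: 'a assume c: "c \<in> {0..}"
        show "S c \<in> insert {} A"
        proof (cases "E \<tau> 0 c")
          case True
          have "\<not> below (E \<tau>) c w" for w unfolding below_def using conv20[of 0 w c] True by auto
          then show ?thesis unfolding S_def H_def by simp
        next
          case False
          then have "gd \<tau> c" using g c unfolding gd_def O'_def by auto
          then show ?thesis unfolding A_def S_def by blast
        qed
      qed
      show "E \<tau> x y" if "x \<in> {0..}" "y \<in> {0..}" "S x = S y" for x y
      proof (rule below_det)
        show "below (E \<tau>) x z \<longleftrightarrow> below (E \<tau>) y z" if "0 \<le> z" for z
        proof -
          have "z \<in> S x \<longleftrightarrow> z \<in> S y" using \<open>S x = S y\<close> by simp
          then show ?thesis unfolding S_def H_def using that by simp
        qed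
      qed (use that in auto)
    qed (use finA in simp)
  qed
  then show "\<exists>N. \<forall>\<tau> n. res_good (val_ring v) (E \<tau>) \<longrightarrow> idx (E \<tau>) {0..} n \<longrightarrow> idx (E \<tau>) {0..} N" by blast
qed

end

section \<open>The valuation of a convex subring\<close>

definition value_class :: "'a::linordered_field set \<Rightarrow> 'a \<Rightarrow> 'a list set" where
  "value_class O' x = {[y] | y. y \<noteq> 0 \<and> y / x \<in> O' \<and> x / y \<in> O'}"

text \<open>The value group is the multiplicative group modulo the units of the ring, with cosets as
  values, so its elements are imaginaries already. It lets a hypothesis on definable valuations be
  applied to a ring such as \<open>stab_ring\<close> that is found in the course of the
  proof.\<close>

definition ring_valuation :: "'a::linordered_field set \<Rightarrow> 'a valuation" where
  "ring_valuation O' = \<lparr>value_group = \<lparr>carrier = value_class O' ` (- {0}),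
      mult = (\<lambda>P Q. {[x * y] | x y. [x] \<in> P \<and> [y] \<in> Q}), one = value_class O' 1,
      gle = (\<lambda>P Q. \<exists>x y. [x] \<in> P \<and> [y] \<in> Q \<and> y / x \<in> O')\<rparr>, val = value_class O'\<rparr>"

locale conv_ring =
  fixes O' :: "'a::linordered_field set"
  assumes ring: "convex_ring O'"
begin

lemmas D = convex_ringD[OF ring]

abbreviation "G \<equiv> value_group (ring_valuation O')"
abbreviation "cls \<equiv> value_class O'"

lemma val: "val (ring_valuation O') = cls"
  unfolding ring_valuation_def by simp

lemma carrier: "carrier G = cls ` (- {0})" and one: "\<one>\<^bsub>G\<^esub> = cls 1"
  and mult_def: "P \<otimes>\<^bsub>G\<^esub> Q = {[x * y] | x y. [x] \<in> P \<and> [y] \<in> Q}"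
  and gle_def: "gle G P Q \<longleftrightarrow> (\<exists>x y. [x] \<in> P \<and> [y] \<in> Q \<and> y / x \<in> O')"
  unfolding ring_valuation_def by simp_all

lemma cls: "[y] \<in> cls x \<longleftrightarrow> y \<noteq> 0 \<and> y / x \<in> O' \<and> x / y \<in> O'"
  unfolding value_class_def by simp

lemma cls_list: "l \<in> cls x \<Longrightarrow> \<exists>y. l = [y]"
  unfolding value_class_def by blast

lemma cls_self: "x \<noteq> 0 \<Longrightarrow> [x] \<in> cls x"
  unfolding cls using D(1) by simp

lemma quot_trans: "y \<noteq> 0 \<Longrightarrow> x / y \<in> O' \<Longrightarrow> y / z \<in> O' \<Longrightarrow> x / z \<in> O'"
  using D(3)[of "x / y" "y / z"] by simp

lemma cls_eq: "x \<noteq> 0 \<Longrightarrow> y \<noteq> 0 \<Longrightarrow> cls x = cls y \<longleftrightarrow> x / y \<in> O' \<and> y / x \<in> O'"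
proof
  assume x: "x \<noteq> 0" "cls x = cls y"
  then show "x / y \<in> O' \<and> y / x \<in> O'" using cls_self[OF x(1)] unfolding cls by (metis cls)
next
  assume *: "x \<noteq> 0" "y \<noteq> 0" "x / y \<in> O' \<and> y / x \<in> O'"
  have "[z] \<in> cls x \<longleftrightarrow> [z] \<in> cls y" for z unfolding cls
    using quot_trans[of x z y] quot_trans[of y z x] quot_trans[of x y z] quot_trans[of y x z] * by blast
  then show "cls x = cls y" using cls_list by blast
qed

lemma mult: "x \<noteq> 0 \<Longrightarrow> y \<noteq> 0 \<Longrightarrow> cls x \<otimes>\<^bsub>G\<^esub> cls y = cls (x * y)"
proof (intro Set.set_eqI iffI)
  fix l assume xy: "x \<noteq> 0" "y \<noteq> 0" and "l \<in> cls x \<otimes>\<^bsub>G\<^esub> cls y"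
  then obtain a b where ab: "l = [a * b]" "[a] \<in> cls x" "[b] \<in> cls y" unfolding mult_def by blast
  then show "l \<in> cls (x * y)" using D(3)[of "a / x" "b / y"] D(3)[of "x / a" "y / b"] unfolding ab(1) cls by simp
next
  fix l assume xy: "x \<noteq> 0" "y \<noteq> 0" and l: "l \<in> cls (x * y)"
  then obtain z where z: "l = [z]" using cls_list by blast
  have "[z / y] \<in> cls x" using l xy unfolding z cls by (simp add: mult.commute)
  moreover have "l = [(z / y) * y]" using z xy by simp
  ultimately show "l \<in> cls x \<otimes>\<^bsub>G\<^esub> cls y" unfolding mult_def using cls_self[OF xy(2)] by blast
qed

lemma gle: "x \<noteq> 0 \<Longrightarrow> y \<noteq> 0 \<Longrightarrow> gle G (cls x) (cls y) \<longleftrightarrow> y / x \<in> O'"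
proof
  assume xy: "x \<noteq> 0" "y \<noteq> 0" "gle G (cls x) (cls y)"
  then obtain a b where ab: "[a] \<in> cls x" "[b] \<in> cls y" "b / a \<in> O'" unfolding gle_def by blast
  then show "y / x \<in> O'" using quot_trans[of b y a] quot_trans[of a y x] unfolding cls by blast
next
  assume "x \<noteq> 0" "y \<noteq> 0" "y / x \<in> O'"
  then show "gle G (cls x) (cls y)" unfolding gle_def using cls_self by blast
qed

lemma total: "x \<noteq> 0 \<Longrightarrow> y \<noteq> 0 \<Longrightarrow> y / x \<in> O' \<or> x / y \<in> O'"
proof -
  assume xy: "x \<noteq> 0" "y \<noteq> 0"
  show ?thesis
  proof (cases "\<bar>y\<bar> \<le> \<bar>x\<bar>")
    case True
    then have "\<bar>y / x\<bar> \<le> \<bar>1\<bar>" using xy by (simp add: abs_divide)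
    then show ?thesis using D(4)[OF D(1)] by blast
  next
    case False
    then have "\<bar>x / y\<bar> \<le> \<bar>1\<bar>" using xy by (simp add: abs_divide)
    then show ?thesis using D(4)[OF D(1)] by blast
  qed
qed

lemma is_valuation: "is_valuation (ring_valuation O')"
proof -
  have "comm_group G"
  proof (rule comm_groupI)
    fix P assume "P \<in> carrier G"
    then obtain x where x: "P = cls x" "x \<noteq> 0" unfolding carrier by blast
    then have "cls (inverse x) \<otimes>\<^bsub>G\<^esub> P = \<one>\<^bsub>G\<^esub>" unfolding one by (simp add: mult)
    then show "\<exists>Q\<in>carrier G. Q \<otimes>\<^bsub>G\<^esub> P = \<one>\<^bsub>G\<^esub>" unfolding carrier using x(2) by auto
  qed (auto simp: carrier one mult ac_simps)
  then have oag: "ordered_abelian_group G" unfolding ordered_abelian_group_def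
  proof (intro conjI ballI impI)
    fix P Q R assume "P \<in> carrier G" "Q \<in> carrier G" "R \<in> carrier G"
    then obtain x y z where *: "P = cls x" "x \<noteq> 0" "Q = cls y" "y \<noteq> 0" "R = cls z" "z \<noteq> 0" unfolding carrier by blast
    { show "gle G P P" unfolding * using gle[OF *(2,2)] * D(1) by simp }
    { show "gle G P Q \<and> gle G Q P \<Longrightarrow> P = Q" unfolding * using gle[OF *(2,4)] gle[OF *(4,2)] cls_eq[OF *(2,4)] by blast }
    { show "gle G P Q \<and> gle G Q R \<Longrightarrow> gle G P R" unfolding *
        using gle[OF *(2,4)] gle[OF *(4,6)] gle[OF *(2,6)] quot_trans[OF *(4)] by blast }
    { show "gle G P Q \<or> gle G Q P" unfolding * using gle[OF *(2,4)] gle[OF *(4,2)] total[OF *(2,4)] by blast }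
    { assume "gle G P Q"
      then have "y / x \<in> O'" unfolding * using gle[OF *(2,4)] by blast
      then show "gle G (P \<otimes>\<^bsub>G\<^esub> R) (Q \<otimes>\<^bsub>G\<^esub> R)" unfolding * mult[OF *(2,6)] mult[OF *(4,6)]
        using gle[of "x * z" "y * z"] *(2,4,6) by simp }
  qed
  have "gle G (cls x) (cls (x + y)) \<or> gle G (cls y) (cls (x + y))" if "x \<noteq> 0" "y \<noteq> 0" "x + y \<noteq> 0" for x y
  proof -
    have "(x + y) / x \<in> O'" if "y / x \<in> O'" "x \<noteq> 0" for x y using D(2)[OF D(1) that(1)] that(2) by (simp add: add_divide_distrib)
    from this[of y x] this[of x y] show ?thesis using total[OF that(1,2)] gle that by (auto simp: add.commute)
  qed
  then show ?thesis unfolding is_valuation_def val using oag mult by (simp add: carrier)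
qed

lemma val_ring: "val_ring (ring_valuation O') = O'"
proof -
  have "0 \<in> O'" using D(4)[OF D(1), of 0] by simp
  moreover have "gle G (cls 1) (cls x) \<longleftrightarrow> x \<in> O'" if "x \<noteq> 0" for x using gle[of 1 x] that by simp
  ultimately have "x = 0 \<or> gle G (cls 1) (cls x) \<longleftrightarrow> x \<in> O'" for x by (cases "x = 0") simp_all
  then show ?thesis unfolding val_ring_def val one by simp
qed

lemma definable:
  assumes Od: "dfn K es (\<lambda>\<rho>. \<rho> 0 \<in> O')" shows "definable_valuation K (ring_valuation O')"
proof -
  note O_app = dfn_unop[where D = "\<lambda>x. x \<in> O'", OF Od]
  \<comment> \<open>The sort must contain 0, which has no value; it gets a class of its own outside
    \<open>carrier G\<close>.\<close>
  define QD where "QD = {([x], [y]) | x y. (x = 0 \<and> y = 0) \<or> (x \<noteq> 0 \<and> y \<noteq> 0 \<and> x / y \<in> O' \<and> y / x \<in> O')}"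
  have eqD: "equiv (tuples 1) QD"
  proof (rule equivI)
    show "QD \<subseteq> tuples 1 \<times> tuples 1" unfolding QD_def by auto
    show "refl_on (tuples 1) QD" unfolding refl_on_def QD_def using D(1) by (auto simp: length_Suc_conv)
    show "sym QD" unfolding sym_def QD_def by auto
    show "trans QD"
    proof (rule transI)
      fix a b c assume "(a, b) \<in> QD" "(b, c) \<in> QD"
      then obtain x y z where *: "a = [x]" "c = [z]" "(x = 0 \<and> y = 0) \<or> (x \<noteq> 0 \<and> y \<noteq> 0 \<and> x / y \<in> O' \<and> y / x \<in> O')"
        "(y = 0 \<and> z = 0) \<or> (y \<noteq> 0 \<and> z \<noteq> 0 \<and> y / z \<in> O' \<and> z / y \<in> O')" unfolding QD_def by auto
      then have "(x = 0 \<and> z = 0) \<or> (x \<noteq> 0 \<and> z \<noteq> 0 \<and> x / z \<in> O' \<and> z / x \<in> O')"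
        using quot_trans[of y x z] quot_trans[of y z x] by blast
      then show "(a, c) \<in> QD" unfolding QD_def *(1,2) by blast
    qed
  qed
  have dD: "definable_equiv K 1 QD"
  proof (rule definable_equivI[OF eqD])
    have "(map \<rho> [0..<1], map (\<lambda>i. \<rho> (1 + i)) [0..<1]) \<in> QD \<longleftrightarrow>
        (\<rho> 0 = 0 \<and> \<rho> (Suc 0) = 0) \<or> (\<rho> 0 \<noteq> 0 \<and> \<rho> (Suc 0) \<noteq> 0 \<and> \<rho> 0 / \<rho> (Suc 0) \<in> O' \<and> \<rho> (Suc 0) / \<rho> 0 \<in> O')" for \<rho>
      unfolding QD_def by simp
    then show "dfn K es (\<lambda>\<rho>. (map \<rho> [0..<1], map (\<lambda>i. \<rho> (1 + i)) [0..<1]) \<in> QD)"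
      by (simp only:) (intro dfn_intros O_app)
  qed
  have "eq_definable_set K (carrier G)" unfolding eq_definable_set_def
  proof (intro exI conjI)
    show "definable_equiv K 1 QD" by (rule dD)
    show "carrier G \<subseteq> tuples 1 // QD"
    proof
      fix d assume "d \<in> carrier G"
      then obtain x where x: "d = cls x" "x \<noteq> 0" unfolding carrier by blast
      have "d = QD `` {[x]}" unfolding x(1) QD_def value_class_def using x(2) by auto
      then show "d \<in> tuples 1 // QD" by (simp add: quotientI)
    qed
    have U: "\<Union> (carrier G) = {[y] | y. y \<noteq> 0}"
    proof (intro Set.set_eqI iffI)
      fix l assume "l \<in> \<Union> (carrier G)"
      then show "l \<in> {[y] | y. y \<noteq> 0}" unfolding carrier value_class_def by blast
    next
      fix l assume "l \<in> {[y] | y. y \<noteq> (0::'a)}"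
      then show "l \<in> \<Union> (carrier G)" unfolding carrier using cls_self by blast
    qed
    have "map \<rho> [0..<1] \<in> {[y] | y. y \<noteq> 0} \<longleftrightarrow> \<rho> 0 \<noteq> 0" for \<rho> :: "nat \<Rightarrow> 'a" by simp
    moreover have "dfn K es (\<lambda>\<rho>. \<rho> 0 \<noteq> 0)" by (intro dfn_intros)
    ultimately have "dfn K es (\<lambda>\<rho>. map \<rho> [0..<1] \<in> {[y] | y. y \<noteq> 0})" by (simp only:)
    then show "definable K 1 (\<Union> (carrier G))" unfolding U by (rule dfn_imp_definable) auto
  qed
  moreover have "eq_definable_rel K {[a, b, a \<otimes>\<^bsub>G\<^esub> b] | a b. a \<in> carrier G \<and> b \<in> carrier G}"
  proof -
    define S where "S = {[a, b, c] | a b c. a \<noteq> 0 \<and> b \<noteq> 0 \<and> c \<noteq> 0 \<and> c / (a * b) \<in> O' \<and> (a * b) / c \<in> O'}"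
    have "pullback {[a, b, a \<otimes>\<^bsub>G\<^esub> b] | a b. a \<in> carrier G \<and> b \<in> carrier G} = S"
    proof (intro Set.set_eqI iffI)
      fix l assume "l \<in> pullback {[a, b, a \<otimes>\<^bsub>G\<^esub> b] | a b. a \<in> carrier G \<and> b \<in> carrier G}"
      then obtain xss P Q where xss: "l = concat xss" "list_all2 (\<in>) xss [P, Q, P \<otimes>\<^bsub>G\<^esub> Q]" "P \<in> carrier G" "Q \<in> carrier G"
        unfolding pullback_def by blast
      then obtain x y where xy: "P = cls x" "x \<noteq> 0" "Q = cls y" "y \<noteq> 0" unfolding carrier by blast
      obtain as bs cs where "xss = [as, bs, cs]" "as \<in> cls x" "bs \<in> cls y" "cs \<in> cls (x * y)"
        using xss(2) unfolding xy mult[OF xy(2,4)] by (auto simp: list_all2_Cons2)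
      moreover from this(2-4) obtain a b c where "as = [a]" "bs = [b]" "cs = [c]" using cls_list by blast
      ultimately have abc: "l = [a, b, c]" "[a] \<in> cls x" "[b] \<in> cls y" "[c] \<in> cls (x * y)"
        using xss(1) by simp_all
      then have *: "a \<noteq> 0" "b \<noteq> 0" "c \<noteq> 0" "a / x \<in> O'" "x / a \<in> O'" "b / y \<in> O'" "y / b \<in> O'" "c / (x * y) \<in> O'" "(x * y) / c \<in> O'"
        unfolding cls by blast+
      have ab: "(a * b) / (x * y) \<in> O'" "(x * y) / (a * b) \<in> O'" using D(3)[OF *(4,6)] D(3)[OF *(5,7)] by simp_all
      have "x * y \<noteq> 0" using xy by simp
      then have "c / (a * b) \<in> O'" "(a * b) / c \<in> O'" using quot_trans *(8,9) ab by blast+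
      then show "l \<in> S" unfolding S_def abc(1) using *(1-3) by blast
    next
      fix l assume "l \<in> S"
      then obtain a b c where abc: "l = concat [[a], [b], [c]]" "a \<noteq> 0" "b \<noteq> 0" "[c] \<in> cls (a * b)"
        unfolding S_def cls by auto
      then have "list_all2 (\<in>) [[a], [b], [c]] [cls a, cls b, cls a \<otimes>\<^bsub>G\<^esub> cls b]"
        using cls_self by (simp add: mult)
      moreover have "cls a \<in> carrier G" "cls b \<in> carrier G" unfolding carrier using abc by blast+
      ultimately show "l \<in> pullback {[a, b, a \<otimes>\<^bsub>G\<^esub> b] | a b. a \<in> carrier G \<and> b \<in> carrier G}"
        unfolding pullback_def using abc(1) by blast
    qed
    moreover have "definable K (Suc (Suc (Suc 0))) S"
    proof (rule dfn_imp_definable)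
      have "map \<rho> [0..<Suc (Suc (Suc 0))] \<in> S \<longleftrightarrow> \<rho> 0 \<noteq> 0 \<and> \<rho> (Suc 0) \<noteq> 0 \<and> \<rho> (Suc (Suc 0)) \<noteq> 0 \<and>
          \<rho> (Suc (Suc 0)) / (\<rho> 0 * \<rho> (Suc 0)) \<in> O' \<and> (\<rho> 0 * \<rho> (Suc 0)) / \<rho> (Suc (Suc 0)) \<in> O'" for \<rho>
        unfolding S_def by simp
      then show "dfn K es (\<lambda>\<rho>. map \<rho> [0..<Suc (Suc (Suc 0))] \<in> S)"
        by (simp only:) (intro dfn_intros O_app)
    qed (auto simp: S_def)
    ultimately show ?thesis unfolding eq_definable_rel_def by auto
  qed
  moreover have "eq_definable_rel K {[a, b] | a b. a \<in> carrier G \<and> b \<in> carrier G \<and> gle G a b}"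
  proof -
    define R where "R = {(a, b). a \<in> carrier G \<and> b \<in> carrier G \<and> gle G a b}"
    define S where "S = {[a, b] | a b. a \<noteq> 0 \<and> b \<noteq> 0 \<and> b / a \<in> O'}"
    have "{[a, b] | a b. a \<in> carrier G \<and> b \<in> carrier G \<and> gle G a b} = {[a, b] | a b. (a, b) \<in> R}"
      unfolding R_def by simp
    moreover have "pullback {[a, b] | a b. (a, b) \<in> R} = S" unfolding pullback_pairs
    proof (intro Set.set_eqI iffI)
      fix l assume "l \<in> {xs @ ys | xs ys x y. (x, y) \<in> R \<and> xs \<in> x \<and> ys \<in> y}"
      then obtain xs ys x y where l: "l = xs @ ys" "xs \<in> cls x" "ys \<in> cls y" "x \<noteq> 0" "y \<noteq> 0" "gle G (cls x) (cls y)"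
        unfolding R_def carrier by blast
      then obtain a b where ab: "xs = [a]" "ys = [b]" using cls_list by blast
      have "y / x \<in> O'" using gle[OF l(4,5)] l(6) by blast
      then have "b / a \<in> O'" "a \<noteq> 0" "b \<noteq> 0" using l(2-5) quot_trans[of x y a] quot_trans[of y b a] unfolding ab cls by blast+
      then show "l \<in> S" unfolding S_def l(1) ab by auto
    next
      fix l assume "l \<in> S"
      then obtain a b where ab: "l = [a] @ [b]" "a \<noteq> 0" "b \<noteq> 0" "b / a \<in> O'" unfolding S_def by auto
      then have "(cls a, cls b) \<in> R" unfolding R_def carrier using gle[OF ab(2,3)] by blast
      then show "l \<in> {xs @ ys | xs ys x y. (x, y) \<in> R \<and> xs \<in> x \<and> ys \<in> y}"
        using ab(1) cls_self[OF ab(2)] cls_self[OF ab(3)] by blast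
    qed
    moreover have "definable K (Suc (Suc 0)) S"
    proof (rule dfn_imp_definable)
      have "map \<rho> [0..<Suc (Suc 0)] \<in> S \<longleftrightarrow> \<rho> 0 \<noteq> 0 \<and> \<rho> (Suc 0) \<noteq> 0 \<and> \<rho> (Suc 0) / \<rho> 0 \<in> O'" for \<rho>
        unfolding S_def by simp
      then show "dfn K es (\<lambda>\<rho>. map \<rho> [0..<Suc (Suc 0)] \<in> S)" by (simp only:) (intro dfn_intros O_app)
    qed (auto simp: S_def)
    ultimately show ?thesis unfolding eq_definable_rel_def by auto
  qed
  moreover have "eq_definable_rel K {[{[x]}, cls x] | x. x \<noteq> 0}"
  proof -
    define R where "R = {({[x]}, cls x) | x. x \<noteq> 0}"
    define S where "S = {[x, y] | x y. x \<noteq> 0 \<and> y \<noteq> 0 \<and> y / x \<in> O' \<and> x / y \<in> O'}"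
    have "{[{[x]}, cls x] | x. x \<noteq> 0} = {[a, b] | a b. (a, b) \<in> R}" unfolding R_def by blast
    moreover have "pullback {[a, b] | a b. (a, b) \<in> R} = S" unfolding pullback_pairs
    proof (intro Set.set_eqI iffI)
      fix l assume "l \<in> {xs @ ys | xs ys x y. (x, y) \<in> R \<and> xs \<in> x \<and> ys \<in> y}"
      then obtain ys x where l: "l = [x] @ ys" "ys \<in> cls x" "x \<noteq> 0" unfolding R_def by blast
      then obtain y where "ys = [y]" using cls_list by blast
      then show "l \<in> S" unfolding S_def using l cls by auto
    next
      fix l assume "l \<in> S"
      then obtain x y where xy: "l = [x] @ [y]" "x \<noteq> 0" "[y] \<in> cls x" unfolding S_def cls by auto
      then have "({[x]}, cls x) \<in> R" unfolding R_def by blast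
      then show "l \<in> {xs @ ys | xs ys x y. (x, y) \<in> R \<and> xs \<in> x \<and> ys \<in> y}" using xy(1,3) by blast
    qed
    moreover have "definable K (Suc (Suc 0)) S"
    proof (rule dfn_imp_definable)
      have "map \<rho> [0..<Suc (Suc 0)] \<in> S \<longleftrightarrow> \<rho> 0 \<noteq> 0 \<and> \<rho> (Suc 0) \<noteq> 0 \<and> \<rho> (Suc 0) / \<rho> 0 \<in> O' \<and> \<rho> 0 / \<rho> (Suc 0) \<in> O'" for \<rho>
        unfolding S_def by simp
      then show "dfn K es (\<lambda>\<rho>. map \<rho> [0..<Suc (Suc 0)] \<in> S)" by (simp only:) (intro dfn_intros O_app)
    qed (auto simp: S_def)
    ultimately show ?thesis unfolding eq_definable_rel_def by auto
  qed
  ultimately show ?thesis unfolding definable_valuation_def Let_def val using is_valuation by blast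
qed

end

section \<open>The implications between the conditions\<close>

context wom
begin

text \<open>The field itself is the valuation ring of the trivial valuation. This serves as the
  witness in (3), and it is the valuation to which (5) is applied.\<close>

lemma trivial_valuation:
  "definable_valuation K (ring_valuation (UNIV :: 'a set))" "val_ring (ring_valuation (UNIV :: 'a set)) = UNIV"
proof -
  interpret conv_ring "UNIV :: 'a set" by unfold_locales (simp add: convex_ring_def)
  have "dfn K [] (\<lambda>\<rho>. \<rho> 0 = \<rho> 0)" by (intro dfn_intros)
  then have "dfn K [] (\<lambda>\<rho>. \<rho> 0 \<in> UNIV)" by simp
  then show "definable_valuation K (ring_valuation (UNIV :: 'a set))" by (rule definable)
  show "val_ring (ring_valuation (UNIV :: 'a set)) = UNIV" by (rule val_ring)
qed

lemma collection_if_eq_uniform_finiteness: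
  "eq_uniform_finiteness K \<Longrightarrow> collection_uniform_finiteness K D \<D>"
  unfolding collection_uniform_finiteness_def imaginaries_from_def eq_uniform_finiteness_def by blast

lemma eq_if_add_bounded: "unif_bounded K {0..} add_good \<Longrightarrow> eq_uniform_finiteness K"
  by (rule eq_uniform_finiteness_if_bounded[OF cut_bounded])

text \<open>Each definable convex ring that comes up as a ring of scalars is made into a definable
  valuation, whose value group the hypothesis controls.\<close>

lemma eq_if_value_groups:
  assumes "\<And>v. definable_valuation K v \<Longrightarrow> value_group_uniform_finiteness K v"
  shows "eq_uniform_finiteness K"
proof (rule eq_if_add_bounded[OF add_bounded_if_val_bounded])
  fix O' :: "'a set" and es assume O': "convex_ring O'" "dfn K es (\<lambda>\<rho>. \<rho> 0 \<in> O')"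
  interpret conv_ring O' by unfold_locales (rule O'(1))
  show "unif_bounded K {1..} (val_good O')"
    using val_bounded[OF definable[OF O'(2)] assms[OF definable[OF O'(2)]]] unfolding val_ring .
qed

lemma eq_if_value_bounded:
  assumes v: "definable_valuation K v" and V: "unif_bounded K {1..} (val_good (val_ring v))"
    and R: "residue_field_uniform_finiteness K v"
  shows "eq_uniform_finiteness K"
proof -
  obtain fs where "dfn K fs (\<lambda>\<rho>. \<rho> 0 \<in> val_ring v)" using definable_valuationD[OF v] by blast
  then show ?thesis
    by (rule eq_if_add_bounded[OF add_bounded_if_val_res_bounded[OF val_ring_convex[OF v] _ V res_bounded[OF v R]]])
qed

lemma eq_if_residue_fields:
  assumes "\<And>v. definable_valuation K v \<Longrightarrow> residue_field_uniform_finiteness K v"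
  shows "eq_uniform_finiteness K"
proof (rule eq_if_value_bounded[OF trivial_valuation(1) _ assms[OF trivial_valuation(1)]])
  \<comment> \<open>For the trivial valuation all nonzero elements are units, so
    \<open>val_good\<close> leaves a single class and the value group contributes no cuts.\<close>
  have "idx E {1..} 1" if g: "val_good (UNIV :: 'a set) E" for E
  proof -
    interpret val_equiv UNIV E by unfold_locales (rule g)
    have "E x y" if "x \<in> {1..}" "y \<in> {1..}" for x y
      using trans[of x 1 y] sym[of 1 x] unit[of x] unit[of y] that by auto
    then show ?thesis unfolding idx_def by (intro exI[of _ "\<lambda>_. 0"]) auto
  qed
  then show "unif_bounded K {1..} (val_good (val_ring (ring_valuation (UNIV :: 'a set))))"
    unfolding unif_bounded_def trivial_valuation(2) by blast
qed

end

theorem corollary3p12: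
  fixes K :: "('a::linordered_field, 'f, 'r) expansion"
  assumes "weakly_o_minimal K"
    and "aleph0_saturated K"
  shows "(eq_uniform_finiteness K \<longleftrightarrow>
            (\<forall>v. definable_valuation K v \<longrightarrow>
               value_group_uniform_finiteness K v \<and> residue_field_uniform_finiteness K v)) \<and>
         (eq_uniform_finiteness K \<longleftrightarrow>
            (\<exists>v. definable_valuation K v \<and>
               value_group_uniform_finiteness K v \<and> residue_field_uniform_finiteness K v)) \<and>
         (eq_uniform_finiteness K \<longleftrightarrow>
            (\<forall>v. definable_valuation K v \<longrightarrow> value_group_uniform_finiteness K v)) \<and>
         (eq_uniform_finiteness K \<longleftrightarrow>
            (\<forall>v. definable_valuation K v \<longrightarrow> residue_field_uniform_finiteness K v))"
proof -
  interpret wom K by unfold_locales (rule assms)+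
  have 1: "value_group_uniform_finiteness K v" "residue_field_uniform_finiteness K v"
    if "eq_uniform_finiteness K" for v
    unfolding value_group_uniform_finiteness_def residue_field_uniform_finiteness_def
    by (rule collection_if_eq_uniform_finiteness[OF that])+
  have 3: "eq_uniform_finiteness K" if "definable_valuation K v" "value_group_uniform_finiteness K v"
    "residue_field_uniform_finiteness K v" for v
    by (rule eq_if_value_bounded[OF that(1) val_bounded[OF that(1,2)] that(3)])
  \<comment> \<open>Existence in (3) follows from (1) through the trivial valuation.\<close>
  show ?thesis
    using 1 3 eq_if_value_groups eq_if_residue_fields trivial_valuation(1) by blast
qed

end
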